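(* Let $\gamma>0$, $0<r\le1$, and let $\Lambda^{(2)}_*$ be the multiplier operator associated with $\lambda^{(2),*}_{m,n}=e^{-\gamma(m+n)^r}$, $m,n\in\mathbb{N}$. Then for all $k\in\mathbb{N}$ $$d_k(\Lambda^{(2)}_*U_p,L^q)\gg e^{-\mathcal{R}_*k^{r/(2d-1)}}\vartheta_k,$$ where $$\mathcal{R}_*=\gamma\Big(\frac{(2d-1)!}{2}\Big)^{r/(2d-1)},\qquad \vartheta_k=\begin{cases}1,&1\le p\le2,\ 1<q\le2,\\1,&2\le p<\infty,\ 2\le q\le\infty,\\1,&1\le p\le2\le q\le\infty,\\(\ln k)^{-1/2},&1\le p\le2,\ q=1,\\(\ln k)^{-1/2},&p=\infty,\ 2\le q\le\infty.\end{cases}$$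
   Context: $\mathbb{N}=\{0,1,2,\dots\}$; $d\ge2$ is a fixed integer. The notation $a_k\gg b_k$ means that there is a constant $C>0$, independent of $k$, with $a_k\ge Cb_k$; here it is understood for $k\ge2$. $\Omega_d$ is the unit sphere of $\mathbb{C}^d$ with surface measure $\sigma_d$ (the Lebesgue surface measure of $S^{2d-1}\subset\mathbb{R}^{2d}$ under $\mathbb{C}^d\cong\mathbb{R}^{2d}$). $L^p=L^p(\Omega_d)$ is the usual space of complex-valued functions, with closed unit ball $U_p$. $\mathcal{H}_{m,n}$ is the space of restrictions to $\Omega_d$ of polynomials in $z,\bar z$ homogeneous of degree $m$ in $z$ and degree $n$ in $\bar z$ and in the kernel of $4\sum_j\partial^2/\partial z_j\partial\bar z_j$. Let $Z_w^{(m,n)}$ be the reproducing kernel of $\mathcal{H}_{m,n}$ at $w\in\Omega_d$, and $(\varphi*\widetilde Z^{(m,n)})(w)=\int_{\Omega_d}\varphi\,\overline{Z_w^{(m,n)}}\,d\sigma_d$ (the orthogonal projection onto $\mathcal{H}_{m,n}$ on $L^2$). The multiplier operator $\Lambda$ associated with $\{\lambda_{m,n}\}$ sends $\varphi$ to the function $\Lambda\varphi$ with formal expansion $\Lambda\varphi\sim\sum_{m,n}\lambda_{m,n}\varphi*\widetilde Z^{(m,n)}$. Kolmogorov width: $d_n(A,X)=\inf_{X_n}\sup_{x\in A}\inf_{y\in X_n}\|x-y\|_X$, $X_n$ ranging over the subspaces of $X$ of dimension $n$. *)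

theory Defs
  imports "HOL-Probability.Probability"
begin

text \<open>
  The space \<open>\<complex>\<^sup>d\<close> is \<^typ>\<open>complex ^ 'd\<close>, with \<open>d = CARD('d)\<close>. Functions on its unit sphere are
  represented by functions on the whole space of which only the values on the sphere matter;
  equality of classes in \<open>L\<^sup>p\<close> is equality almost everywhere with respect to \<open>sphere_measure\<close>.
\<close>

subsection \<open>Surface measure\<close>

text \<open>
  The surface measure of \<open>A\<close> is the real dimension \<open>2 d\<close> times the volume of the cone
  \<open>{t x | 0 < t \<le> 1, x \<in> A}\<close> (integration in polar coordinates), i.e. the image under
  \<open>z \<mapsto> z / norm z\<close> of Lebesgue measure on the punctured unit ball, scaled by \<open>2 d\<close>; see
  \<open>emeasure_sphere_measure\<close> below.
\<close>

definition sphere_measure :: "(complex ^ 'd::finite) measure" where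
  "sphere_measure =
     scale_measure (ennreal (2 * real CARD('d)))
       (distr (restrict_space lborel (cball 0 1 - {0})) (restrict_space borel (sphere 0 1)) sgn)"

lemma space_sphere_measure: "space sphere_measure = sphere 0 1"
  by (simp add: sphere_measure_def space_restrict_space space_scale_measure)

lemma sets_sphere_measure:
  "sets sphere_measure = sets (restrict_space borel (sphere 0 1))"
  by (simp add: sphere_measure_def)

lemma emeasure_sphere_measure:
  fixes A :: "(complex ^ 'd::finite) set"
  assumes A: "A \<in> sets sphere_measure"
  shows "emeasure sphere_measure A =
    ennreal (2 * real CARD('d)) * emeasure lborel {t *\<^sub>R x | t x. 0 < t \<and> t \<le> 1 \<and> x \<in> A}"
proof -
  let ?B = "cball 0 1 - {0} :: (complex ^ 'd) set"
  have B: "?B \<in> sets borel" by auto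
  have A': "A \<in> sets (restrict_space borel (sphere 0 1))"
    using A by (simp add: sets_sphere_measure)
  have As: "A \<subseteq> sphere 0 1"
    using sets.sets_into_space[OF A] by (simp add: space_sphere_measure)
  have cont: "continuous_on ?B sgn"
    unfolding sgn_div_norm by (intro continuous_intros) auto
  have m1: "sgn \<in> borel_measurable (restrict_space borel ?B)"
    using cont by (rule borel_measurable_continuous_on_restrict)
  have m: "sgn \<in> measurable (restrict_space lborel ?B) (restrict_space borel (sphere 0 1))"
    using m1 by (intro measurable_restrict_space2)
      (auto simp: space_restrict_space norm_sgn measurable_def sets_restrict_space)
  have eq: "sgn -` A \<inter> ?B = {t *\<^sub>R x | t x. 0 < t \<and> t \<le> 1 \<and> x \<in> A}"
  proof (intro set_eqI iffI)
    fix z assume "z \<in> sgn -` A \<inter> ?B"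
    then show "z \<in> {t *\<^sub>R x | t x. 0 < t \<and> t \<le> 1 \<and> x \<in> A}"
      by (intro CollectI exI[of _ "norm z"] exI[of _ "sgn z"]) (auto simp: sgn_div_norm)
  next
    fix z assume "z \<in> {t *\<^sub>R x | t x. 0 < t \<and> t \<le> 1 \<and> x \<in> A}"
    then obtain t x where tx: "z = t *\<^sub>R x" "0 < t" "t \<le> 1" "x \<in> A" by auto
    then have "norm x = 1" using As by auto
    then show "z \<in> sgn -` A \<inter> ?B" using tx by (auto simp: sgn_div_norm)
  qed
  have "emeasure sphere_measure A = ennreal (2 * real CARD('d)) *
      emeasure (restrict_space lborel ?B) (sgn -` A \<inter> ?B)"
    using A' m by (simp add: sphere_measure_def emeasure_distr space_restrict_space)
  also have "emeasure (restrict_space lborel ?B) (sgn -` A \<inter> ?B)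
      = emeasure lborel (sgn -` A \<inter> ?B)"
    using B by (intro emeasure_restrict_space) auto
  finally show ?thesis unfolding eq .
qed

subsection \<open>Lebesgue spaces and Kolmogorov widths\<close>

text \<open>\<open>\<infinity>\<close> is an admissible exponent and also an admissible value of the norm.\<close>

definition Lp_norm :: "ennreal \<Rightarrow> (complex ^ 'd::finite \<Rightarrow> complex) \<Rightarrow> ennreal" where
  "Lp_norm p f =
     (if p = \<infinity> then esssup sphere_measure (\<lambda>x. ennreal (norm (f x)))
      else let I = (\<integral>\<^sup>+x. ennreal (norm (f x) powr enn2real p) \<partial>sphere_measure)
        in if I = \<infinity> then \<infinity> else ennreal (enn2real I powr (1 / enn2real p)))"

definition Lp_space :: "ennreal \<Rightarrow> (complex ^ 'd::finite \<Rightarrow> complex) set" where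
  "Lp_space p = {f \<in> borel_measurable sphere_measure. Lp_norm p f < \<infinity>}"

definition Lp_ball :: "ennreal \<Rightarrow> (complex ^ 'd::finite \<Rightarrow> complex) set" where
  "Lp_ball p = {f \<in> Lp_space p. Lp_norm p f \<le> 1}"

text \<open>
  The \<open>n\<close>-dimensional complex subspaces of \<open>L\<^sup>q\<close>. The generating functions are linearly independent as
  elements of \<open>L\<^sup>q\<close>, that is modulo functions vanishing almost everywhere.
\<close>

definition Lp_subspaces :: "ennreal \<Rightarrow> nat \<Rightarrow> (complex ^ 'd::finite \<Rightarrow> complex) set set" where
  "Lp_subspaces q n =
     {{\<lambda>x. \<Sum>i<n. c i * g i x | c :: nat \<Rightarrow> complex. True} | g.
        (\<forall>i<n. g i \<in> Lp_space q) \<and>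
        (\<forall>c :: nat \<Rightarrow> complex.
           (AE x in sphere_measure. (\<Sum>i<n. c i * g i x) = 0) \<longrightarrow> (\<forall>i<n. c i = 0))}"

definition kolmogorov_width ::
    "nat \<Rightarrow> (complex ^ 'd::finite \<Rightarrow> complex) set \<Rightarrow> ennreal \<Rightarrow> ennreal" where
  "kolmogorov_width n A q =
     (INF X\<in>Lp_subspaces q n. SUP x\<in>A. INF y\<in>X. Lp_norm q (\<lambda>z. x z - y z))"

subsection \<open>Bihomogeneous spherical harmonics\<close>

definition bihomogeneous_polys ::
    "nat \<Rightarrow> nat \<Rightarrow> (complex ^ 'd::finite \<Rightarrow> complex) set" where
  "bihomogeneous_polys m n =
     {\<lambda>z. \<Sum>\<alpha> | sum \<alpha> UNIV = m. \<Sum>\<beta> | sum \<beta> UNIV = n.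
         c \<alpha> \<beta> * (\<Prod>j\<in>UNIV. (z $ j) ^ \<alpha> j) * (\<Prod>j\<in>UNIV. cnj (z $ j) ^ \<beta> j)
      | c :: ('d \<Rightarrow> nat) \<Rightarrow> ('d \<Rightarrow> nat) \<Rightarrow> complex. True}"

text \<open>The index sets of the sums above are finite, so the sums are genuine.\<close>

lemma finite_multiindices: "finite {\<alpha> :: 'd::finite \<Rightarrow> nat. sum \<alpha> UNIV = m}"
proof (rule finite_subset)
  show "{\<alpha> :: 'd \<Rightarrow> nat. sum \<alpha> UNIV = m} \<subseteq> PiE UNIV (\<lambda>_. {..m})"
    by (auto intro: member_le_sum)
qed (intro finite_PiE; simp)

text \<open>The Wirtinger derivatives \<open>\<partial>/\<partial>z\<^sub>j = (\<partial>/\<partial>x\<^sub>j - \<i> \<partial>/\<partial>y\<^sub>j) / 2\<close> and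
  \<open>\<partial>/\<partial>\<bar>z\<^sub>j = (\<partial>/\<partial>x\<^sub>j + \<i> \<partial>/\<partial>y\<^sub>j) / 2\<close>, where \<open>z\<^sub>j = x\<^sub>j + \<i> y\<^sub>j\<close>.\<close>

definition d_z ::
    "'d \<Rightarrow> (complex ^ 'd::finite \<Rightarrow> complex) \<Rightarrow> complex ^ 'd \<Rightarrow> complex" where
  "d_z j f z = (frechet_derivative f (at z) (axis j 1)
                - \<i> * frechet_derivative f (at z) (axis j \<i>)) / 2"

definition d_zbar ::
    "'d \<Rightarrow> (complex ^ 'd::finite \<Rightarrow> complex) \<Rightarrow> complex ^ 'd \<Rightarrow> complex" where
  "d_zbar j f z = (frechet_derivative f (at z) (axis j 1)
                   + \<i> * frechet_derivative f (at z) (axis j \<i>)) / 2"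

definition complex_laplacian ::
    "(complex ^ 'd::finite \<Rightarrow> complex) \<Rightarrow> complex ^ 'd \<Rightarrow> complex" where
  "complex_laplacian f z = 4 * (\<Sum>j\<in>UNIV. d_z j (d_zbar j f) z)"

text \<open>Restriction to the sphere is encoded by the value \<open>0\<close> off the sphere, so that an element of
  \<open>harmonics m n\<close> is determined by its values on the sphere.\<close>

definition harmonics :: "nat \<Rightarrow> nat \<Rightarrow> (complex ^ 'd::finite \<Rightarrow> complex) set" where
  "harmonics m n =
     {\<lambda>z. if z \<in> sphere 0 1 then f z else 0 | f.
        f \<in> bihomogeneous_polys m n \<and> (\<forall>z. complex_laplacian f z = 0)}"

definition reproducing_kernel ::
    "nat \<Rightarrow> nat \<Rightarrow> complex ^ 'd::finite \<Rightarrow> complex ^ 'd \<Rightarrow> complex" where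
  "reproducing_kernel m n w =
     (THE Z. Z \<in> harmonics m n \<and>
        (\<forall>f\<in>harmonics m n. f w = (\<integral>x. f x * cnj (Z x) \<partial>sphere_measure)))"

definition harmonic_projection ::
    "nat \<Rightarrow> nat \<Rightarrow> (complex ^ 'd::finite \<Rightarrow> complex) \<Rightarrow> complex ^ 'd \<Rightarrow> complex" where
  "harmonic_projection m n \<phi> w =
     (\<integral>x. \<phi> x * cnj (reproducing_kernel m n w x) \<partial>sphere_measure)"

subsection \<open>Multiplier operators\<close>

text \<open>
  The function with formal expansion \<open>\<Sum>\<^sub>m\<^sub>,\<^sub>n \<lambda>\<^sub>m\<^sub>,\<^sub>n \<phi> * Z\<^sup>(\<^sup>m\<^sup>,\<^sup>n\<^sup>)\<close> is the integrable function
  whose component in each space of harmonics is the prescribed one. It is determined up to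
  equality almost everywhere; the value of the operator is the set of all its representatives.
\<close>

definition multiplier_op ::
    "(nat \<Rightarrow> nat \<Rightarrow> complex) \<Rightarrow> (complex ^ 'd::finite \<Rightarrow> complex)
       \<Rightarrow> (complex ^ 'd \<Rightarrow> complex) set" where
  "multiplier_op lam \<phi> =
     {\<psi> \<in> Lp_space 1. \<forall>m n. \<forall>w\<in>sphere 0 1.
        harmonic_projection m n \<psi> w = lam m n * harmonic_projection m n \<phi> w}"

definition multiplier_image ::
    "(nat \<Rightarrow> nat \<Rightarrow> complex) \<Rightarrow> (complex ^ 'd::finite \<Rightarrow> complex) set
       \<Rightarrow> (complex ^ 'd \<Rightarrow> complex) set" where
  "multiplier_image lam A = (\<Union>\<phi>\<in>A. multiplier_op lam \<phi>)"

definition exp_multiplier :: "real \<Rightarrow> real \<Rightarrow> nat \<Rightarrow> nat \<Rightarrow> complex" where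
  "exp_multiplier \<gamma> r m n = of_real (exp (- \<gamma> * real (m + n) powr r))"

subsection \<open>Constants of the estimate\<close>

definition R_star :: "nat \<Rightarrow> real \<Rightarrow> real \<Rightarrow> real" where
  "R_star d \<gamma> r = \<gamma> * (fact (2 * d - 1) / 2) powr (r / real (2 * d - 1))"

text \<open>The factor \<open>\<vartheta>\<^sub>k\<close> is given by cases only for these exponents; the value \<open>0\<close> elsewhere is a
  dummy.\<close>

definition theta_domain :: "ennreal \<Rightarrow> ennreal \<Rightarrow> bool" where
  "theta_domain p q \<longleftrightarrow>
     1 \<le> p \<and> p \<le> 2 \<and> 1 < q \<and> q \<le> 2 \<or>
     2 \<le> p \<and> p < \<infinity> \<and> 2 \<le> q \<and> q \<le> \<infinity> \<or>
     1 \<le> p \<and> p \<le> 2 \<and> 2 \<le> q \<and> q \<le> \<infinity> \<or>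
     1 \<le> p \<and> p \<le> 2 \<and> q = 1 \<or>
     p = \<infinity> \<and> 2 \<le> q \<and> q \<le> \<infinity>"

definition theta :: "ennreal \<Rightarrow> ennreal \<Rightarrow> nat \<Rightarrow> real" where
  "theta p q k =
     (if 1 \<le> p \<and> p \<le> 2 \<and> 1 < q \<and> q \<le> 2 then 1
      else if 2 \<le> p \<and> p < \<infinity> \<and> 2 \<le> q \<and> q \<le> \<infinity> then 1
      else if 1 \<le> p \<and> p \<le> 2 \<and> 2 \<le> q \<and> q \<le> \<infinity> then 1
      else if 1 \<le> p \<and> p \<le> 2 \<and> q = 1 then ln (real k) powr (- 1 / 2)
      else if p = \<infinity> \<and> 2 \<le> q \<and> q \<le> \<infinity> then ln (real k) powr (- 1 / 2)
      else 0)"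

end

theory Submission
  imports Defs
begin

text \<open>
  The proof is by duality. If \<open>f\<close> is orthogonal to a subspace \<open>X\<close> of \<open>L\<^sup>q\<close>, then
  every \<open>\<psi>\<close> has distance at least \<open>|\<langle>\<psi>, f\<rangle>| / \<parallel>f\<parallel>\<^sub>q\<^sub>'\<close> from \<open>X\<close>, where \<open>q'\<close> is the
  conjugate exponent (\<open>kolmogorov_width_lower\<close>). So for each \<open>X\<close> of dimension \<open>k\<close> it
  suffices to find one good pair.

  Let \<open>T\<^sub>M\<close> be the space of restrictions to the sphere of polynomials of degree at most \<open>M\<close>. It has an
  orthonormal basis of harmonics, on which the multiplier \<open>\<Lambda>\<close> is diagonal. A space of elements of
  \<open>T\<^sub>M\<close> defined by \<open>k\<close> linear equations has an orthonormal family \<open>g\<^sub>1, \<dots>, g\<^sub>m\<close> with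
  \<open>m \<ge> dim T\<^sub>M - k\<close>. Put \<open>G = \<Sum>\<^sub>i \<plusminus> g\<^sub>i\<close> and \<open>F = \<Lambda>\<^sup>-\<^sup>1 G\<close>. Then \<open>\<parallel>G\<parallel>\<^sub>2\<^sup>2 = m\<close> for all signs.
  By Bessel's inequality \<open>\<Sum>\<^sub>i |\<Lambda>\<^sup>-\<^sup>1 g\<^sub>i (x)|\<^sup>2\<close> is at most
  \<open>B = \<Sum>\<^sub>l exp (2 \<gamma> l\<^sup>r) \<kappa>\<^sub>l (x)\<close>, where \<open>\<kappa>\<^sub>l\<close> is the reproducing kernel of the harmonics of degree
  \<open>l \<le> M\<close> on the diagonal. It is constant, namely the dimension divided by the mass of the sphere, as the unitary group acts transitively
  (\<open>kernel_diagonal_constant\<close>). Khintchine's inequality now gives signs with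
  \<open>\<parallel>F\<parallel>\<^sub>2\<^sub>n \<le> C (n B)\<^sup>1\<^sup>/\<^sup>2\<close> (\<open>random_combination\<close>).

  It remains to choose \<open>M\<close> so that \<open>B / m\<close> is at most a constant times \<open>exp (2 \<gamma> N\<^sup>r)\<close> with
  \<open>N\<close> barely large enough for \<open>dim T\<^sub>N \<ge> k\<close>. The weights \<open>exp (2 \<gamma> l\<^sup>r)\<close> are comparable only over the
  last \<open>N\<^sup>1\<^sup>-\<^sup>r\<close> or so levels, so \<open>M = N + b\<close> with \<open>b\<close> of this order does it: the \<open>b\<close> levels above
  \<open>N\<close> provide \<open>m\<close>, and they account for a fixed proportion of \<open>B\<close>
  (\<open>degree_choice\<close>). The expansion \<open>dim T\<^sub>N = 2 N\<^sup>D / D! + \<dots>\<close> with \<open>D = 2 d - 1\<close> turns \<open>\<gamma> N\<^sup>r\<close>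
  into the exponent of the theorem, up to a bounded summand since \<open>r \<le> 1\<close>.

  For \<open>q \<ge> 2\<close> the image \<open>G / \<parallel>F\<parallel>\<^sub>p\<close> of \<open>F / \<parallel>F\<parallel>\<^sub>p\<close> is paired with \<open>G\<close>
  (\<open>width_lower_by_ball_norm\<close>). For \<open>p, q \<le> 2\<close> the image \<open>\<Lambda> G\<close> of \<open>G\<close> is paired with \<open>F\<close>
  (\<open>width_lower_by_functional\<close>). In both cases only one norm of \<open>F\<close> with exponent \<open>p\<close> or \<open>q'\<close> matters.
  If that exponent is infinite, the polynomial \<open>F\<^sup>n\<close> of degree \<open>n M\<close> shows that
  \<open>\<parallel>F\<parallel>\<^sub>\<infinity>\<close> is at most \<open>\<parallel>F\<parallel>\<^sub>2\<^sub>n\<close> times a constant and the \<open>2 n\<close>-th root of \<open>dim T\<^sub>n\<^sub>M\<close>. This root is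
  bounded for \<open>n\<close> of the order \<open>ln k\<close>, and the factor \<open>n\<^sup>1\<^sup>/\<^sup>2\<close> produces \<open>(ln k)\<^sup>-\<^sup>1\<^sup>/\<^sup>2\<close>
  (\<open>exists_small_sup_polynomial\<close>).

  The facts about harmonics come from the invariance of the surface measure under unitary maps. Differentiating
  it yields an integration by parts on the sphere (\<open>integral_coord_mult\<close>), and this makes the harmonics of
  different bidegrees orthogonal (\<open>harmonic_orthogonal\<close>). Counting the equations that express harmonicity
  bounds the numbers of harmonics from below, and these bounds add up to the dimension of \<open>T\<^sub>M\<close>; so the
  harmonics are a basis of it (\<open>exists_harmonic_system\<close>).
\<close>

section \<open>Invariance of the surface measure\<close>

lemma nn_integral_lborel_shift:
  fixes f :: "'a::euclidean_space \<Rightarrow> ennreal"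
  assumes [measurable]: "f \<in> borel_measurable borel"
  shows "(\<integral>\<^sup>+x. f (c + x) \<partial>lborel) = (\<integral>\<^sup>+x. f x \<partial>lborel)"
proof -
  have "(\<integral>\<^sup>+x. f x \<partial>lborel) = (\<integral>\<^sup>+x. f x \<partial>distr lborel borel ((+) c))"
    by (simp add: lborel_distr_plus)
  also have "\<dots> = (\<integral>\<^sup>+x. f (c + x) \<partial>lborel)"
    by (subst nn_integral_distr) auto
  finally show ?thesis by simp
qed

lemma nn_integral_lborel_reflect:
  fixes f :: "'a::euclidean_space \<Rightarrow> ennreal"
  assumes [measurable]: "f \<in> borel_measurable borel"
  shows "(\<integral>\<^sup>+x. f (c - x) \<partial>lborel) = (\<integral>\<^sup>+x. f x \<partial>lborel)"
proof -
  have *: "lborel = density (distr lborel borel (\<lambda>x::'a. c + (-1) *\<^sub>R x)) (\<lambda>_. 1)"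
    using lborel_affine[of "-1" c] by simp
  have "(\<integral>\<^sup>+x. f x \<partial>lborel) = (\<integral>\<^sup>+x. f x \<partial>distr lborel borel (\<lambda>x::'a. c + (-1) *\<^sub>R x))"
    by (subst *, subst nn_integral_density) auto
  also have "\<dots> = (\<integral>\<^sup>+x. f (c - x) \<partial>lborel)"
    by (subst nn_integral_distr) auto
  finally show ?thesis by simp
qed

lemma emeasure_lborel_ball_pos: "emeasure lborel (ball 0 1 :: 'a::euclidean_space set) \<noteq> 0"
  using content_ball_pos[of 1 "0::'a"] by (auto simp: measure_def)

text \<open>
  The image of Lebesgue measure under an isometry is again translation invariant, and
  integrating \<open>1\<^sub>A(x) 1\<^sub>B(x + y)\<close> in the two possible orders shows that two
  translation invariant measures are proportional. They agree on the unit ball, which an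
  isometry maps to itself.
\<close>

lemma emeasure_lborel_isometry_vimage:
  fixes U :: "'a::euclidean_space \<Rightarrow> 'a"
  assumes lin: "linear U" and iso: "\<And>x. norm (U x) = norm x"
    and A[measurable]: "A \<in> sets borel"
  shows "emeasure lborel (U -` A) = emeasure lborel A"
proof -
  let ?B = "ball 0 1 :: 'a set"
  have [measurable]: "U \<in> borel_measurable borel"
    by (intro borel_measurable_continuous_onI linear_continuous_on) (use lin in \<open>simp add: linear_conv_bounded_linear\<close>)
  have [measurable]: "?B \<in> sets borel" by simp
  have inj: "inj U"
    using iso lin by (metis linear_injective_0 norm_eq_zero)
  have surj: "surj U" using lin inj by (rule linear_injective_imp_surjective) simp
  have [measurable]: "U -` A \<in> sets borel"
    using measurable_sets[of U borel borel A] by simp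
  have "emeasure lborel (U -` A) * emeasure lborel ?B
      = (\<integral>\<^sup>+x. (\<integral>\<^sup>+y. indicator A (U x) * indicator ?B y \<partial>lborel) \<partial>lborel)"
  proof -
    have "(\<integral>\<^sup>+x. (\<integral>\<^sup>+y. indicator A (U x) * indicator ?B y \<partial>lborel) \<partial>lborel)
        = (\<integral>\<^sup>+x. indicator (U -` A) x * emeasure lborel ?B \<partial>lborel)"
    proof (rule nn_integral_cong)
      fix x :: 'a
      have "(\<integral>\<^sup>+y. indicator A (U x) * indicator ?B y \<partial>lborel)
          = indicator A (U x) * (\<integral>\<^sup>+y. indicator ?B y \<partial>lborel)"
        by (rule nn_integral_cmult) (rule borel_measurable_indicator, simp)
      then show "(\<integral>\<^sup>+y. indicator A (U x) * indicator ?B y \<partial>lborel)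
          = indicator (U -` A) x * emeasure lborel ?B"
        by (auto split: split_indicator)
    qed
    also have "\<dots> = emeasure lborel (U -` A) * emeasure lborel ?B"
      by (subst nn_integral_multc) auto
    finally show ?thesis by simp
  qed
  also have "\<dots> = (\<integral>\<^sup>+x. (\<integral>\<^sup>+y. indicator A (U x) * indicator ?B (U x + y) \<partial>lborel) \<partial>lborel)"
  proof (rule nn_integral_cong)
    fix x :: 'a
    show "(\<integral>\<^sup>+y. indicator A (U x) * indicator ?B y \<partial>lborel)
        = (\<integral>\<^sup>+y. indicator A (U x) * indicator ?B (U x + y) \<partial>lborel)"
      by (rule nn_integral_lborel_shift[symmetric]) (intro borel_measurable_times_ennreal borel_measurable_const borel_measurable_indicator, simp)
  qed
  also have "\<dots> = (\<integral>\<^sup>+y. (\<integral>\<^sup>+x. indicator A (U x) * indicator ?B (U x + y) \<partial>lborel) \<partial>lborel)"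
    by (rule lborel_pair.Fubini') measurable
  also have "\<dots> = (\<integral>\<^sup>+y. (\<integral>\<^sup>+x. indicator A (U x - y) * indicator ?B (U x) \<partial>lborel) \<partial>lborel)"
  proof (rule nn_integral_cong)
    fix y :: 'a
    obtain b where b: "U b = y" using surj by (metis surjD)
    have "(\<integral>\<^sup>+x. indicator A (U x - y) * indicator ?B (U x) \<partial>lborel)
      = (\<integral>\<^sup>+x. indicator A (U (b + x) - y) * indicator ?B (U (b + x)) \<partial>lborel)"
      by (subst nn_integral_lborel_shift[of "\<lambda>x. indicator A (U x - y) * indicator ?B (U x)"]) auto
    then show "(\<integral>\<^sup>+x. indicator A (U x) * indicator ?B (U x + y) \<partial>lborel)
        = (\<integral>\<^sup>+x. indicator A (U x - y) * indicator ?B (U x) \<partial>lborel)"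
      by (simp add: linear_add[OF lin] b add.commute)
  qed
  also have "\<dots> = (\<integral>\<^sup>+x. (\<integral>\<^sup>+y. indicator A (U x - y) * indicator ?B (U x) \<partial>lborel) \<partial>lborel)"
    by (rule lborel_pair.Fubini') measurable
  also have "\<dots> = (\<integral>\<^sup>+x. emeasure lborel A * indicator ?B x \<partial>lborel)"
  proof (rule nn_integral_cong)
    fix x :: 'a
    have "(\<integral>\<^sup>+y. indicator A (U x - y) * indicator ?B (U x) \<partial>lborel)
      = (\<integral>\<^sup>+y. indicator A (U x - y) \<partial>lborel) * indicator ?B (U x)"
      by (rule nn_integral_multc) auto
    also have "(\<integral>\<^sup>+y. indicator A (U x - y) \<partial>lborel) = emeasure lborel A"
      by (subst nn_integral_lborel_reflect) auto
    finally show "(\<integral>\<^sup>+y. indicator A (U x - y) * indicator ?B (U x) \<partial>lborel)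
       = emeasure lborel A * indicator ?B x"
      by (auto simp: iso split: split_indicator)
  qed
  also have "\<dots> = emeasure lborel A * emeasure lborel ?B"
    by (subst nn_integral_cmult) auto
  finally show ?thesis
    using emeasure_lborel_ball_pos[where 'a='a] emeasure_lborel_ball_finite[of "0::'a" 1]
    by (metis infinity_ennreal_def less_irrefl mult_divide_eq_ennreal)
qed

definition sphere_cone :: "'a::euclidean_space set \<Rightarrow> 'a set" where
  "sphere_cone A = {t *\<^sub>R x | t x. 0 < t \<and> t \<le> 1 \<and> x \<in> A}"

lemma sphere_cone_eq_sgn_vimage:
  assumes "A \<subseteq> sphere 0 1"
  shows "sphere_cone A = sgn -` A \<inter> (cball 0 1 - {0})"
proof (intro set_eqI iffI)
  fix z assume "z \<in> sgn -` A \<inter> (cball 0 1 - {0})"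
  then show "z \<in> sphere_cone A" unfolding sphere_cone_def
    by (intro CollectI exI[of _ "norm z"] exI[of _ "sgn z"]) (auto simp: sgn_div_norm)
next
  fix z assume "z \<in> sphere_cone A"
  then obtain t x where tx: "z = t *\<^sub>R x" "0 < t" "t \<le> 1" "x \<in> A" unfolding sphere_cone_def by auto
  then have "norm x = 1" using assms by auto
  then show "z \<in> sgn -` A \<inter> (cball 0 1 - {0})" using tx by (auto simp: sgn_div_norm)
qed

lemma sets_sphere_measure_iff:
  "A \<in> sets (sphere_measure :: (complex ^ 'd::finite) measure) \<longleftrightarrow> A \<in> sets borel \<and> A \<subseteq> sphere 0 1"
  unfolding sets_sphere_measure
  by (subst sets_restrict_space_iff) auto

lemma sphere_cone_measurable:
  assumes "A \<in> sets borel" "A \<subseteq> sphere 0 1"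
  shows "sphere_cone A \<in> sets borel"
proof -
  have "sgn = (\<lambda>x::'a. inverse (norm x) *\<^sub>R x)" by (auto simp: sgn_div_norm)
  then have [measurable]: "(sgn :: 'a \<Rightarrow> 'a) \<in> borel_measurable borel" by simp
  have "sgn -` A \<in> sets borel" using measurable_sets[of sgn borel borel A] assms by simp
  then show ?thesis unfolding sphere_cone_eq_sgn_vimage[OF assms(2)] by auto
qed

lemma emeasure_sphere_cone:
  fixes A :: "(complex ^ 'd::finite) set"
  assumes "A \<in> sets sphere_measure"
  shows "emeasure sphere_measure A = ennreal (2 * real CARD('d)) * emeasure lborel (sphere_cone A)"
  using emeasure_sphere_measure[OF assms] by (simp add: sphere_cone_def)

lemma measurable_sphere_isometry:
  fixes U :: "complex ^ 'd::finite \<Rightarrow> complex ^ 'd"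
  assumes lin: "linear U" and iso: "\<And>x. norm (U x) = norm x"
  shows "U \<in> measurable sphere_measure sphere_measure"
proof -
  have "U \<in> borel_measurable borel"
    by (intro borel_measurable_continuous_onI linear_continuous_on) (use lin in \<open>simp add: linear_conv_bounded_linear\<close>)
  then have "U \<in> measurable (restrict_space borel (sphere 0 1)) (restrict_space borel (sphere 0 1))"
    by (intro measurable_restrict_space3) (auto simp: iso)
  then show ?thesis
    by (simp add: measurable_cong_sets[OF sets_sphere_measure sets_sphere_measure])
qed

lemma sphere_measure_isometry_invariant:
  fixes U :: "complex ^ 'd::finite \<Rightarrow> complex ^ 'd"
  assumes lin: "linear U" and iso: "\<And>x. norm (U x) = norm x"
  shows "distr sphere_measure sphere_measure U = sphere_measure"
proof (rule measure_eqI)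
  have m: "U \<in> measurable sphere_measure sphere_measure"
    using assms(1,2) by (rule measurable_sphere_isometry)
  fix A assume "A \<in> sets (distr sphere_measure sphere_measure U)"
  then have A: "A \<in> sets sphere_measure" by simp
  then have A': "A \<in> sets borel" "A \<subseteq> sphere 0 1" by (auto simp: sets_sphere_measure_iff)
  let ?A' = "U -` A \<inter> sphere 0 1"
  have V: "?A' \<in> sets sphere_measure"
    using measurable_sets[OF m A] by (simp add: space_sphere_measure)
  have c: "sphere_cone ?A' = U -` sphere_cone A"
  proof (intro set_eqI iffI)
    fix z assume "z \<in> sphere_cone ?A'"
    then obtain t x where tx: "z = t *\<^sub>R x" "0 < t" "t \<le> 1" "U x \<in> A" unfolding sphere_cone_def by auto
    then have "U z = t *\<^sub>R U x" by (simp add: linear_scale[OF lin])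
    then show "z \<in> U -` sphere_cone A"
      unfolding sphere_cone_def using tx by blast
  next
    fix z assume z: "z \<in> U -` sphere_cone A"
    then obtain t x where tx: "U z = t *\<^sub>R x" "0 < t" "t \<le> 1" "x \<in> A" unfolding sphere_cone_def by auto
    then have "norm x = 1" using A' by auto
    then have n: "norm z = t" using iso[of z] tx by simp
    have "U (z /\<^sub>R t) = x" using tx by (simp add: linear_scale[OF lin])
    then show "z \<in> sphere_cone ?A'"
      unfolding sphere_cone_def using tx n
      by (intro CollectI exI[of _ t] exI[of _ "z /\<^sub>R t"]) auto
  qed
  have "emeasure (distr sphere_measure sphere_measure U) A = emeasure sphere_measure ?A'"
    using emeasure_distr[OF m A] by (simp add: space_sphere_measure)
  also have "\<dots> = emeasure sphere_measure A"
    unfolding emeasure_sphere_cone[OF V] emeasure_sphere_cone[OF A] c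
    using emeasure_lborel_isometry_vimage[OF lin iso sphere_cone_measurable[OF A']] by simp
  finally show "emeasure (distr sphere_measure sphere_measure U) A = emeasure sphere_measure A" .
qed simp

lemma finite_measure_sphere: "finite_measure (sphere_measure :: (complex ^ 'd::finite) measure)"
proof
  have S: "sphere 0 1 \<in> sets (sphere_measure :: (complex ^ 'd) measure)"
    by (simp add: sets_sphere_measure_iff)
  have "emeasure lborel (sphere_cone (sphere 0 1 :: (complex ^ 'd) set)) \<le> emeasure lborel (cball 0 1 :: (complex ^ 'd) set)"
    by (intro emeasure_mono) (auto simp: sphere_cone_def)
  also have "\<dots> < \<infinity>" by (rule emeasure_lborel_cball_finite)
  finally show "emeasure sphere_measure (space (sphere_measure :: (complex ^ 'd) measure)) \<noteq> \<infinity>"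
    by (simp add: space_sphere_measure emeasure_sphere_cone[OF S] ennreal_mult_eq_top_iff)
qed

interpretation sph: finite_measure "sphere_measure :: (complex ^ 'd::finite) measure"
  by (rule finite_measure_sphere)

lemma borel_measurable_sphere_continuous:
  fixes f :: "complex ^ 'd::finite \<Rightarrow> 'b::{second_countable_topology, real_normed_vector}"
  assumes "continuous_on (sphere 0 1) f"
  shows "f \<in> borel_measurable sphere_measure"
  using borel_measurable_continuous_on_restrict[OF assms]
  by (simp add: measurable_cong_sets[OF sets_sphere_measure refl])

lemma integrable_sphere_bounded_mult:
  fixes f :: "complex ^ 'd::finite \<Rightarrow> complex"
  assumes "continuous_on (sphere 0 1) f" "integrable sphere_measure g"
  shows "integrable sphere_measure (\<lambda>x. g x * f x)"
proof -
  have "compact (f ` sphere 0 1)" using assms(1) by (intro compact_continuous_image) auto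
  then obtain B where B: "\<And>x. x \<in> sphere 0 1 \<Longrightarrow> norm (f x) \<le> B"
    using compact_imp_bounded[of "f ` sphere 0 1"] unfolding bounded_iff by blast
  have [measurable]: "f \<in> borel_measurable sphere_measure"
    using assms(1) by (rule borel_measurable_sphere_continuous)
  have [measurable]: "g \<in> borel_measurable sphere_measure" using assms(2) by auto
  show ?thesis
  proof (rule Bochner_Integration.integrable_bound[where f="\<lambda>x. B *\<^sub>R norm (g x)"])
    show "integrable sphere_measure (\<lambda>x. B *\<^sub>R norm (g x))" using assms(2) by auto
    show "AE x in sphere_measure. norm (g x * f x) \<le> norm (B *\<^sub>R norm (g x))"
    proof (rule AE_I2)
      fix x :: "complex ^ 'd" assume "x \<in> space sphere_measure"
      then have "norm (f x) \<le> B" using B by (simp add: space_sphere_measure)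
      then show "norm (g x * f x) \<le> norm (B *\<^sub>R norm (g x))"
        by (auto simp: norm_mult mult.commute[of B] intro!: order_trans[OF mult_left_mono abs_ge_self])
    qed
  qed simp
qed

lemma integrable_sphere_continuous:
  fixes f :: "complex ^ 'd::finite \<Rightarrow> complex"
  assumes "continuous_on (sphere 0 1) f"
  shows "integrable sphere_measure f"
  using integrable_sphere_bounded_mult[OF assms, of "\<lambda>_. 1"] by simp

lemma integrable_sphere_continuous_real:
  fixes f :: "complex ^ 'd::finite \<Rightarrow> real"
  assumes "continuous_on (sphere 0 1) f"
  shows "integrable sphere_measure f"
proof -
  have "continuous_on (sphere 0 1) (\<lambda>x. complex_of_real (f x))"
    using assms by (intro continuous_intros)
  from integrable_sphere_continuous[OF this] show ?thesis
    by (simp add: complex_of_real_integrable_eq)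
qed

lemma integral_sphere_isometry:
  fixes f :: "complex ^ 'd::finite \<Rightarrow> complex" and U :: "complex ^ 'd \<Rightarrow> complex ^ 'd"
  assumes "linear U" "\<And>x. norm (U x) = norm x" and f: "continuous_on (sphere 0 1) f"
  shows "(\<integral>x. f (U x) \<partial>sphere_measure) = (\<integral>x. f x \<partial>sphere_measure)"
proof -
  have m: "U \<in> measurable sphere_measure sphere_measure"
    using assms(1,2) by (rule measurable_sphere_isometry)
  have "(\<integral>x. f x \<partial>sphere_measure) = (\<integral>x. f x \<partial>distr sphere_measure sphere_measure U)"
    using sphere_measure_isometry_invariant[OF assms(1,2)] by simp
  also have "\<dots> = (\<integral>x. f (U x) \<partial>sphere_measure)"
    using m borel_measurable_sphere_continuous[OF f] by (rule integral_distr)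
  finally show ?thesis by simp
qed

text \<open>
  A non-empty relatively open part of the sphere spans a cone with interior points, so it
  has positive measure.
\<close>

lemma sphere_continuous_eq_0_if_AE:
  fixes f :: "complex ^ 'd::finite \<Rightarrow> complex"
  assumes f: "continuous_on (sphere 0 1) f" and ae: "AE x in sphere_measure. f x = 0"
    and x: "x \<in> sphere 0 1"
  shows "f x = 0"
proof (rule ccontr)
  assume nz: "f x \<noteq> 0"
  let ?A = "{y \<in> sphere 0 1. f y \<noteq> 0}"
  have "openin (top_of_set (sphere 0 1)) (sphere 0 1 \<inter> f -` (- {0}))"
    using f by (intro continuous_openin_preimage_gen) auto
  then obtain T where T: "open T" "sphere 0 1 \<inter> f -` (- {0}) = sphere 0 1 \<inter> T"
    by (auto simp: openin_open)
  have "?A = sphere 0 1 \<inter> f -` (- {0})" by auto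
  then have A: "?A = sphere 0 1 \<inter> T" using T(2) by (rule trans)
  have "x \<in> ?A" using nz x by simp
  then have xT: "x \<in> T" unfolding A by simp
  have As: "?A \<in> sets sphere_measure" unfolding A using T(1) by (simp add: sets_sphere_measure_iff)
  have "emeasure sphere_measure ?A = 0"
  proof -
    have "{y \<in> space sphere_measure. \<not> (f y = 0)} = ?A" by (auto simp: space_sphere_measure)
    then show ?thesis using ae AE_iff_measurable[OF As, of "\<lambda>y. f y = 0"] by simp
  qed
  then have n: "emeasure lborel (sphere_cone ?A) = 0"
    unfolding emeasure_sphere_cone[OF As] by (simp add: zero_less_iff_neq_zero)
  let ?W = "{z. z \<in> ball 0 1 - {0} \<and> sgn z \<in> T} :: (complex ^ 'd) set"
  have "continuous_on (ball 0 1 - {0} :: (complex ^ 'd) set) sgn"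
    unfolding sgn_div_norm by (intro continuous_intros) auto
  then have "open ((ball 0 1 - {0}) \<inter> sgn -` T :: (complex ^ 'd) set)"
    by (rule continuous_open_preimage[OF _ _ T(1)]) (intro open_delete open_ball)
  moreover have "?W = (ball 0 1 - {0}) \<inter> sgn -` T" by blast
  ultimately have oW: "open ?W" by simp
  have W: "(1/2) *\<^sub>R x \<in> ?W" using x xT by (auto simp: sgn_div_norm)
  have "?W \<subseteq> sphere_cone ?A"
    unfolding A by (subst sphere_cone_eq_sgn_vimage) (auto simp: norm_sgn)
  moreover have "sphere_cone ?A \<in> sets lborel"
    using sphere_cone_measurable[of ?A] As by (simp add: sets_sphere_measure_iff)
  ultimately have "emeasure lborel ?W = 0"
    using n emeasure_mono[OF \<open>?W \<subseteq> sphere_cone ?A\<close>, of lborel] by simp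
  moreover obtain e where e: "e > 0" "ball ((1/2) *\<^sub>R x) e \<subseteq> ?W"
    by (rule openE[OF oW W])
  ultimately have "emeasure lborel (ball ((1/2) *\<^sub>R x) e) = 0"
    using emeasure_mono[OF e(2), of lborel] oW by simp
  then show False using content_ball_pos[OF e(1), of "(1/2) *\<^sub>R x"] by (simp add: measure_def)
qed

lemma sphere_measure_pos: "measure sphere_measure (sphere 0 1 :: (complex ^ 'd::finite) set) > 0"
proof (rule ccontr)
  assume "\<not> ?thesis"
  then have "measure sphere_measure (sphere 0 1 :: (complex ^ 'd) set) = 0"
    by (metis measure_nonneg order_le_less)
  then have "emeasure sphere_measure (space (sphere_measure :: (complex ^ 'd) measure)) = 0"
    by (simp add: sph.emeasure_eq_measure space_sphere_measure)
  then have "AE x in (sphere_measure :: (complex ^ 'd) measure). (1 :: complex) = 0"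
    by (intro AE_I[of _ _ "space sphere_measure"]) auto
  from sphere_continuous_eq_0_if_AE[OF _ this, of "axis undefined 1"] show False by simp
qed

section \<open>Polynomials in the coordinates and their conjugates\<close>

text \<open>
  Differentiability, continuity and commutation of derivatives are proved by induction on the
  construction of a polynomial; statements about degrees use the graded version \<open>bihom\<close>.
\<close>

inductive polyfun :: "(complex ^ 'd::finite \<Rightarrow> complex) \<Rightarrow> bool" where
  const: "polyfun (\<lambda>z. c)"
| add: "polyfun f \<Longrightarrow> polyfun g \<Longrightarrow> polyfun (\<lambda>z. f z + g z)"
| coord: "polyfun f \<Longrightarrow> polyfun (\<lambda>z. z $ j * f z)"
| cnj_coord: "polyfun f \<Longrightarrow> polyfun (\<lambda>z. cnj (z $ j) * f z)"

inductive bihom :: "nat \<Rightarrow> nat \<Rightarrow> (complex ^ 'd::finite \<Rightarrow> complex) \<Rightarrow> bool" where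
  zero: "bihom m n (\<lambda>z. 0)"
| const: "bihom 0 0 (\<lambda>z. c)"
| add: "bihom m n f \<Longrightarrow> bihom m n g \<Longrightarrow> bihom m n (\<lambda>z. f z + g z)"
| coord: "bihom m n f \<Longrightarrow> bihom (Suc m) n (\<lambda>z. z $ j * f z)"
| cnj_coord: "bihom m n f \<Longrightarrow> bihom m (Suc n) (\<lambda>z. cnj (z $ j) * f z)"

lemma bihom_polyfun: "bihom m n f \<Longrightarrow> polyfun f"
  by (induction rule: bihom.induct) (auto intro: polyfun.intros)

lemma bihom_cmult: "bihom m n f \<Longrightarrow> bihom m n (\<lambda>z. c * f z)"
proof (induction rule: bihom.induct)
  case (add m n f g)
  then show ?case using bihom.add[OF add.IH] by (simp add: algebra_simps)
next
  case (coord m n f j)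
  then show ?case using bihom.coord[OF coord.IH, of j] by (simp add: mult.left_commute)
next
  case (cnj_coord m n f j)
  then show ?case using bihom.cnj_coord[OF cnj_coord.IH, of j] by (simp add: mult.left_commute)
qed (auto intro: bihom.intros)

lemma bihom_sum: "(\<And>i. i \<in> A \<Longrightarrow> bihom m n (f i)) \<Longrightarrow> bihom m n (\<lambda>z. \<Sum>i\<in>A. f i z)"
  by (induction A rule: infinite_finite_induct) (auto intro: bihom.intros)

lemma bihom_mult:
  assumes "bihom m n f" "bihom m' n' g"
  shows "bihom (m + m') (n + n') (\<lambda>z. f z * g z)"
  using assms(1)
proof (induction rule: bihom.induct)
  case (zero m n)
  then show ?case using bihom.zero by simp
next
  case (const c)
  then show ?case using bihom_cmult[OF assms(2)] by simp
next
  case (add m n f1 f2)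
  then show ?case using bihom.add[OF add.IH] by (simp add: algebra_simps)
next
  case (coord m n f j)
  then show ?case using bihom.coord[OF coord.IH, of j] by (simp add: mult.assoc)
next
  case (cnj_coord m n f j)
  then show ?case using bihom.cnj_coord[OF cnj_coord.IH, of j] by (simp add: mult.assoc)
qed

lemma bihom_cnj: "bihom m n f \<Longrightarrow> bihom n m (\<lambda>z. cnj (f z))"
  by (induction rule: bihom.induct) (auto intro: bihom.intros)

lemma bihom_power: "bihom m n f \<Longrightarrow> bihom (k * m) (k * n) (\<lambda>z. f z ^ k)"
  by (induction k) (auto intro: bihom.const bihom_mult)

lemma bihom_prod:
  "finite A \<Longrightarrow> (\<And>i. i \<in> A \<Longrightarrow> bihom (a i) (b i) (f i)) \<Longrightarrow> bihom (sum a A) (sum b A) (\<lambda>z. \<Prod>i\<in>A. f i z)"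
  by (induction A rule: finite_induct) (auto intro: bihom.const bihom_mult)

lemma bihom_coord1: "bihom 1 0 (\<lambda>z. z $ j)"
  using bihom.coord[OF bihom.const[of 1], of j] by simp

lemma bihom_cnj_coord1: "bihom 0 1 (\<lambda>z. cnj (z $ j))"
  using bihom.cnj_coord[OF bihom.const[of 1], of j] by simp

lemma bihom_comp_linear:
  assumes U: "\<And>z k. U z $ k = (\<Sum>j\<in>UNIV. a k j * z $ j)"
  shows "bihom m n f \<Longrightarrow> bihom m n (\<lambda>z. f (U z))"
proof (induction rule: bihom.induct)
  case (coord m n f k)
  have "bihom (1 + m) (0 + n) (\<lambda>z. U z $ k * f (U z))"
    unfolding U by (intro bihom_mult bihom_sum bihom_cmult bihom_coord1 coord.IH)
  then show ?case by simp
next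
  case (cnj_coord m n f k)
  have "bihom (0 + m) (1 + n) (\<lambda>z. cnj (U z $ k) * f (U z))"
    unfolding U cnj_sum complex_cnj_mult
    by (intro bihom_mult bihom_sum bihom_cmult bihom_cnj_coord1 cnj_coord.IH)
  then show ?case by simp
qed (auto intro: bihom.intros)

lemma bihom_homogeneous:
  "bihom m n f \<Longrightarrow> f (t *\<^sub>R z) = of_real t ^ (m + n) * f z"
  by (induction rule: bihom.induct) (auto simp: algebra_simps scaleR_conv_of_real[where 'a=complex])

definition zmono :: "('d \<Rightarrow> nat) \<Rightarrow> ('d \<Rightarrow> nat) \<Rightarrow> complex ^ 'd::finite \<Rightarrow> complex" where
  "zmono \<alpha> \<beta> z = (\<Prod>j\<in>UNIV. (z $ j) ^ \<alpha> j) * (\<Prod>j\<in>UNIV. cnj (z $ j) ^ \<beta> j)"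

definition multiindices :: "nat \<Rightarrow> ('d::finite \<Rightarrow> nat) set" where
  "multiindices m = {\<alpha>. sum \<alpha> UNIV = m}"

lemma finite_multiindices' [simp]: "finite (multiindices m)"
  unfolding multiindices_def by (rule finite_multiindices)

lemma bihom_mono: "bihom (sum \<alpha> UNIV) (sum \<beta> UNIV) (zmono \<alpha> \<beta>)"
proof -
  have "bihom (\<Sum>j\<in>UNIV. \<alpha> j * 1) (\<Sum>j\<in>UNIV. \<alpha> j * 0) (\<lambda>z. \<Prod>j\<in>UNIV. (z $ j) ^ \<alpha> j)"
    by (intro bihom_prod bihom_power bihom_coord1) auto
  moreover have "bihom (\<Sum>j\<in>UNIV. \<beta> j * 0) (\<Sum>j\<in>UNIV. \<beta> j * 1) (\<lambda>z. \<Prod>j\<in>UNIV. (cnj (z $ j)) ^ \<beta> j)"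
    by (intro bihom_prod bihom_power bihom_cnj_coord1) auto
  ultimately have "bihom ((\<Sum>j\<in>UNIV. \<alpha> j * 1) + (\<Sum>j\<in>UNIV. \<beta> j * 0))
      ((\<Sum>j\<in>UNIV. \<alpha> j * 0) + (\<Sum>j\<in>UNIV. \<beta> j * 1))
      (\<lambda>z. (\<Prod>j\<in>UNIV. (z $ j) ^ \<alpha> j) * (\<Prod>j\<in>UNIV. (cnj (z $ j)) ^ \<beta> j))"
    by (rule bihom_mult)
  then show ?thesis by (simp add: zmono_def[abs_def])
qed

lemma bihomogeneous_polys_iff_coeffs:
  "f \<in> bihomogeneous_polys m n \<longleftrightarrow>
     (\<exists>c. f = (\<lambda>z. \<Sum>x\<in>multiindices m \<times> multiindices n. c x * zmono (fst x) (snd x) z))"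
proof -
  have *: "(\<lambda>z. \<Sum>\<alpha> | sum \<alpha> UNIV = m. \<Sum>\<beta> | sum \<beta> UNIV = n.
         c \<alpha> \<beta> * (\<Prod>j\<in>UNIV. (z $ j) ^ \<alpha> j) * (\<Prod>j\<in>UNIV. cnj (z $ j) ^ \<beta> j))
    = (\<lambda>z. \<Sum>x\<in>multiindices m \<times> multiindices n. c (fst x) (snd x) * zmono (fst x) (snd x) z)"
    for c :: "('a \<Rightarrow> nat) \<Rightarrow> ('a \<Rightarrow> nat) \<Rightarrow> complex"
    by (simp add: sum.cartesian_product multiindices_def zmono_def mult.assoc case_prod_beta)
  show ?thesis
    unfolding bihomogeneous_polys_def mem_Collect_eq *
  proof safe
    fix c :: "('a \<Rightarrow> nat) \<Rightarrow> ('a \<Rightarrow> nat) \<Rightarrow> complex"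
    show "\<exists>c'. (\<lambda>z. \<Sum>x\<in>multiindices m \<times> multiindices n. c (fst x) (snd x) * zmono (fst x) (snd x) z)
      = (\<lambda>z. \<Sum>x\<in>multiindices m \<times> multiindices n. c' x * zmono (fst x) (snd x) z)"
      by (rule exI[of _ "\<lambda>x. c (fst x) (snd x)"]) (rule refl)
  next
    fix c :: "('a \<Rightarrow> nat) \<times> ('a \<Rightarrow> nat) \<Rightarrow> complex"
    show "\<exists>c'. (\<lambda>z. \<Sum>x\<in>multiindices m \<times> multiindices n. c x * zmono (fst x) (snd x) z)
      = (\<lambda>z. \<Sum>x\<in>multiindices m \<times> multiindices n. c' (fst x) (snd x) * zmono (fst x) (snd x) z) \<and> True"
      by (rule exI[of _ "\<lambda>a b. c (a, b)"]) simp
  qed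
qed

lemma mono_in_bihomogeneous_polys:
  assumes "sum \<alpha> UNIV = m" "sum \<beta> UNIV = n"
  shows "zmono \<alpha> \<beta> \<in> bihomogeneous_polys m n"
proof -
  have "zmono \<alpha> \<beta> = (\<lambda>z. \<Sum>x\<in>multiindices m \<times> multiindices n. of_bool (x = (\<alpha>, \<beta>)) * zmono (fst x) (snd x) z)"
    using assms by (intro ext) (subst sum.remove[of _ "(\<alpha>, \<beta>)"], auto simp: multiindices_def[symmetric] intro!: sum.neutral, auto simp: multiindices_def)
  then show ?thesis unfolding bihomogeneous_polys_iff_coeffs
    by (rule exI[of _ "\<lambda>x. of_bool (x = (\<alpha>, \<beta>))"])
qed

lemma bihomogeneous_polys_add:
  assumes "f \<in> bihomogeneous_polys m n" "g \<in> bihomogeneous_polys m n"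
  shows "(\<lambda>z. f z + g z) \<in> bihomogeneous_polys m n"
proof -
  from assms obtain c c' where "f = (\<lambda>z. \<Sum>x\<in>multiindices m \<times> multiindices n. c x * zmono (fst x) (snd x) z)"
     "g = (\<lambda>z. \<Sum>x\<in>multiindices m \<times> multiindices n. c' x * zmono (fst x) (snd x) z)"
    unfolding bihomogeneous_polys_iff_coeffs by blast
  then show ?thesis unfolding bihomogeneous_polys_iff_coeffs
    by (intro exI[of _ "\<lambda>x. c x + c' x"]) (auto simp: sum.distrib algebra_simps)
qed

lemma bihomogeneous_polys_zero: "(\<lambda>z. 0) \<in> bihomogeneous_polys m n"
  unfolding bihomogeneous_polys_iff_coeffs by (intro exI[of _ "\<lambda>x. 0"]) simp

lemma bihomogeneous_polys_cmult:
  assumes "f \<in> bihomogeneous_polys m n"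
  shows "(\<lambda>z. a * f z) \<in> bihomogeneous_polys m n"
proof -
  from assms obtain c where "f = (\<lambda>z. \<Sum>x\<in>multiindices m \<times> multiindices n. c x * zmono (fst x) (snd x) z)"
    unfolding bihomogeneous_polys_iff_coeffs by blast
  then show ?thesis unfolding bihomogeneous_polys_iff_coeffs
    by (intro exI[of _ "\<lambda>x. a * c x"]) (auto simp: sum_distrib_left algebra_simps)
qed

lemma bihomogeneous_polys_sum:
  "(\<And>i. i \<in> A \<Longrightarrow> f i \<in> bihomogeneous_polys m n) \<Longrightarrow> (\<lambda>z. \<Sum>i\<in>A. f i z) \<in> bihomogeneous_polys m n"
  by (induction A rule: infinite_finite_induct)
    (auto intro: bihomogeneous_polys_add bihomogeneous_polys_zero)

lemma prod_power_upd:
  fixes j :: "'d::finite" and x :: "'d \<Rightarrow> complex"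
  shows "(\<Prod>k\<in>UNIV. x k ^ (\<alpha>(j := Suc (\<alpha> j))) k) = x j * (\<Prod>k\<in>UNIV. x k ^ \<alpha> k)"
proof -
  have "(\<Prod>k\<in>UNIV. x k ^ (\<alpha>(j := Suc (\<alpha> j))) k) = (\<Prod>k\<in>UNIV. (if k = j then x j else 1) * x k ^ \<alpha> k)"
    by (intro prod.cong) auto
  then show ?thesis by (simp add: prod.distrib)
qed

lemma sum_upd_Suc:
  fixes j :: "'d::finite"
  shows "sum (\<alpha>(j := Suc (\<alpha> j))) UNIV = Suc (sum \<alpha> UNIV)"
proof -
  have "sum (\<alpha>(j := Suc (\<alpha> j))) UNIV = (\<Sum>k\<in>UNIV. (if k = j then 1 else 0) + \<alpha> k)"
    by (intro sum.cong) auto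
  then show ?thesis by (simp add: sum.distrib)
qed

lemma coord_mono: "z $ j * zmono \<alpha> \<beta> z = zmono (\<alpha>(j := Suc (\<alpha> j))) \<beta> z"
  unfolding zmono_def using prod_power_upd[of "\<lambda>k. z $ k" \<alpha> j] by (simp add: mult.assoc)

lemma cnj_coord_mono: "cnj (z $ j) * zmono \<alpha> \<beta> z = zmono \<alpha> (\<beta>(j := Suc (\<beta> j))) z"
  unfolding zmono_def using prod_power_upd[of "\<lambda>k. cnj (z $ k)" \<beta> j] by (simp add: algebra_simps)

text \<open>
  The inductive description replaces manipulations of coefficient families by induction; this is
  the only place where the two are compared.
\<close>

lemma bihom_iff: "bihom m n f \<longleftrightarrow> f \<in> bihomogeneous_polys m n"
proof
  assume "bihom m n f"
  then show "f \<in> bihomogeneous_polys m n"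
  proof (induction rule: bihom.induct)
    case (const c)
    have "zmono (\<lambda>_. 0) (\<lambda>_. 0) \<in> bihomogeneous_polys 0 0"
      by (rule mono_in_bihomogeneous_polys) auto
    from bihomogeneous_polys_cmult[OF this, of c] show ?case by (simp add: zmono_def)
  next
    case (coord m n f j)
    then obtain c where c: "f = (\<lambda>z. \<Sum>x\<in>multiindices m \<times> multiindices n. c x * zmono (fst x) (snd x) z)"
      unfolding bihomogeneous_polys_iff_coeffs by blast
    have "(\<lambda>z. z $ j * f z) = (\<lambda>z. \<Sum>x\<in>multiindices m \<times> multiindices n.
        c x * zmono ((fst x)(j := Suc (fst x j))) (snd x) z)"
      unfolding c by (simp add: sum_distrib_left mult.left_commute coord_mono[symmetric])
    also have "\<dots> \<in> bihomogeneous_polys (Suc m) n"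
      by (intro bihomogeneous_polys_sum bihomogeneous_polys_cmult mono_in_bihomogeneous_polys)
        (auto simp: multiindices_def sum_upd_Suc simp del: fun_upd_apply)
    finally show ?case .
  next
    case (cnj_coord m n f j)
    then obtain c where c: "f = (\<lambda>z. \<Sum>x\<in>multiindices m \<times> multiindices n. c x * zmono (fst x) (snd x) z)"
      unfolding bihomogeneous_polys_iff_coeffs by blast
    have "(\<lambda>z. cnj (z $ j) * f z) = (\<lambda>z. \<Sum>x\<in>multiindices m \<times> multiindices n.
        c x * zmono (fst x) ((snd x)(j := Suc (snd x j))) z)"
      unfolding c by (simp add: sum_distrib_left mult.left_commute cnj_coord_mono[symmetric])
    also have "\<dots> \<in> bihomogeneous_polys m (Suc n)"
      by (intro bihomogeneous_polys_sum bihomogeneous_polys_cmult mono_in_bihomogeneous_polys)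
        (auto simp: multiindices_def sum_upd_Suc simp del: fun_upd_apply)
    finally show ?case .
  qed (auto intro: bihomogeneous_polys_add bihomogeneous_polys_zero)
next
  assume "f \<in> bihomogeneous_polys m n"
  then obtain c where c: "f = (\<lambda>z. \<Sum>x\<in>multiindices m \<times> multiindices n. c x * zmono (fst x) (snd x) z)"
    unfolding bihomogeneous_polys_iff_coeffs by blast
  have "bihom m n (zmono \<alpha> \<beta>)" if "(\<alpha>, \<beta>) \<in> multiindices m \<times> multiindices n" for \<alpha> \<beta> :: "'a \<Rightarrow> nat"
    using bihom_mono[of \<alpha> \<beta>] that by (auto simp: multiindices_def)
  then show "bihom m n f" unfolding c by (intro bihom_sum bihom_cmult) auto
qed

subsection \<open>Wirtinger derivatives\<close>

text \<open>
  Both Wirtinger derivatives at once: the sign \<open>\<epsilon>\<close> is \<open>-1\<close> for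
  \<open>\<partial>/\<partial>z\<^sub>j\<close> and \<open>1\<close> for \<open>\<partial>/\<partial>\<bar>z\<^sub>j\<close>.
\<close>

definition wirt :: "complex \<Rightarrow> 'd \<Rightarrow> (complex ^ 'd::finite \<Rightarrow> complex) \<Rightarrow> complex ^ 'd \<Rightarrow> complex" where
  "wirt \<epsilon> j f z = (frechet_derivative f (at z) (axis j 1)
                    + \<epsilon> * \<i> * frechet_derivative f (at z) (axis j \<i>)) / 2"

lemma d_z_wirt: "d_z j f = wirt (-1) j f" and d_zbar_wirt: "d_zbar j f = wirt 1 j f"
  by (auto simp: fun_eq_iff d_z_def d_zbar_def wirt_def)

lemma has_derivative_coord: "((\<lambda>z::complex ^ 'd::finite. z $ k) has_derivative (\<lambda>w. w $ k)) (at z)"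
  by (rule bounded_linear_imp_has_derivative[OF bounded_linear_vec_nth])

lemma has_derivative_cnj_coord:
  "((\<lambda>z::complex ^ 'd::finite. cnj (z $ k)) has_derivative (\<lambda>w. cnj (w $ k))) (at z)"
  by (rule bounded_linear_imp_has_derivative)
    (rule bounded_linear_compose[OF bounded_linear_cnj bounded_linear_vec_nth])

lemma polyfun_differentiable: "polyfun f \<Longrightarrow> f differentiable (at z)"
proof (induction rule: polyfun.induct)
  case (coord f j)
  then show ?case using has_derivative_coord by (intro differentiable_mult) (auto simp: differentiable_def)
next
  case (cnj_coord f j)
  then show ?case using has_derivative_cnj_coord by (intro differentiable_mult) (auto simp: differentiable_def)
qed (auto intro: derivative_intros)

lemma polyfun_has_derivative:
  "polyfun f \<Longrightarrow> (f has_derivative frechet_derivative f (at z)) (at z)"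
  using polyfun_differentiable frechet_derivative_works by blast

lemma polyfun_continuous_on: "polyfun f \<Longrightarrow> continuous_on A f"
  by (induction rule: polyfun.induct) (auto intro!: continuous_intros)

lemma lipschitz_mult:
  fixes f u :: "complex ^ 'd::finite \<Rightarrow> complex"
  assumes f: "polyfun f" "\<exists>C. \<forall>x\<in>cball 0 1. \<forall>y\<in>cball 0 1. norm (f x - f y) \<le> C * norm (x - y)"
    and u: "\<And>x y. norm (u x - u y) \<le> norm (x - y)" "\<And>x. norm (u x) \<le> norm x"
  shows "\<exists>C. \<forall>x\<in>cball 0 1. \<forall>y\<in>cball 0 1. norm (u x * f x - u y * f y) \<le> C * norm (x - y)"
proof -
  obtain C where C: "\<And>x y. x \<in> cball 0 1 \<Longrightarrow> y \<in> cball 0 1 \<Longrightarrow> norm (f x - f y) \<le> C * norm (x - y)"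
    using f(2) by blast
  obtain B where B: "\<And>x. x \<in> cball 0 1 \<Longrightarrow> norm (f x) \<le> B"
    using compact_imp_bounded[OF compact_continuous_image[OF polyfun_continuous_on[OF f(1)] compact_cball[of 0 1]]]
    unfolding bounded_iff by blast
  have "norm (u x * f x - u y * f y) \<le> (C + B) * norm (x - y)" if "x \<in> cball 0 1" "y \<in> cball 0 1" for x y
  proof -
    have "u x * f x - u y * f y = u x * (f x - f y) + (u x - u y) * f y"
      by (simp add: algebra_simps)
    also have "norm \<dots> \<le> norm (u x) * norm (f x - f y) + norm (u x - u y) * norm (f y)"
      by (metis norm_mult norm_triangle_ineq)
    also have "\<dots> \<le> 1 * (C * norm (x - y)) + norm (x - y) * B"
      using that order_trans[OF u(2)[of x], of 1] by (intro add_mono mult_mono C B u(1)) auto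
    finally show ?thesis by (simp add: algebra_simps)
  qed
  then show ?thesis by blast
qed

text \<open>
  Needed to dominate the difference quotients in the differentiation under the integral sign.
\<close>

lemma polyfun_lipschitz:
  "polyfun f \<Longrightarrow> \<exists>C. \<forall>x\<in>cball 0 1. \<forall>y\<in>cball 0 1. norm (f x - f y) \<le> C * norm (x - y)"
proof (induction rule: polyfun.induct)
  case (const c)
  show ?case by (intro exI[of _ 0]) auto
next
  case (add f g)
  then obtain C C' where C: "\<And>x y. x \<in> cball 0 1 \<Longrightarrow> y \<in> cball 0 1 \<Longrightarrow> norm (f x - f y) \<le> C * norm (x - y)"
    "\<And>x y. x \<in> cball 0 1 \<Longrightarrow> y \<in> cball 0 1 \<Longrightarrow> norm (g x - g y) \<le> C' * norm (x - y)"
    by blast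
  have "norm (f x + g x - (f y + g y)) \<le> (C + C') * norm (x - y)" if "x \<in> cball 0 1" "y \<in> cball 0 1" for x y
    using C(1)[OF that] C(2)[OF that] norm_triangle_ineq[of "f x - f y" "g x - g y"]
    by (simp add: algebra_simps)
  then show ?case by blast
next
  case (coord f j)
  show ?case
    by (rule lipschitz_mult[OF coord])
      (use Finite_Cartesian_Product.norm_nth_le[of _ j] in \<open>simp_all flip: vector_minus_component\<close>)
next
  case (cnj_coord f j)
  show ?case
    by (rule lipschitz_mult[OF cnj_coord])
      (use Finite_Cartesian_Product.norm_nth_le[of _ j] in \<open>simp_all flip: vector_minus_component complex_cnj_diff\<close>)
qed

lemma wirt_has_derivative:
  "(f has_derivative f') (at z) \<Longrightarrow> wirt \<epsilon> j f z = (f' (axis j 1) + \<epsilon> * \<i> * f' (axis j \<i>)) / 2"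
  unfolding wirt_def by (simp add: frechet_derivative_at[symmetric])

lemma wirt_const: "wirt \<epsilon> j (\<lambda>z. c) = (\<lambda>z. 0)"
  by (rule ext, subst wirt_has_derivative[OF has_derivative_const]) simp

lemma wirt_add:
  "polyfun f \<Longrightarrow> polyfun g \<Longrightarrow> wirt \<epsilon> j (\<lambda>z. f z + g z) z = wirt \<epsilon> j f z + wirt \<epsilon> j g z"
  by (subst wirt_has_derivative[OF has_derivative_add[OF polyfun_has_derivative polyfun_has_derivative]])
    (auto simp: wirt_def algebra_simps add_divide_distrib)

lemma wirt_coord:
  "polyfun f \<Longrightarrow> wirt \<epsilon> j (\<lambda>z. z $ k * f z) z
     = z $ k * wirt \<epsilon> j f z + (if j = k then (1 - \<epsilon>) / 2 else 0) * f z"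
  by (subst wirt_has_derivative[OF has_derivative_mult[OF has_derivative_coord polyfun_has_derivative]])
    (auto simp: wirt_def axis_def field_simps)

lemma wirt_cnj_coord:
  "polyfun f \<Longrightarrow> wirt \<epsilon> j (\<lambda>z. cnj (z $ k) * f z) z
     = cnj (z $ k) * wirt \<epsilon> j f z + (if j = k then (1 + \<epsilon>) / 2 else 0) * f z"
  by (subst wirt_has_derivative[OF has_derivative_mult[OF has_derivative_cnj_coord polyfun_has_derivative]])
    (auto simp: wirt_def axis_def field_simps)

lemma polyfun_cmult: "polyfun f \<Longrightarrow> polyfun (\<lambda>z. c * f z)"
proof (induction rule: polyfun.induct)
  case (add f g)
  then show ?case using polyfun.add[OF add.IH] by (simp add: algebra_simps)
next
  case (coord f j)
  then show ?case using polyfun.coord[OF coord.IH, of j] by (simp add: mult.left_commute)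
next
  case (cnj_coord f j)
  then show ?case using polyfun.cnj_coord[OF cnj_coord.IH, of j] by (simp add: mult.left_commute)
qed (auto intro: polyfun.intros)

lemma polyfun_mult:
  assumes "polyfun f" "polyfun g"
  shows "polyfun (\<lambda>z. f z * g z)"
  using assms(1)
proof (induction rule: polyfun.induct)
  case (const c)
  show ?case using assms(2) by (rule polyfun_cmult)
next
  case (add f1 f2)
  then show ?case using polyfun.add[OF add.IH] by (simp add: algebra_simps)
next
  case (coord f j)
  then show ?case using polyfun.coord[OF coord.IH, of j] by (simp add: mult.assoc)
next
  case (cnj_coord f j)
  then show ?case using polyfun.cnj_coord[OF cnj_coord.IH, of j] by (simp add: mult.assoc)
qed

lemma polyfun_cnj: "polyfun f \<Longrightarrow> polyfun (\<lambda>z. cnj (f z))"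
  by (induction rule: polyfun.induct) (auto intro: polyfun.intros)

lemma polyfun_sum: "(\<And>i. i \<in> A \<Longrightarrow> polyfun (f i)) \<Longrightarrow> polyfun (\<lambda>z. \<Sum>i\<in>A. f i z)"
  by (induction A rule: infinite_finite_induct) (auto intro: polyfun.intros)

lemma polyfun_wirt: "polyfun f \<Longrightarrow> polyfun (wirt \<epsilon> j f)"
proof (induction rule: polyfun.induct)
  case (const c)
  show ?case unfolding wirt_const by (rule polyfun.const)
next
  case (add f g)
  have "wirt \<epsilon> j (\<lambda>z. f z + g z) = (\<lambda>z. wirt \<epsilon> j f z + wirt \<epsilon> j g z)"
    using add by (auto simp: wirt_add)
  then show ?case using polyfun.add[OF add.IH] by simp
next
  case (coord f k)
  have *: "wirt \<epsilon> j (\<lambda>z. z $ k * f z) = (\<lambda>z. z $ k * wirt \<epsilon> j f z + (if j = k then (1 - \<epsilon>) / 2 else 0) * f z)"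
    using coord by (auto simp only: wirt_coord)
  show ?case unfolding * by (intro polyfun.add polyfun.coord polyfun_cmult coord)
next
  case (cnj_coord f k)
  have *: "wirt \<epsilon> j (\<lambda>z. cnj (z $ k) * f z) = (\<lambda>z. cnj (z $ k) * wirt \<epsilon> j f z + (if j = k then (1 + \<epsilon>) / 2 else 0) * f z)"
    using cnj_coord by (auto simp only: wirt_cnj_coord)
  show ?case unfolding * by (intro polyfun.add polyfun.cnj_coord polyfun_cmult cnj_coord)
qed

lemma wirt_cnj: "polyfun f \<Longrightarrow> wirt \<epsilon> j (\<lambda>z. cnj (f z)) z = cnj (wirt (- cnj \<epsilon>) j f z)"
  by (subst wirt_has_derivative[OF bounded_linear.has_derivative[OF bounded_linear_cnj polyfun_has_derivative]])
    (auto simp: wirt_def)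

lemma wirt_cmult: "polyfun f \<Longrightarrow> wirt \<epsilon> j (\<lambda>z. c * f z) z = c * wirt \<epsilon> j f z"
  by (subst wirt_has_derivative[OF has_derivative_mult_right[OF polyfun_has_derivative]])
    (auto simp: wirt_def algebra_simps)

lemma wirt_mult:
  "polyfun f \<Longrightarrow> polyfun g \<Longrightarrow> wirt \<epsilon> j (\<lambda>z. f z * g z) z = f z * wirt \<epsilon> j g z + wirt \<epsilon> j f z * g z"
  by (subst wirt_has_derivative[OF has_derivative_mult[OF polyfun_has_derivative polyfun_has_derivative]])
    (auto simp: wirt_def algebra_simps add_divide_distrib)

lemma wirt_sum:
  "(\<And>i. i \<in> A \<Longrightarrow> polyfun (f i)) \<Longrightarrow> wirt \<epsilon> j (\<lambda>z. \<Sum>i\<in>A. f i z) z = (\<Sum>i\<in>A. wirt \<epsilon> j (f i) z)"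
  by (induction A rule: infinite_finite_induct) (auto simp: wirt_const wirt_add polyfun_sum)

lemma wirt_commute: "polyfun f \<Longrightarrow> wirt \<epsilon> j (wirt \<epsilon>' k f) = wirt \<epsilon>' k (wirt \<epsilon> j f)"
proof (induction rule: polyfun.induct)
  case (const c)
  show ?case by (simp add: wirt_const)
next
  case (add f g)
  have "wirt \<epsilon> j (\<lambda>z. f z + g z) = (\<lambda>z. wirt \<epsilon> j f z + wirt \<epsilon> j g z)" for \<epsilon> j
    using add by (auto simp: wirt_add)
  then show ?case using add by (auto simp: fun_eq_iff wirt_add polyfun_wirt)
next
  case (coord f l)
  define a where "a = (\<lambda>(\<epsilon>::complex) j. if j = l then (1 - \<epsilon>) / 2 else 0)"
  have *: "wirt \<epsilon> j (\<lambda>z. z $ l * g z) = (\<lambda>z. z $ l * wirt \<epsilon> j g z + a \<epsilon> j * g z)"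
    if "polyfun g" for \<epsilon> j g
    using that by (auto simp only: wirt_coord a_def)
  have **: "wirt \<epsilon> j (\<lambda>z. z $ l * g z + c * f z) = (\<lambda>z. z $ l * wirt \<epsilon> j g z + a \<epsilon> j * g z + c * wirt \<epsilon> j f z)"
    if "polyfun g" for \<epsilon> j g c
    using wirt_add[OF polyfun.coord[OF that, of l] polyfun_cmult[OF coord.hyps, of c], of \<epsilon> j]
    by (simp only: fun_eq_iff *[OF that] wirt_cmult[OF coord.hyps] simp_thms)
  show ?case
    unfolding *[OF coord.hyps] **[OF polyfun_wirt[OF coord.hyps]] coord.IH
    by (simp add: algebra_simps)
next
  case (cnj_coord f l)
  define a where "a = (\<lambda>(\<epsilon>::complex) j. if j = l then (1 + \<epsilon>) / 2 else 0)"
  have *: "wirt \<epsilon> j (\<lambda>z. cnj (z $ l) * g z) = (\<lambda>z. cnj (z $ l) * wirt \<epsilon> j g z + a \<epsilon> j * g z)"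
    if "polyfun g" for \<epsilon> j g
    using that by (auto simp only: wirt_cnj_coord a_def)
  have **: "wirt \<epsilon> j (\<lambda>z. cnj (z $ l) * g z + c * f z) = (\<lambda>z. cnj (z $ l) * wirt \<epsilon> j g z + a \<epsilon> j * g z + c * wirt \<epsilon> j f z)"
    if "polyfun g" for \<epsilon> j g c
    using wirt_add[OF polyfun.cnj_coord[OF that, of l] polyfun_cmult[OF cnj_coord.hyps, of c], of \<epsilon> j]
    by (simp only: fun_eq_iff *[OF that] wirt_cmult[OF cnj_coord.hyps] simp_thms)
  show ?case
    unfolding *[OF cnj_coord.hyps] **[OF polyfun_wirt[OF cnj_coord.hyps]] cnj_coord.IH
    by (simp add: algebra_simps)
qed

lemma frechet_derivative_wirt:
  fixes f :: "complex ^ 'd::finite \<Rightarrow> complex"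
  assumes "polyfun f"
  shows "frechet_derivative f (at z) w = (\<Sum>k\<in>UNIV. w $ k * wirt (-1) k f z + cnj (w $ k) * wirt 1 k f z)"
proof -
  define F where "F = frechet_derivative f (at z)"
  have lin: "linear F" unfolding F_def
    using polyfun_has_derivative[OF assms] has_derivative_linear by blast
  have w: "w = (\<Sum>k\<in>UNIV. Re (w $ k) *\<^sub>R axis k 1 + Im (w $ k) *\<^sub>R axis k \<i>)"
    by (simp add: vec_eq_iff sum_component axis_def complex_eq_iff if_distrib if_distribR cong: if_cong)
  have "F w = (\<Sum>k\<in>UNIV. Re (w $ k) *\<^sub>R F (axis k 1) + Im (w $ k) *\<^sub>R F (axis k \<i>))"
    by (subst w) (simp add: linear_sum[OF lin] linear_add[OF lin] linear_scale[OF lin])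
  also have "\<dots> = (\<Sum>k\<in>UNIV. w $ k * wirt (-1) k f z + cnj (w $ k) * wirt 1 k f z)"
    by (intro sum.cong refl) (simp add: wirt_def F_def[symmetric] complex_eq_iff field_simps)
  finally show ?thesis by (simp add: F_def)
qed

lemma bihom_wirt_z:
  "bihom m n f \<Longrightarrow> (m = 0 \<longrightarrow> wirt (-1) j f = (\<lambda>z. 0)) \<and> (\<forall>m'. m = Suc m' \<longrightarrow> bihom m' n (wirt (-1) j f))"
proof (induction rule: bihom.induct)
  case (zero m n)
  have "wirt (-1) j (\<lambda>z. 0) = (\<lambda>z. 0)" by (auto simp: wirt_const)
  then show ?case by (auto intro: bihom.zero)
next
  case (const c)
  then show ?case by (auto simp: wirt_const)
next
  case (add m n f g)
  have "wirt (-1) j (\<lambda>z. f z + g z) = (\<lambda>z. wirt (-1) j f z + wirt (-1) j g z)"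
    using add by (auto simp: wirt_add bihom_polyfun)
  then show ?case using add by (auto intro: bihom.add)
next
  case (coord m n f k)
  have *: "wirt (-1) j (\<lambda>z. z $ k * f z) = (\<lambda>z. z $ k * wirt (-1) j f z + of_bool (j = k) * f z)"
    using coord by (auto simp: wirt_coord bihom_polyfun)
  have "bihom m n (\<lambda>z. z $ k * wirt (-1) j f z)"
    using coord.IH by (cases m) (auto intro: bihom.coord bihom.zero)
  then show ?case unfolding * by (auto intro!: bihom.add bihom_cmult coord)
next
  case (cnj_coord m n f k)
  have *: "wirt (-1) j (\<lambda>z. cnj (z $ k) * f z) = (\<lambda>z. cnj (z $ k) * wirt (-1) j f z)"
    using cnj_coord by (auto simp: wirt_cnj_coord bihom_polyfun)
  show ?case unfolding * using cnj_coord.IH by (auto intro!: bihom.cnj_coord)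
qed

text \<open>
  Conjugation exchanges the two derivatives; facts about \<open>\<partial>/\<partial>\<bar>z\<^sub>j\<close> follow
  from those about \<open>\<partial>/\<partial>z\<^sub>j\<close>.
\<close>

lemma wirt_zbar_via_cnj:
  assumes "polyfun f"
  shows "wirt 1 j f = (\<lambda>z. cnj (wirt (-1) j (\<lambda>z. cnj (f z)) z))"
  using wirt_cnj[OF polyfun_cnj[OF assms], of 1 j] by (simp add: fun_eq_iff)

lemma bihom_wirt_zbar:
  assumes f: "bihom m n f"
  shows "(n = 0 \<longrightarrow> wirt 1 j f = (\<lambda>z. 0)) \<and> (\<forall>n'. n = Suc n' \<longrightarrow> bihom m n' (wirt 1 j f))"
  unfolding wirt_zbar_via_cnj[OF bihom_polyfun[OF f]]
  using bihom_wirt_z[OF bihom_cnj[OF f], of j] by (auto intro: bihom_cnj)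

lemma euler_z: "bihom m n f \<Longrightarrow> (\<Sum>j\<in>UNIV. z $ j * wirt (-1) j f z) = of_nat m * f z"
proof (induction rule: bihom.induct)
  case (coord m n f k)
  have "(\<Sum>j\<in>UNIV. z $ j * wirt (-1) j (\<lambda>z. z $ k * f z) z)
     = (\<Sum>j\<in>UNIV. z $ k * (z $ j * wirt (-1) j f z) + (if j = k then z $ k * f z else 0))"
    using coord by (intro sum.cong refl) (simp add: wirt_coord bihom_polyfun distrib_left mult.left_commute)
  then show ?case using coord by (simp add: sum.distrib flip: sum_distrib_left) (simp add: algebra_simps)
next
  case (cnj_coord m n f k)
  have "(\<Sum>j\<in>UNIV. z $ j * wirt (-1) j (\<lambda>z. cnj (z $ k) * f z) z)
     = cnj (z $ k) * (\<Sum>j\<in>UNIV. z $ j * wirt (-1) j f z)"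
    unfolding sum_distrib_left using cnj_coord.hyps
    by (intro sum.cong refl) (simp add: wirt_cnj_coord bihom_polyfun)
  then show ?case using cnj_coord.IH by simp
qed (auto simp: wirt_const wirt_add bihom_polyfun distrib_left sum.distrib)

lemma euler_zbar:
  assumes f: "bihom m n f"
  shows "(\<Sum>j\<in>UNIV. cnj (z $ j) * wirt 1 j f z) = of_nat n * f z"
proof -
  have "cnj (\<Sum>j\<in>UNIV. z $ j * wirt (-1) j (\<lambda>z. cnj (f z)) z) = of_nat n * f z"
    unfolding euler_z[OF bihom_cnj[OF f]] by simp
  then show ?thesis unfolding wirt_zbar_via_cnj[OF bihom_polyfun[OF f]] by simp
qed

definition harmonic :: "(complex ^ 'd::finite \<Rightarrow> complex) \<Rightarrow> bool" where
  "harmonic f \<longleftrightarrow> (\<forall>z. (\<Sum>j\<in>UNIV. wirt (-1) j (wirt 1 j f) z) = 0)"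

lemma harmonic_iff: "harmonic f \<longleftrightarrow> (\<forall>z. complex_laplacian f z = 0)"
  by (simp add: harmonic_def complex_laplacian_def d_z_wirt d_zbar_wirt)

lemma harmonic_wirt:
  assumes "polyfun f" "harmonic f"
  shows "harmonic (wirt \<epsilon> k f)"
proof -
  have "(\<Sum>j\<in>UNIV. wirt (-1) j (wirt 1 j (wirt \<epsilon> k f)) z) = 0" for z
  proof -
    have "(\<Sum>j\<in>UNIV. wirt (-1) j (wirt 1 j (wirt \<epsilon> k f)) z) = (\<Sum>j\<in>UNIV. wirt \<epsilon> k (wirt (-1) j (wirt 1 j f)) z)"
      by (simp add: wirt_commute[OF assms(1), of 1 _ \<epsilon> k] wirt_commute[OF polyfun_wirt[OF assms(1)], of "-1" _ \<epsilon> k])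
    also have "\<dots> = wirt \<epsilon> k (\<lambda>z. \<Sum>j\<in>UNIV. wirt (-1) j (wirt 1 j f) z) z"
      by (subst wirt_sum) (auto intro: polyfun_wirt assms(1))
    also have "\<dots> = 0" using assms(2) by (simp add: harmonic_def wirt_const)
    finally show ?thesis .
  qed
  then show ?thesis by (simp add: harmonic_def)
qed

section \<open>Orthogonality of the spaces of harmonics\<close>

definition herm :: "complex ^ 'd::finite \<Rightarrow> complex ^ 'd \<Rightarrow> complex" where
  "herm z v = (\<Sum>j\<in>UNIV. z $ j * cnj (v $ j))"

lemma herm_add_left: "herm (x + y) v = herm x v + herm y v"
  and herm_add_right: "herm v (x + y) = herm v x + herm v y"
  and herm_diff_left: "herm (x - y) v = herm x v - herm y v"
  and herm_diff_right: "herm v (x - y) = herm v x - herm v y"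
  and herm_scale_left: "herm (a *s x) v = a * herm x v"
  and herm_scale_right: "herm v (a *s x) = cnj a * herm v x"
  and cnj_herm: "cnj (herm x v) = herm v x"
  by (auto simp: herm_def algebra_simps sum.distrib sum_subtractf sum_distrib_left)

lemma herm_scaleR_left: "herm (r *\<^sub>R x) v = of_real r * herm x v"
  by (simp add: herm_def sum_distrib_left scaleR_conv_of_real[where 'a=complex] mult.assoc)

lemma herm_self: "herm z z = of_real ((norm z)\<^sup>2)"
  unfolding herm_def norm_vec_def L2_set_def
  by (simp add: complex_mult_cnj cmod_power2 sum_nonneg)

text \<open>
  For a unit vector \<open>v\<close> and \<open>|c| = 1\<close> these unitary maps are the only symmetries of
  the sphere used below: they act transitively on it, and the generators of the one-parameter groups
  \<open>c = exp (\<i> t)\<close> for varying \<open>v\<close> span the Lie algebra of the unitary group.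
\<close>

definition unitary_reflection :: "complex ^ 'd::finite \<Rightarrow> complex \<Rightarrow> complex ^ 'd \<Rightarrow> complex ^ 'd" where
  "unitary_reflection v c z = z + ((c - 1) * herm z v) *s v"

lemma unitary_reflection_component:
  "unitary_reflection v c z $ k = (\<Sum>j\<in>UNIV. (of_bool (j = k) + (c - 1) * cnj (v $ j) * v $ k) * z $ j)"
proof -
  have "(\<Sum>j\<in>UNIV. (of_bool (j = k) + (c - 1) * cnj (v $ j) * v $ k) * z $ j)
      = (\<Sum>j\<in>UNIV. (if j = k then z $ j else 0) + (c - 1) * v $ k * (z $ j * cnj (v $ j)))"
    by (intro sum.cong refl) (simp add: algebra_simps)
  also have "\<dots> = z $ k + (c - 1) * v $ k * herm z v"
    by (simp add: sum.distrib herm_def flip: sum_distrib_left)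
  finally show ?thesis by (simp add: unitary_reflection_def mult_ac)
qed

lemma linear_unitary_reflection: "linear (unitary_reflection v c)"
  by (rule linearI)
    (auto simp: vec_eq_iff unitary_reflection_def herm_add_left herm_scaleR_left algebra_simps scaleR_conv_of_real[where 'a=complex])

lemma norm_unitary_reflection:
  assumes v: "herm v v = 1" and c: "norm c = 1"
  shows "norm (unitary_reflection v c z) = norm z"
proof -
  have cc: "c * cnj c = 1" using c complex_norm_square[of c] by simp
  define h where "h = herm z v"
  have "herm (unitary_reflection v c z) (unitary_reflection v c z)
     = herm z z + ((c - 1) * h * cnj h + cnj (c - 1) * cnj h * h + (c - 1) * cnj (c - 1) * h * cnj h)"
    unfolding unitary_reflection_def herm_add_left herm_add_right herm_scale_left herm_scale_right
    by (simp add: v h_def cnj_herm mult.assoc) (simp add: algebra_simps)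
  also have "(c - 1) * h * cnj h + cnj (c - 1) * cnj h * h + (c - 1) * cnj (c - 1) * h * cnj h
     = h * cnj h * (c * cnj c - 1)"
    by (simp add: algebra_simps)
  finally have "complex_of_real ((norm (unitary_reflection v c z))\<^sup>2) = of_real ((norm z)\<^sup>2)"
    by (simp add: herm_self cc)
  then show ?thesis by (simp only: of_real_eq_iff) simp
qed

abbreviation sint :: "(complex ^ 'd::finite \<Rightarrow> complex) \<Rightarrow> complex" where
  "sint f \<equiv> (\<integral>x. f x \<partial>sphere_measure)"

lemma polyfun_integrable: "polyfun f \<Longrightarrow> integrable sphere_measure f"
  by (intro integrable_sphere_continuous polyfun_continuous_on)

lemma integral_cong_sphere:
  "(\<And>x. x \<in> sphere 0 1 \<Longrightarrow> f x = g x) \<Longrightarrow> (\<integral>x. f x \<partial>sphere_measure) = (\<integral>x. g x \<partial>sphere_measure)"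
  by (intro Bochner_Integration.integral_cong refl) (auto simp: space_sphere_measure)

lemma norm_cis_minus_1_le: "norm (cis t - 1) \<le> \<bar>t\<bar>"
proof -
  have "norm (cis t - 1) = 2 * \<bar>sin (t / 2)\<bar>"
    using dist_exp_i_1[of t] by (simp add: cis_conv_exp mult.commute)
  also have "\<dots> \<le> 2 * \<bar>t / 2\<bar>" using abs_sin_x_le_abs_x[of "t / 2"] by simp
  finally show ?thesis by simp
qed

lemma has_vector_derivative_quotient_limit:
  fixes g :: "real \<Rightarrow> 'a::real_normed_vector"
  assumes "(g has_vector_derivative D) (at 0)"
  shows "((\<lambda>t. (g t - g 0) /\<^sub>R t) \<longlongrightarrow> D) (at 0)"
proof -
  have "((\<lambda>t. norm ((g t - g 0 - t *\<^sub>R D) /\<^sub>R norm t)) \<longlongrightarrow> 0) (at 0)"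
    using assms unfolding has_vector_derivative_def has_derivative_def by (intro tendsto_norm_zero) simp
  moreover have "\<forall>\<^sub>F t in at 0. norm ((g t - g 0 - t *\<^sub>R D) /\<^sub>R norm t) = norm ((g t - g 0) /\<^sub>R t - D)"
  proof (rule eventually_at_filter[THEN iffD2], rule always_eventually, intro allI impI)
    fix t :: real assume "t \<noteq> 0"
    then have "(g t - g 0) /\<^sub>R t - D = (g t - g 0 - t *\<^sub>R D) /\<^sub>R t"
      by (simp add: algebra_simps)
    then show "norm ((g t - g 0 - t *\<^sub>R D) /\<^sub>R norm t) = norm ((g t - g 0) /\<^sub>R t - D)" by simp
  qed
  ultimately have "((\<lambda>t. norm ((g t - g 0) /\<^sub>R t - D)) \<longlongrightarrow> 0) (at 0)"
    by (rule Lim_transform_eventually)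
  then show ?thesis by (simp add: tendsto_norm_zero_iff LIM_zero_iff)
qed

text \<open>
  For \<open>U\<^sub>t\<close> the reflection with \<open>c = exp (\<i> t)\<close>, the integral of
  \<open>f \<circ> U\<^sub>t\<close> over the sphere does not depend on \<open>t\<close>. Its derivative at \<open>t = 0\<close>
  is computed by dominated convergence.
\<close>

lemma integral_rotation_derivative:
  assumes f: "polyfun f" and v: "herm v v = 1"
  shows "sint (\<lambda>z. frechet_derivative f (at z) ((\<i> * herm z v) *s v)) = 0"
proof -
  let ?U = "\<lambda>t. unitary_reflection v (cis t)"
  define q where "q n z = (f (?U (1 / real (Suc n)) z) - f z) * of_real (real (Suc n))" for n z
  have pt: "polyfun (\<lambda>z. f (?U t z))" for t
  proof -
    have "polyfun (\<lambda>z. f (?U t z))" using f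
    proof (induction rule: polyfun.induct)
      case (coord f k)
      show ?case unfolding unitary_reflection_component
        by (intro polyfun_mult polyfun_sum polyfun_cmult coord.IH[unfolded unitary_reflection_component])
          (auto intro: polyfun_mult polyfun.const bihom_polyfun[OF bihom_coord1] coord.IH)
    next
      case (cnj_coord f k)
      show ?case unfolding unitary_reflection_component cnj_sum complex_cnj_mult
        by (intro polyfun_mult polyfun_sum polyfun_cmult)
          (auto intro: polyfun_mult polyfun.const bihom_polyfun[OF bihom_cnj_coord1] cnj_coord.IH)
    qed (auto intro: polyfun.intros)
    then show ?thesis .
  qed
  have int0: "sint (q n) = 0" for n
  proof -
    have "sint (\<lambda>z. f (?U (1 / real (Suc n)) z)) = sint f"
      by (rule integral_sphere_isometry[OF linear_unitary_reflection norm_unitary_reflection[OF v]])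
        (auto intro: polyfun_continuous_on f)
    then show ?thesis unfolding q_def
      using polyfun_integrable[OF pt] polyfun_integrable[OF f] by simp
  qed
  obtain C where C: "\<And>x y. x \<in> cball 0 1 \<Longrightarrow> y \<in> cball 0 1 \<Longrightarrow> norm (f x - f y) \<le> C * norm (x - y)"
    using polyfun_lipschitz[OF f] by blast
  have "continuous_on (sphere 0 1) (\<lambda>z. herm z v *s v)"
    unfolding herm_def vector_scalar_mult_def by (intro continuous_intros)
  from compact_imp_bounded[OF compact_continuous_image[OF this compact_sphere]]
  obtain B where B: "\<And>z. z \<in> sphere 0 1 \<Longrightarrow> norm (herm z v *s v) \<le> B"
    unfolding bounded_iff by blast
  have diff: "?U t z - z = (cis t - 1) *s (herm z v *s v)" for t z
    by (simp add: unitary_reflection_def)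
  have norm_smult: "norm (a *s w) = norm a * norm w" for a :: complex and w :: "complex ^ 'a"
    by (simp add: norm_vec_def L2_set_def norm_mult power_mult_distrib sum_distrib_left[symmetric] real_sqrt_mult)
  have bnd: "norm (q n z) \<le> \<bar>C\<bar> * \<bar>B\<bar>" if z: "z \<in> sphere 0 1" for n z
  proof -
    have "norm (f (?U (1 / real (Suc n)) z) - f z) \<le> C * norm (?U (1 / real (Suc n)) z - z)"
      by (rule C) (use z norm_unitary_reflection[OF v] in auto)
    also have "\<dots> \<le> \<bar>C\<bar> * ((1 / real (Suc n)) * \<bar>B\<bar>)"
    proof (intro mult_mono)
      show "norm (?U (1 / real (Suc n)) z - z) \<le> (1 / real (Suc n)) * \<bar>B\<bar>"
        unfolding diff norm_smult[of _ "herm z v *s v"]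
      proof (intro mult_mono)
        show "norm (cis (1 / real (Suc n)) - 1) \<le> 1 / real (Suc n)"
          using norm_cis_minus_1_le[of "1 / real (Suc n)"] by simp
        show "norm (herm z v *s v) \<le> \<bar>B\<bar>" using B[OF z] by simp
      qed auto
    qed auto
    finally have "norm (f (?U (1 / real (Suc n)) z) - f z) * real (Suc n) \<le> \<bar>C\<bar> * \<bar>B\<bar>"
      by (simp add: field_simps)
    then show ?thesis by (simp only: q_def norm_mult norm_of_real abs_of_nat)
  qed
  have lim: "(\<lambda>n. q n z) \<longlonglongrightarrow> frechet_derivative f (at z) ((\<i> * herm z v) *s v)" for z
  proof -
    have "((\<lambda>t. ?U t z) has_vector_derivative (\<i> * herm z v) *s v) (at 0)"
    proof -
      have 1: "(cis has_vector_derivative \<i>) (at 0)"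
        unfolding has_vector_derivative_def
        by (auto intro!: derivative_eq_intros simp: cis_conv_exp scaleR_conv_of_real)
      have bl: "bounded_linear (\<lambda>c. (c * herm z v) *s v)"
        unfolding linear_conv_bounded_linear[symmetric]
        by (rule linearI; simp add: vec_eq_iff algebra_simps)
      from bounded_linear.has_vector_derivative[OF bl 1]
      have "((\<lambda>t. (cis t * herm z v) *s v) has_vector_derivative (\<i> * herm z v) *s v) (at 0)" .
      then have "((\<lambda>t. (z - herm z v *s v) + (cis t * herm z v) *s v) has_vector_derivative 0 + (\<i> * herm z v) *s v) (at 0)"
        by (intro has_vector_derivative_add) auto
      moreover have "(\<lambda>t. (z - herm z v *s v) + (cis t * herm z v) *s v) = (\<lambda>t. ?U t z)"
        by (auto simp: unitary_reflection_def vec_eq_iff algebra_simps)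
      ultimately show ?thesis by simp
    qed
    moreover have "(f has_derivative frechet_derivative f (at z)) (at (?U 0 z))"
      using polyfun_has_derivative[OF f] by (simp add: unitary_reflection_def)
    ultimately have "((\<lambda>t. f (?U t z)) has_vector_derivative frechet_derivative f (at z) ((\<i> * herm z v) *s v)) (at 0)"
      using vector_derivative_diff_chain_within[of "\<lambda>t. ?U t z" "(\<i> * herm z v) *s v" 0 UNIV f "frechet_derivative f (at z)"]
      by (simp add: o_def has_derivative_at_withinI)
    then have *: "((\<lambda>t. (f (?U t z) - f (?U 0 z)) /\<^sub>R t) \<longlongrightarrow> frechet_derivative f (at z) ((\<i> * herm z v) *s v)) (at 0)"
      by (rule has_vector_derivative_quotient_limit)
    have "filterlim (\<lambda>n. 1 / real (Suc n)) (at 0) sequentially"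
      unfolding filterlim_at using LIMSEQ_inverse_real_of_nat by (auto simp: inverse_eq_divide)
    from filterlim_compose[OF * this] show ?thesis
      unfolding q_def by (simp add: unitary_reflection_def scaleR_conv_of_real mult.commute)
  qed
  have "polyfun (\<lambda>z. frechet_derivative f (at z) ((\<i> * herm z v) *s v))"
    unfolding frechet_derivative_wirt[OF f] herm_def vector_smult_component complex_cnj_mult cnj_sum
    by (intro polyfun_sum polyfun.add polyfun_mult polyfun_wirt f polyfun.const
      bihom_polyfun[OF bihom_coord1] bihom_polyfun[OF bihom_cnj_coord1])
  then have m: "(\<lambda>z. frechet_derivative f (at z) ((\<i> * herm z v) *s v)) \<in> borel_measurable sphere_measure"
    by (intro borel_measurable_integrable polyfun_integrable)
  have mq: "q n \<in> borel_measurable sphere_measure" for n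
    unfolding q_def
    by (intro borel_measurable_times borel_measurable_diff borel_measurable_const
      borel_measurable_integrable polyfun_integrable pt f)
  have "(\<lambda>n. sint (q n)) \<longlonglongrightarrow> sint (\<lambda>z. frechet_derivative f (at z) ((\<i> * herm z v) *s v))"
    by (rule integral_dominated_convergence[where w = "\<lambda>_. \<bar>C\<bar> * \<bar>B\<bar>", OF m mq])
      (auto simp: space_sphere_measure lim bnd)
  then show ?thesis by (simp add: int0 LIMSEQ_const_iff)
qed

text \<open>
  The elementary generators of the complexified Lie algebra of the unitary group, acting on
  functions.
\<close>

definition rotation_op :: "'d \<Rightarrow> 'd \<Rightarrow> (complex ^ 'd::finite \<Rightarrow> complex) \<Rightarrow> complex ^ 'd \<Rightarrow> complex" where
  "rotation_op j k f z = z $ j * wirt (-1) k f z - cnj (z $ k) * wirt 1 j f z"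

lemma polyfun_rotation_op: "polyfun f \<Longrightarrow> polyfun (rotation_op j k f)"
proof -
  assume f: "polyfun f"
  have "rotation_op j k f = (\<lambda>z. z $ j * wirt (-1) k f z + (-1) * (cnj (z $ k) * wirt 1 j f z))"
    by (auto simp: rotation_op_def)
  moreover have "polyfun \<dots>" using f by (intro polyfun.add polyfun.coord polyfun.cnj_coord polyfun_cmult polyfun_wirt)
  ultimately show ?thesis by simp
qed

text \<open>
  The derivative along the reflections with axis \<open>v\<close> is the form
  \<open>\<i> \<Sum>\<^sub>j\<^sub>k cnj v\<^sub>j v\<^sub>k L\<^sub>j\<^sub>k\<close> in \<open>v\<close>. Its integral vanishes
  for all \<open>v\<close>, hence by polarization so do the integrals of its coefficients.
\<close>

lemma integral_rotation_op:
  fixes f :: "complex ^ 'd::finite \<Rightarrow> complex"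
  assumes f: "polyfun f"
  shows "sint (rotation_op j k f) = 0"
proof -
  define q where "q j k = sint (rotation_op j k f)" for j k
  define Q where "Q v = (\<Sum>j\<in>UNIV. \<Sum>k\<in>UNIV. cnj (v $ j) * v $ k * q j k)" for v :: "complex ^ 'd"
  have unit: "Q v = 0" if v: "herm v v = 1" for v
  proof -
    have "frechet_derivative f (at z) ((\<i> * herm z v) *s v) = \<i> * (\<Sum>j\<in>UNIV. \<Sum>k\<in>UNIV. cnj (v $ j) * v $ k * rotation_op j k f z)" for z
    proof -
      have "frechet_derivative f (at z) ((\<i> * herm z v) *s v)
        = (\<Sum>k\<in>UNIV. (\<Sum>j\<in>UNIV. \<i> * (cnj (v $ j) * v $ k * (z $ j * wirt (-1) k f z)))
          - (\<Sum>j\<in>UNIV. \<i> * (cnj (v $ k) * v $ j * (cnj (z $ j) * wirt 1 k f z))))"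
        unfolding frechet_derivative_wirt[OF f] herm_def
        by (intro sum.cong refl) (simp add: sum_distrib_left sum_distrib_right mult_ac sum_negf)
      also have "\<dots> = (\<Sum>k\<in>UNIV. \<Sum>j\<in>UNIV. \<i> * (cnj (v $ j) * v $ k * (z $ j * wirt (-1) k f z)))
          - (\<Sum>k\<in>UNIV. \<Sum>j\<in>UNIV. \<i> * (cnj (v $ k) * v $ j * (cnj (z $ j) * wirt 1 k f z)))"
        by (rule sum_subtractf)
      also have "(\<Sum>k\<in>UNIV. \<Sum>j\<in>UNIV. \<i> * (cnj (v $ j) * v $ k * (z $ j * wirt (-1) k f z)))
         = (\<Sum>j\<in>UNIV. \<Sum>k\<in>UNIV. \<i> * (cnj (v $ j) * v $ k * (z $ j * wirt (-1) k f z)))"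
        by (rule sum.swap)
      finally show ?thesis
        by (simp add: rotation_op_def sum_distrib_left sum_subtractf algebra_simps)
    qed
    then have "0 = sint (\<lambda>z. \<i> * (\<Sum>j\<in>UNIV. \<Sum>k\<in>UNIV. cnj (v $ j) * v $ k * rotation_op j k f z))"
      using integral_rotation_derivative[OF f v] by simp
    also have "\<dots> = \<i> * Q v"
      using polyfun_integrable[OF polyfun_rotation_op[OF f]] by (simp add: Q_def q_def)
    finally show ?thesis by simp
  qed
  have all: "Q v = 0" for v
  proof (cases "v = 0")
    case False
    define u where "u = v /\<^sub>R norm v"
    have "norm u = 1" using False by (simp add: u_def)
    then have "herm u u = 1" by (simp add: herm_self)
    moreover have "v $ j = of_real (norm v) * u $ j" for j
      using False by (simp add: u_def scaleR_conv_of_real[where 'a=complex])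
    then have "Q v = (\<Sum>j\<in>UNIV. \<Sum>k\<in>UNIV. cnj (of_real (norm v) * u $ j) * (of_real (norm v) * u $ k) * q j k)"
      unfolding Q_def by (simp only:)
    then have "Q v = of_real ((norm v)\<^sup>2) * Q u"
      by (simp add: Q_def sum_distrib_left power2_eq_square mult_ac)
    ultimately show ?thesis using unit by simp
  qed (simp add: Q_def)
  \<comment> \<open>With \<open>a = 1\<close>, the choices \<open>b = 1\<close> and \<open>b = \<i>\<close> give the sum and the difference of the two off-diagonal coefficients.\<close>
  have two: "Q (axis j a + axis k b) = cnj a * a * q j j + cnj a * b * q j k + cnj b * a * q k j + cnj b * b * q k k" for j k a b
  proof -
    have ax: "(axis j a + axis k b) $ l = of_bool (l = j) * a + of_bool (l = k) * b" for l
      by (simp add: axis_def)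
    have cnj_bool: "cnj (of_bool P) = of_bool P" for P by (cases P) auto
    have delta: "(\<Sum>l\<in>UNIV. (of_bool (l = j) * s + of_bool (l = k) * t) * X l) = s * X j + t * X k"
      for X :: "'d \<Rightarrow> complex" and s t
    proof -
      have "(\<Sum>l\<in>UNIV. (of_bool (l = j) * s + of_bool (l = k) * t) * X l)
          = (\<Sum>l\<in>UNIV. (if l = j then s * X l else 0) + (if l = k then t * X l else 0))"
        by (intro sum.cong refl) (simp add: distrib_right)
      then show ?thesis by (simp add: sum.distrib)
    qed
    have "Q (axis j a + axis k b)
        = (\<Sum>l\<in>UNIV. (of_bool (l = j) * cnj a + of_bool (l = k) * cnj b)
            * (\<Sum>m\<in>UNIV. (of_bool (m = j) * a + of_bool (m = k) * b) * q l m))"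
      unfolding Q_def ax sum_distrib_left by (simp add: mult.assoc cnj_bool)
    also have "\<dots> = cnj a * (a * q j j + b * q j k) + cnj b * (a * q k j + b * q k k)"
      by (simp only: delta)
    finally show ?thesis by (simp add: algebra_simps)
  qed
  have jj: "q j j = 0" for j using all two[of j 1 j 0] by simp
  have "q j k + q k j = 0" using all two[of j 1 k 1] jj by simp
  moreover have "\<i> * q j k - \<i> * q k j = 0" using all two[of j 1 k \<i>] jj by simp
  ultimately have "q j k = 0" by simp
  then show ?thesis by (simp add: q_def)
qed

text \<open>
  By Euler's identities \<open>\<Sum>\<^sub>j L\<^sub>j\<^sub>j f = (a - b) f\<close>.
\<close>

lemma integral_bidegree_zero:
  assumes f: "bihom a b f" and "a \<noteq> b"
  shows "sint f = 0"
proof -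
  have "(\<Sum>j\<in>UNIV. rotation_op j j f z) = (of_nat a - of_nat b) * f z" for z
    using euler_z[OF f, of z] euler_zbar[OF f, of z] by (simp add: rotation_op_def sum_subtractf algebra_simps)
  then have "(of_nat a - of_nat b) * sint f = sint (\<lambda>z. \<Sum>j\<in>UNIV. rotation_op j j f z)"
    by simp
  also have "\<dots> = 0"
    using polyfun_integrable[OF polyfun_rotation_op[OF bihom_polyfun[OF f]]] by (simp add: integral_rotation_op[OF bihom_polyfun[OF f]])
  finally show ?thesis using assms(2) by simp
qed

text \<open>
  Integration by parts on the sphere. Summing \<open>L\<^sub>j\<^sub>k (z\<^sub>k f)\<close> over \<open>k\<close>
  gives \<open>(d + a) z\<^sub>j f - (\<Sum>\<^sub>k z\<^sub>k \<bar>z\<^sub>k) \<partial>f/\<partial>\<bar>z\<^sub>j\<close> by Euler's identity,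
  and \<open>\<Sum>\<^sub>k z\<^sub>k \<bar>z\<^sub>k = 1\<close> on the sphere.
\<close>

lemma integral_coord_mult:
  fixes f :: "complex ^ 'd::finite \<Rightarrow> complex"
  assumes f: "bihom a b f"
  shows "of_nat (CARD('d) + a) * sint (\<lambda>z. z $ j * f z) = sint (wirt 1 j f)"
proof -
  have pf: "polyfun f" using f by (rule bihom_polyfun)
  have "(\<Sum>k\<in>UNIV. rotation_op j k (\<lambda>z. z $ k * f z) z) = of_nat (CARD('d) + a) * (z $ j * f z) - wirt 1 j f z"
    if z: "z \<in> sphere 0 1" for z
  proof -
    have n: "(\<Sum>k\<in>UNIV. z $ k * cnj (z $ k)) = 1" using z herm_self[of z] by (simp add: herm_def)
    have "(\<Sum>k\<in>UNIV. rotation_op j k (\<lambda>z. z $ k * f z) z)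
      = (\<Sum>k\<in>UNIV. z $ j * (z $ k * wirt (-1) k f z) + z $ j * f z - (z $ k * cnj (z $ k)) * wirt 1 j f z)"
      by (intro sum.cong refl) (simp add: rotation_op_def wirt_coord[OF pf], simp add: algebra_simps)
    also have "\<dots> = z $ j * (of_nat a * f z) + of_nat CARD('d) * (z $ j * f z) - wirt 1 j f z"
      by (simp add: sum.distrib sum_subtractf n euler_z[OF f] flip: sum_distrib_left sum_distrib_right)
    finally show ?thesis by (simp add: algebra_simps)
  qed
  then have "sint (\<lambda>z. of_nat (CARD('d) + a) * (z $ j * f z) - wirt 1 j f z) = sint (\<lambda>z. \<Sum>k\<in>UNIV. rotation_op j k (\<lambda>z. z $ k * f z) z)"
    by (intro integral_cong_sphere) simp
  also have "\<dots> = 0"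
    using polyfun_integrable[OF polyfun_rotation_op[OF polyfun.coord[OF pf]]] by (simp add: integral_rotation_op[OF polyfun.coord[OF pf]])
  finally show ?thesis
    using polyfun_integrable[OF polyfun.coord[OF pf, of j]] polyfun_integrable[OF polyfun_wirt[OF pf, of 1 j]]
    by simp
qed

lemma integral_cnj_coord_mult:
  fixes f :: "complex ^ 'd::finite \<Rightarrow> complex"
  assumes f: "bihom a b f"
  shows "of_nat (CARD('d) + b) * sint (\<lambda>z. cnj (z $ j) * f z) = sint (wirt (-1) j f)"
proof -
  have 1: "of_nat (CARD('d) + b) * sint (\<lambda>z. z $ j * cnj (f z)) = sint (\<lambda>z. cnj (wirt (-1) j f z))"
    using integral_coord_mult[OF bihom_cnj[OF f], of j] wirt_cnj[OF bihom_polyfun[OF f], of 1 j] by simp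
  have "sint (\<lambda>z. cnj (z $ j) * f z) = sint (\<lambda>z. cnj (z $ j * cnj (f z)))" by simp
  also have "\<dots> = cnj (sint (\<lambda>z. z $ j * cnj (f z)))" by (rule Bochner_Integration.integral_cnj)
  finally have "of_nat (CARD('d) + b) * sint (\<lambda>z. cnj (z $ j) * f z)
      = cnj (of_nat (CARD('d) + b) * sint (\<lambda>z. z $ j * cnj (f z)))" by simp
  also have "\<dots> = sint (wirt (-1) j f)" unfolding 1 Bochner_Integration.integral_cnj by simp
  finally show ?thesis .
qed

text \<open>
  Euler's identity writes \<open>m p\<close> as \<open>\<Sum>\<^sub>j z\<^sub>j \<partial>p/\<partial>z\<^sub>j\<close>;
  integrating by parts produces the Laplacian of \<open>p\<close>.
\<close>

lemma harmonic_integral_zero: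
  fixes p :: "complex ^ 'd::finite \<Rightarrow> complex"
  assumes p: "bihom m n p" "harmonic p" and mn: "m + n > 0"
  shows "sint p = 0"
proof (cases m)
  case 0
  then show ?thesis using integral_bidegree_zero[OF p(1)] mn by simp
next
  case (Suc m')
  have pp: "polyfun p" using p(1) by (rule bihom_polyfun)
  have b: "bihom m' n (wirt (-1) j p)" for j using bihom_wirt_z[OF p(1)] Suc by blast
  have "of_nat (CARD('d) + m') * (of_nat m * sint p)
    = of_nat (CARD('d) + m') * sint (\<lambda>z. \<Sum>j\<in>UNIV. z $ j * wirt (-1) j p z)"
    by (simp add: euler_z[OF p(1)])
  also have "\<dots> = (\<Sum>j\<in>UNIV. of_nat (CARD('d) + m') * sint (\<lambda>z. z $ j * wirt (-1) j p z))"
    using polyfun_integrable[OF polyfun.coord[OF polyfun_wirt[OF pp]]]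
    by (simp add: sum_distrib_left)
  also have "\<dots> = (\<Sum>j\<in>UNIV. sint (wirt 1 j (wirt (-1) j p)))"
    by (simp only: integral_coord_mult[OF b])
  also have "\<dots> = sint (\<lambda>z. \<Sum>j\<in>UNIV. wirt (-1) j (wirt 1 j p) z)"
    using polyfun_integrable[OF polyfun_wirt[OF polyfun_wirt[OF pp]]]
    by (simp add: wirt_commute[OF pp, of 1 _ "-1"])
  also have "\<dots> = 0" using p(2) by (simp add: harmonic_def)
  finally show ?thesis using Suc by (simp del: of_nat_add of_nat_Suc)
qed

text \<open>
  Integrating by parts against a factor \<open>z\<^sub>j\<close> or \<open>\<bar>z\<^sub>j\<close> of \<open>f\<close>
  either lowers the degrees of both \<open>p\<close> and \<open>f\<close> by one, or lowers that of \<open>f\<close>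
  by two. Derivatives of \<open>p\<close> remain harmonic and the inequality between the degrees
  is preserved, so the induction ends with the integral of a single harmonic.
\<close>

lemma harmonic_orthogonal_lower_degree:
  fixes p f :: "complex ^ 'd::finite \<Rightarrow> complex"
  assumes "bihom m n p" "harmonic p" "bihom a b f" "a + b < m + n"
  shows "sint (\<lambda>z. p z * f z) = 0"
  using assms
proof (induction "a + b" arbitrary: a b m n p f rule: less_induct)
  case less
  note IH = less.hyps
  have "sint (\<lambda>z. p z * f z) = 0" if "bihom a' b' f" "a' + b' = a + b" for a' b'
    using that
  proof (induction rule: bihom.induct)
    case (const c)
    then show ?case using harmonic_integral_zero[OF less.prems(1,2)] less.prems(4) by simp
  next
    case (add m' n' f1 f2)
    have "polyfun f1" "polyfun f2" using add.hyps bihom_polyfun by blast+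
    then have "integrable sphere_measure (\<lambda>z. p z * f1 z)" "integrable sphere_measure (\<lambda>z. p z * f2 z)"
      using less.prems(1) bihom_polyfun polyfun_mult polyfun_integrable by blast+
    then show ?case using add by (simp add: distrib_left)
  next
    case (coord a' b' f' j)
    have pp: "polyfun p" "polyfun f'" using less.prems(1) coord.hyps bihom_polyfun by blast+
    have 1: "sint (\<lambda>z. wirt 1 j p z * f' z) = 0"
    proof (cases n)
      case 0
      then show ?thesis using bihom_wirt_zbar[OF less.prems(1), of j] by simp
    next
      case (Suc n')
      then show ?thesis using bihom_wirt_zbar[OF less.prems(1), of j] less.prems(4) coord
        by (intro IH[of a' b' m n']) (auto intro: harmonic_wirt less.prems pp)
    qed
    have 2: "sint (\<lambda>z. p z * wirt 1 j f' z) = 0"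
    proof (cases b')
      case 0
      then show ?thesis using bihom_wirt_zbar[OF coord.hyps, of j] by simp
    next
      case (Suc b'')
      then show ?thesis using bihom_wirt_zbar[OF coord.hyps, of j] less.prems(4) coord
        by (intro IH[of a' b'' m n]) (auto intro: less.prems)
    qed
    have "of_nat (CARD('d) + (m + a')) * sint (\<lambda>z. z $ j * (p z * f' z)) = sint (wirt 1 j (\<lambda>z. p z * f' z))"
      by (rule integral_coord_mult[OF bihom_mult[OF less.prems(1) coord.hyps]])
    also have "\<dots> = sint (\<lambda>z. p z * wirt 1 j f' z + wirt 1 j p z * f' z)"
      by (simp add: wirt_mult[OF pp])
    also have "\<dots> = 0"
      using polyfun_integrable[OF polyfun_mult[OF pp(1) polyfun_wirt[OF pp(2)]]]
        polyfun_integrable[OF polyfun_mult[OF polyfun_wirt[OF pp(1)] pp(2)]] 1 2 by simp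
    finally show ?case by (simp add: mult.left_commute del: of_nat_add)
  next
    case (cnj_coord a' b' f' j)
    have pp: "polyfun p" "polyfun f'" using less.prems(1) cnj_coord.hyps bihom_polyfun by blast+
    have 1: "sint (\<lambda>z. wirt (-1) j p z * f' z) = 0"
    proof (cases m)
      case 0
      then show ?thesis using bihom_wirt_z[OF less.prems(1), of j] by simp
    next
      case (Suc m')
      then show ?thesis using bihom_wirt_z[OF less.prems(1), of j] less.prems(4) cnj_coord
        by (intro IH[of a' b' m' n]) (auto intro: harmonic_wirt less.prems pp)
    qed
    have 2: "sint (\<lambda>z. p z * wirt (-1) j f' z) = 0"
    proof (cases a')
      case 0
      then show ?thesis using bihom_wirt_z[OF cnj_coord.hyps, of j] by simp
    next
      case (Suc a'')
      then show ?thesis using bihom_wirt_z[OF cnj_coord.hyps, of j] less.prems(4) cnj_coord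
        by (intro IH[of a'' b' m n]) (auto intro: less.prems)
    qed
    have "of_nat (CARD('d) + (n + b')) * sint (\<lambda>z. cnj (z $ j) * (p z * f' z)) = sint (wirt (-1) j (\<lambda>z. p z * f' z))"
      by (rule integral_cnj_coord_mult[OF bihom_mult[OF less.prems(1) cnj_coord.hyps]])
    also have "\<dots> = sint (\<lambda>z. p z * wirt (-1) j f' z + wirt (-1) j p z * f' z)"
      by (simp add: wirt_mult[OF pp])
    also have "\<dots> = 0"
      using polyfun_integrable[OF polyfun_mult[OF pp(1) polyfun_wirt[OF pp(2)]]]
        polyfun_integrable[OF polyfun_mult[OF polyfun_wirt[OF pp(1)] pp(2)]] 1 2 by simp
    finally show ?case by (simp add: mult.left_commute del: of_nat_add)
  qed simp
  then show ?case using less.prems(3) by blast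
qed

text \<open>
  If the bidegrees of \<open>p\<close> and \<open>q\<close> differ, then either \<open>p \<bar>q\<close> is not
  balanced or the total degrees of \<open>p\<close> and \<open>q\<close> differ.
\<close>

lemma harmonic_orthogonal:
  fixes p q :: "complex ^ 'd::finite \<Rightarrow> complex"
  assumes p: "bihom m n p" "harmonic p" and q: "bihom m' n' q" "harmonic q"
    and ne: "(m, n) \<noteq> (m', n')"
  shows "sint (\<lambda>z. p z * cnj (q z)) = 0"
proof -
  consider "m + n' \<noteq> n + m'" | "m' + n' < m + n" | "m + n < m' + n'"
    using ne by fastforce
  then show ?thesis
  proof cases
    case 1
    then show ?thesis using integral_bidegree_zero[OF bihom_mult[OF p(1) bihom_cnj[OF q(1)]]] by simp
  next
    case 2
    then show ?thesis using harmonic_orthogonal_lower_degree[OF p bihom_cnj[OF q(1)]] by simp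
  next
    case 3
    then have "sint (\<lambda>z. q z * cnj (p z)) = 0"
      using harmonic_orthogonal_lower_degree[OF q bihom_cnj[OF p(1)]] by simp
    moreover have "sint (\<lambda>z. p z * cnj (q z)) = sint (\<lambda>z. cnj (q z * cnj (p z)))"
      by (simp add: mult.commute)
    ultimately show ?thesis
      using Bochner_Integration.integral_cnj[of sphere_measure "\<lambda>z. q z * cnj (p z)"] by simp
  qed
qed

section \<open>Orthonormal bases of harmonics\<close>

text \<open>
  Gaussian elimination of one equation at a time. All dimension counts below reduce to this.
\<close>

lemma underdetermined_system:
  fixes A :: "'j \<Rightarrow> 'i \<Rightarrow> 'a::field"
  assumes "finite J" "finite I" "card J < card I"
  shows "\<exists>c. (\<exists>i\<in>I. c i \<noteq> 0) \<and> (\<forall>j\<in>J. (\<Sum>i\<in>I. c i * A j i) = 0)"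
  using assms
proof (induction J arbitrary: I A rule: finite_induct)
  case empty
  then have "I \<noteq> {}" by auto
  then show ?case by (intro exI[of _ "\<lambda>_. 1"]) auto
next
  case (insert j J)
  show ?case
  proof (cases "\<forall>i\<in>I. A j i = 0")
    case True
    obtain c where "\<exists>i\<in>I. c i \<noteq> 0" "\<forall>j\<in>J. (\<Sum>i\<in>I. c i * A j i) = 0"
      using insert.IH[of I A] insert.prems insert.hyps by auto
    then show ?thesis using True by (intro exI[of _ c]) auto
  next
    case False
    then obtain i0 where i0: "i0 \<in> I" "A j i0 \<noteq> 0" by blast
    define I' where "I' = I - {i0}"
    have I': "finite I'" "card J < card I'" "I = insert i0 I'" "i0 \<notin> I'"
      using insert.prems insert.hyps i0 by (auto simp: I'_def card_Diff_singleton)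
    \<comment> \<open>Equation \<open>j\<close> is solved for the unknown \<open>i0\<close>, which is then substituted in the others.\<close>
    obtain c where c: "\<exists>i\<in>I'. c i \<noteq> 0"
        "\<forall>j'\<in>J. (\<Sum>i\<in>I'. c i * (A j' i - A j' i0 * A j i / A j i0)) = 0"
      using insert.IH[of I' "\<lambda>j' i. A j' i - A j' i0 * A j i / A j i0"] I' by auto
    define s where "s = - (\<Sum>i\<in>I'. c i * A j i) / A j i0"
    define c' where "c' = c(i0 := s)"
    have sum: "(\<Sum>i\<in>I. c' i * X i) = s * X i0 + (\<Sum>i\<in>I'. c i * X i)" for X
    proof -
      have "(\<Sum>i\<in>I'. c' i * X i) = (\<Sum>i\<in>I'. c i * X i)"
        using I'(4) by (intro sum.cong) (auto simp: c'_def)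
      then show ?thesis using I' by (simp add: c'_def)
    qed
    have "(\<Sum>i\<in>I. c' i * A j' i) = 0" if "j' \<in> insert j J" for j'
    proof (cases "j' = j")
      case True
      then show ?thesis using i0(2) by (simp add: sum s_def)
    next
      case False
      then have "(\<Sum>i\<in>I'. c i * (A j' i - A j' i0 * A j i / A j i0)) = 0" using that c(2) by auto
      then have "(\<Sum>i\<in>I'. c i * A j' i) - (\<Sum>i\<in>I'. c i * A j i) * (A j' i0 / A j i0) = 0"
        by (simp add: algebra_simps sum_subtractf sum_distrib_left)
      then show ?thesis by (simp add: sum s_def)
    qed
    moreover have "\<exists>i\<in>I. c' i \<noteq> 0" using c(1) I'(3,4) by (auto simp: c'_def)
    ultimately show ?thesis by blast
  qed
qed

definition ip :: "(complex ^ 'd::finite \<Rightarrow> complex) \<Rightarrow> (complex ^ 'd \<Rightarrow> complex) \<Rightarrow> complex" where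
  "ip f g = sint (\<lambda>x. f x * cnj (g x))"

lemma ip_cong:
  "(\<And>x. x \<in> sphere 0 1 \<Longrightarrow> f x = f' x) \<Longrightarrow> (\<And>x. x \<in> sphere 0 1 \<Longrightarrow> g x = g' x) \<Longrightarrow> ip f g = ip f' g'"
  unfolding ip_def by (intro integral_cong_sphere) auto

lemma ip_integrable:
  fixes f g :: "complex ^ 'd::finite \<Rightarrow> complex"
  assumes "continuous_on (sphere 0 1) f" "continuous_on (sphere 0 1) g"
  shows "integrable sphere_measure (\<lambda>x. f x * cnj (g x))"
  using assms by (intro integrable_sphere_continuous continuous_intros)

lemma ip_sum_left:
  fixes g :: "complex ^ 'd::finite \<Rightarrow> complex"
  assumes "\<And>i. i \<in> I \<Longrightarrow> continuous_on (sphere 0 1) (f i)" "continuous_on (sphere 0 1) g"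
  shows "ip (\<lambda>x. \<Sum>i\<in>I. c i * f i x) g = (\<Sum>i\<in>I. c i * ip (f i) g)"
  unfolding ip_def sum_distrib_right mult.assoc
  by (subst Bochner_Integration.integral_sum)
    (auto intro!: integrable_mult_right ip_integrable assms)

lemma ip_diff_left:
  fixes g :: "complex ^ 'd::finite \<Rightarrow> complex"
  assumes "continuous_on (sphere 0 1) f" "continuous_on (sphere 0 1) h" "continuous_on (sphere 0 1) g"
  shows "ip (\<lambda>x. f x + (-1) * h x) g = ip f g - ip h g"
  using ip_integrable[OF assms(1,3)] ip_integrable[OF assms(2,3)]
  by (simp add: ip_def algebra_simps)

lemma ip_cnj: "cnj (ip f g) = ip g f"
proof -
  have "ip g f = sint (\<lambda>x. cnj (f x * cnj (g x)))" by (simp add: ip_def mult.commute)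
  also have "\<dots> = cnj (ip f g)" unfolding ip_def by (rule Bochner_Integration.integral_cnj)
  finally show ?thesis by simp
qed

lemma ip_sum_right:
  fixes g :: "complex ^ 'd::finite \<Rightarrow> complex"
  assumes "\<And>i. i \<in> I \<Longrightarrow> continuous_on (sphere 0 1) (f i)" "continuous_on (sphere 0 1) g"
  shows "ip g (\<lambda>x. \<Sum>i\<in>I. c i * f i x) = (\<Sum>i\<in>I. cnj (c i) * ip g (f i))"
proof -
  have "cnj (ip (\<lambda>x. \<Sum>i\<in>I. c i * f i x) g) = cnj (\<Sum>i\<in>I. c i * ip (f i) g)"
    using assms by (simp only: ip_sum_left)
  then show ?thesis by (simp add: ip_cnj)
qed

lemma ip_self_real: "ip f f = of_real (\<integral>x. (norm (f x))\<^sup>2 \<partial>sphere_measure)"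
  unfolding ip_def integral_complex_of_real[symmetric] by (simp add: complex_norm_square[symmetric])

lemma norm2_pos:
  fixes f :: "complex ^ 'd::finite \<Rightarrow> complex"
  assumes "continuous_on (sphere 0 1) f" "x \<in> sphere 0 1" "f x \<noteq> 0"
  shows "(\<integral>x. (norm (f x))\<^sup>2 \<partial>sphere_measure) > 0"
proof (rule ccontr)
  assume "\<not> ?thesis"
  moreover have "(\<integral>x. (norm (f x))\<^sup>2 \<partial>sphere_measure) \<ge> 0" by (rule Bochner_Integration.integral_nonneg) simp
  ultimately have z: "(\<integral>x. (norm (f x))\<^sup>2 \<partial>sphere_measure) = 0" by simp
  have "integrable sphere_measure (\<lambda>x. (norm (f x))\<^sup>2)"
    using assms(1) by (intro integrable_sphere_continuous_real continuous_intros)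
  from integral_nonneg_eq_0_iff_AE[OF this] z have "AE x in sphere_measure. (norm (f x))\<^sup>2 = 0" by simp
  then have "AE x in sphere_measure. f x = 0" by simp
  from sphere_continuous_eq_0_if_AE[OF assms(1) this assms(2)] show False using assms(3) by simp
qed

definition orthonormal :: "'i set \<Rightarrow> ('i \<Rightarrow> complex ^ 'd::finite \<Rightarrow> complex) \<Rightarrow> bool" where
  "orthonormal I e \<longleftrightarrow> finite I \<and> (\<forall>i\<in>I. continuous_on (sphere 0 1) (e i))
     \<and> (\<forall>i\<in>I. \<forall>j\<in>I. ip (e i) (e j) = of_bool (i = j))"

lemma orthonormal_coeff:
  assumes "orthonormal I e" "i \<in> I"
  shows "ip (\<lambda>x. \<Sum>i\<in>I. c i * e i x) (e i) = c i"
proof -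
  have "ip (\<lambda>x. \<Sum>i\<in>I. c i * e i x) (e i) = (\<Sum>j\<in>I. c j * ip (e j) (e i))"
    using assms by (intro ip_sum_left) (auto simp: orthonormal_def)
  also have "\<dots> = (\<Sum>j\<in>I. if j = i then c j else 0)"
    using assms by (intro sum.cong refl) (auto simp: orthonormal_def)
  finally show ?thesis using assms by (simp add: orthonormal_def)
qed

lemma orthonormal_parseval:
  assumes "orthonormal I e"
  shows "ip (\<lambda>x. \<Sum>i\<in>I. c i * e i x) (\<lambda>x. \<Sum>i\<in>I. b i * e i x) = (\<Sum>i\<in>I. c i * cnj (b i))"
proof -
  have "ip (\<lambda>x. \<Sum>i\<in>I. c i * e i x) (\<lambda>x. \<Sum>i\<in>I. b i * e i x)
      = (\<Sum>i\<in>I. cnj (b i) * ip (\<lambda>x. \<Sum>i\<in>I. c i * e i x) (e i))"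
    using assms by (intro ip_sum_right) (auto simp: orthonormal_def intro!: continuous_intros)
  also have "\<dots> = (\<Sum>i\<in>I. c i * cnj (b i))"
    using orthonormal_coeff[OF assms] by (intro sum.cong) auto
  finally show ?thesis .
qed

definition spans :: "'i set \<Rightarrow> ('i \<Rightarrow> complex ^ 'd::finite \<Rightarrow> complex) \<Rightarrow> (complex ^ 'd \<Rightarrow> complex) \<Rightarrow> bool" where
  "spans I b f \<longleftrightarrow> (\<exists>c. \<forall>x\<in>sphere 0 1. f x = (\<Sum>i\<in>I. c i * b i x))"

text \<open>
  A non-trivial combination of the \<open>e\<^sub>i\<close> whose coefficients with respect to \<open>b\<close>
  all vanish would contradict orthonormality.
\<close>

lemma orthonormal_card_le:
  assumes e: "orthonormal I e" and A: "finite A" and sp: "\<And>i. i \<in> I \<Longrightarrow> spans A b (e i)"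
  shows "card I \<le> card A"
proof (rule ccontr)
  assume "\<not> ?thesis"
  then have less: "card A < card I" by simp
  have "\<forall>i\<in>I. \<exists>c. \<forall>x\<in>sphere 0 1. e i x = (\<Sum>a\<in>A. c a * b a x)" using sp by (auto simp: spans_def)
  then obtain C where C: "\<And>i x. i \<in> I \<Longrightarrow> x \<in> sphere 0 1 \<Longrightarrow> e i x = (\<Sum>a\<in>A. C i a * b a x)"
    by (subst (asm) bchoice_iff) blast
  obtain c where c: "\<exists>i\<in>I. c i \<noteq> 0" "\<And>a. a \<in> A \<Longrightarrow> (\<Sum>i\<in>I. c i * C i a) = 0"
    using underdetermined_system[OF A _ less, of "\<lambda>a i. C i a"] e by (auto simp: orthonormal_def)
  have z: "(\<Sum>i\<in>I. c i * e i x) = 0" if "x \<in> sphere 0 1" for x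
  proof -
    have "(\<Sum>i\<in>I. c i * e i x) = (\<Sum>i\<in>I. \<Sum>a\<in>A. c i * C i a * b a x)"
      using C that by (intro sum.cong refl) (simp add: sum_distrib_left mult.assoc)
    also have "\<dots> = (\<Sum>a\<in>A. (\<Sum>i\<in>I. c i * C i a) * b a x)"
      by (subst sum.swap) (simp add: sum_distrib_right)
    also have "\<dots> = 0" using c(2) by simp
    finally show ?thesis .
  qed
  obtain i where i: "i \<in> I" "c i \<noteq> 0" using c(1) by blast
  have "c i = ip (\<lambda>x. \<Sum>i\<in>I. c i * e i x) (e i)" using orthonormal_coeff[OF e i(1)] by simp
  also have "\<dots> = ip (\<lambda>x. 0) (e i)" using z by (intro ip_cong) auto
  also have "\<dots> = 0" by (simp add: ip_def)
  finally show False using i(2) by simp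
qed

definition func_space :: "((complex ^ 'd::finite \<Rightarrow> complex) \<Rightarrow> bool) \<Rightarrow> bool" where
  "func_space V \<longleftrightarrow> (\<forall>f. V f \<longrightarrow> continuous_on (sphere 0 1) f) \<and> V (\<lambda>x. 0) \<and>
     (\<forall>f g. V f \<longrightarrow> V g \<longrightarrow> V (\<lambda>x. f x + g x)) \<and> (\<forall>f c. V f \<longrightarrow> V (\<lambda>x. c * f x))"

lemma func_space_sum:
  assumes "func_space V" "\<And>i. i \<in> I \<Longrightarrow> V (f i)"
  shows "V (\<lambda>x. \<Sum>i\<in>I. c i * f i x)"
  using assms(2)
  by (induction I rule: infinite_finite_induct) (use assms(1) in \<open>auto simp: func_space_def\<close>)

lemma orthonormal_extend:
  fixes e :: "nat \<Rightarrow> complex ^ 'd::finite \<Rightarrow> complex"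
  assumes V: "func_space V" and e: "orthonormal {..<n} e" "\<And>i. i < n \<Longrightarrow> V (e i)"
    and g: "V g" "x \<in> sphere 0 1" "g x \<noteq> 0" "\<And>i. i < n \<Longrightarrow> ip g (e i) = 0"
  shows "\<exists>e'. orthonormal {..<Suc n} e' \<and> (\<forall>i<Suc n. V (e' i))"
proof -
  define N where "N = (\<integral>x. (norm (g x))\<^sup>2 \<partial>sphere_measure)"
  have cg: "continuous_on (sphere 0 1) g" using V g(1) by (simp add: func_space_def)
  have N: "N > 0" unfolding N_def by (rule norm2_pos[OF cg g(2,3)])
  define g' where "g' = (\<lambda>x. of_real (1 / sqrt N) * g x)"
  define e' where "e' = e(n := g')"
  have Vg': "V g'" unfolding g'_def using V g(1) unfolding func_space_def by blast
  have cg': "continuous_on (sphere 0 1) g'" using V Vg' by (simp add: func_space_def)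
  have lin: "ip g' f = of_real (1 / sqrt N) * ip g f" for f
    unfolding ip_def g'_def by (simp add: mult.assoc)
  have "ip g' g' = of_real (1 / sqrt N) * (of_real (1 / sqrt N) * ip g g)"
    using lin[of g'] ip_cnj[of g' g] ip_cnj[of g g] lin[of g] by (metis complex_cnj_complex_of_real complex_cnj_mult)
  also have "ip g g = of_real N" by (simp add: ip_self_real N_def)
  also have "of_real (1 / sqrt N) * (of_real (1 / sqrt N) * of_real N) = (1 :: complex)"
    using N by (simp flip: of_real_mult)
  finally have 1: "ip g' g' = 1" .
  have 2: "ip g' (e i) = 0" if "i < n" for i using g(4)[OF that] by (simp add: lin)
  have 3: "ip (e i) g' = 0" if "i < n" for i using ip_cnj[of g' "e i"] 2[OF that] by simp
  have "orthonormal {..<Suc n} e'"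
    using e(1) 1 2 3 cg' unfolding orthonormal_def e'_def by (auto simp: less_Suc_eq)
  moreover have "\<forall>i<Suc n. V (e' i)" using e(2) Vg' by (auto simp: e'_def less_Suc_eq)
  ultimately show ?thesis by blast
qed

text \<open>
  An orthonormal family of maximal size is complete. Completeness is stated as the absence of a
  non-zero element orthogonal to the family, because this is what counting arguments contradict.
\<close>

lemma exists_orthonormal_basis:
  fixes V :: "(complex ^ 'd::finite \<Rightarrow> complex) \<Rightarrow> bool"
  assumes V: "func_space V" and A: "finite A" and sp: "\<And>f. V f \<Longrightarrow> spans A b f"
  shows "\<exists>(n::nat) e. orthonormal {..<n} e \<and> (\<forall>i<n. V (e i)) \<and>
     (\<forall>g x. V g \<longrightarrow> (\<forall>i<n. ip g (e i) = 0) \<longrightarrow> x \<in> sphere 0 1 \<longrightarrow> g x = 0)"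
proof -
  let ?P = "\<lambda>n::nat. \<exists>e. orthonormal {..<n} e \<and> (\<forall>i<n. V (e i))"
  have b: "n \<le> card A" if "?P n" for n
    using that orthonormal_card_le[OF _ A, of "{..<n}"] sp by fastforce
  have "?P 0" by (auto simp: orthonormal_def)
  then obtain n where n: "?P n" "\<And>k. ?P k \<Longrightarrow> k \<le> n"
    using Greatest_le_nat[of ?P _ "card A"] GreatestI_nat[of ?P 0 "card A"] b by blast
  then obtain e where e: "orthonormal {..<n} e" "\<And>i. i < n \<Longrightarrow> V (e i)" by blast
  have compl: "g x = 0" if "V g" "\<forall>i<n. ip g (e i) = 0" "x \<in> sphere 0 1" for g x
  proof (rule ccontr)
    assume "g x \<noteq> 0"
    then have "?P (Suc n)" using orthonormal_extend[OF V e that(1,3)] that(2) by blast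
    then show False using n(2) by fastforce
  qed
  show ?thesis
    by (intro exI[of _ n] exI[of _ e] conjI allI impI e) (assumption | erule (2) compl)+
qed

lemma orthonormal_complete_expansion:
  assumes V: "func_space V" and e: "orthonormal I e" "\<And>i. i \<in> I \<Longrightarrow> V (e i)"
    and compl: "\<And>g x. V g \<Longrightarrow> (\<And>i. i \<in> I \<Longrightarrow> ip g (e i) = 0) \<Longrightarrow> x \<in> sphere 0 1 \<Longrightarrow> g x = 0"
    and f: "V f" and x: "x \<in> sphere 0 1"
  shows "f x = (\<Sum>i\<in>I. ip f (e i) * e i x)"
proof -
  let ?s = "\<lambda>x. \<Sum>i\<in>I. ip f (e i) * e i x"
  have Vs: "V ?s" using func_space_sum[OF V e(2), where c = "\<lambda>i. ip f (e i)"] by simp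
  define g where "g = (\<lambda>x. f x + (-1) * ?s x)"
  have Vg: "V g" unfolding g_def using V f Vs unfolding func_space_def by blast
  have c: "continuous_on (sphere 0 1) h" if "V h" for h using V that by (simp add: func_space_def)
  have "ip g (e i) = 0" if i: "i \<in> I" for i
  proof -
    have "ip g (e i) = ip f (e i) - ip ?s (e i)"
      unfolding g_def by (rule ip_diff_left[OF c[OF f] c[OF Vs] c[OF e(2)[OF i]]])
    then show ?thesis using orthonormal_coeff[OF e(1) i, of "\<lambda>i. ip f (e i)"] by simp
  qed
  from compl[OF Vg this x] show ?thesis by (simp add: g_def)
qed

lemma orthonormal_full_expansion:
  fixes e :: "'i \<Rightarrow> complex ^ 'd::finite \<Rightarrow> complex"
  assumes V: "func_space V" and A: "finite A" and sp: "\<And>f. V f \<Longrightarrow> spans A b f"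
    and e: "orthonormal I e" "\<And>i. i \<in> I \<Longrightarrow> V (e i)" and card: "card A \<le> card I"
    and f: "V f" and x: "x \<in> sphere 0 1"
  shows "f x = (\<Sum>i\<in>I. ip f (e i) * e i x)"
proof (rule orthonormal_complete_expansion[OF V e _ f x])
  fix g and x :: "complex ^ 'd"
  assume g: "V g" "\<And>i. i \<in> I \<Longrightarrow> ip g (e i) = 0" and x: "x \<in> sphere 0 1"
  have fin: "finite I" using e(1) by (simp add: orthonormal_def)
  then obtain h where h: "bij_betw h {..<card I} I"
    using ex_bij_betw_nat_finite[OF fin] by (auto simp: atLeast0LessThan)
  have hI: "h i \<in> I" if "i < card I" for i using h that by (auto simp: bij_betw_def)
  have inj: "h i = h j \<longleftrightarrow> i = j" if "i < card I" "j < card I" for i j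
    using h that by (auto simp: bij_betw_def inj_on_def)
  have oe: "orthonormal {..<card I} (e \<circ> h)"
    using e(1) hI inj unfolding orthonormal_def by auto
  show "g x = 0"
  proof (rule ccontr)
    assume "g x \<noteq> 0"
    then obtain e' where e': "orthonormal {..<Suc (card I)} e'" "\<And>i. i < Suc (card I) \<Longrightarrow> V (e' i)"
      using orthonormal_extend[OF V oe _ g(1) x] e(2) hI g(2) by auto
    have "Suc (card I) \<le> card A"
      using orthonormal_card_le[OF e'(1) A, of b] sp e'(2) by auto
    then show False using card by simp
  qed
qed

subsection \<open>The kernel of an invariant space is constant on the diagonal\<close>

text \<open>
  The reflection has axis \<open>x - y\<close>, and the requirement that it maps \<open>x\<close> to
  \<open>y\<close> determines the multiplier \<open>c\<close>.
\<close>

lemma reflection_maps_to: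
  assumes x: "x \<in> sphere 0 1" and y: "y \<in> sphere 0 1"
  shows "\<exists>v c. herm v v = 1 \<and> norm c = 1 \<and> unitary_reflection v c x = y"
proof (cases "x = y")
  case True
  have "herm x x = 1" using x by (simp add: herm_self)
  then show ?thesis using True by (intro exI[of _ x] exI[of _ 1]) (simp add: unitary_reflection_def)
next
  case False
  define u where "u = x - y"
  define w where "w = herm x u"
  define v where "v = of_real (1 / norm u) *s u"
  \<comment> \<open>\<open>c - 1 = - (w + cnj w) / w\<close>, where \<open>w + cnj w = (norm u)\<^sup>2\<close>; this is what maps \<open>x\<close> to \<open>x - u = y\<close>.\<close>
  define c where "c = - cnj w / w"
  have nu: "norm u > 0" using False by (simp add: u_def)
  have xx: "herm x x = 1" "herm y y = 1" using x y by (auto simp: herm_self)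
  have "herm u u = w + cnj w"
    by (simp add: w_def u_def herm_diff_left herm_diff_right cnj_herm xx)
  then have wu: "w + cnj w = of_real ((norm u)\<^sup>2)" by (simp add: herm_self)
  have w0: "w \<noteq> 0" using wu nu by auto
  have "herm v v = of_real (1 / norm u) * of_real (1 / norm u) * of_real ((norm u)\<^sup>2)"
    unfolding v_def herm_scale_left herm_scale_right herm_self[of u] by simp
  also have "\<dots> = 1" using nu by (simp add: power2_eq_square flip: of_real_mult)
  finally have 1: "herm v v = 1" .
  have 2: "norm c = 1" using w0 by (simp add: c_def norm_divide)
  have "(c - 1) * w = - (w + cnj w)" using w0 by (simp add: c_def field_simps)
  then have *: "(c - 1) * w = - of_real ((norm u)\<^sup>2)" using wu by simp
  have "((c - 1) * herm x v) *s v = ((c - 1) * w * of_real (1 / norm u) * of_real (1 / norm u)) *s u"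
    by (simp add: v_def herm_scale_right w_def)
  also have "(c - 1) * w * of_real (1 / norm u) * of_real (1 / norm u) = -1"
    unfolding * using nu by (simp add: power2_eq_square)
  finally have "unitary_reflection v c x = y"
    by (simp add: unitary_reflection_def u_def vec_eq_iff)
  then show ?thesis using 1 2 by blast
qed

text \<open>
  The value of the sum at \<open>y\<close> is the largest \<open>|f y|\<^sup>2\<close> among the elements
  \<open>f\<close> of \<open>V\<close> of norm at most \<open>1\<close>, attained by a multiple of the reproducing
  kernel at \<open>y\<close>. Moving this extremal function by a symmetry that maps \<open>x\<close> to
  \<open>y\<close> compares the values at \<open>x\<close> and \<open>y\<close>.
\<close>

lemma kernel_diagonal_constant:
  fixes e :: "'i \<Rightarrow> complex ^ 'd::finite \<Rightarrow> complex"
  assumes V: "func_space V" and e: "orthonormal I e" "\<And>i. i \<in> I \<Longrightarrow> V (e i)"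
    and expand: "\<And>f x. V f \<Longrightarrow> x \<in> sphere 0 1 \<Longrightarrow> f x = (\<Sum>i\<in>I. ip f (e i) * e i x)"
    and inv: "\<And>f v c. V f \<Longrightarrow> herm v v = 1 \<Longrightarrow> norm c = 1 \<Longrightarrow> V (\<lambda>z. f (unitary_reflection v c z))"
    and x: "x \<in> sphere 0 1"
  shows "(\<Sum>i\<in>I. (norm (e i x))\<^sup>2) = real (card I) / measure sphere_measure (sphere 0 1 :: (complex ^ 'd) set)"
proof -
  define K where "K x = (\<Sum>i\<in>I. (norm (e i x))\<^sup>2)" for x
  have cV: "continuous_on (sphere 0 1) f" if "V f" for f using V that by (simp add: func_space_def)
  have le: "K y \<le> K x" if x: "x \<in> sphere 0 1" and y: "y \<in> sphere 0 1" for x y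
  proof (cases "K y = 0")
    case False
    then have Ky: "K y > 0" by (smt (verit) K_def sum_nonneg zero_le_power2)
    obtain v c where U: "herm v v = 1" "norm c = 1" "unitary_reflection v c x = y"
      using reflection_maps_to[OF x y] by blast
    define f where "f = (\<lambda>z. \<Sum>i\<in>I. cnj (e i y) * e i z)"
    define g where "g = (\<lambda>z. f (unitary_reflection v c z))"
    have Vf: "V f" unfolding f_def using func_space_sum[OF V e(2), where c = "\<lambda>i. cnj (e i y)"] by simp
    have Vg: "V g" unfolding g_def using inv[OF Vf U(1,2)] .
    have fy: "f y = of_real (K y)"
      unfolding f_def K_def of_real_sum complex_norm_square by (simp add: mult.commute)
    have "ip g g = ip f f"
      unfolding ip_def g_def
      by (rule integral_sphere_isometry[OF linear_unitary_reflection norm_unitary_reflection[OF U(1,2)]])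
        (intro continuous_intros cV Vf)
    also have "\<dots> = of_real (K y)"
      unfolding f_def orthonormal_parseval[OF e(1)] K_def of_real_sum complex_norm_square
      by (simp add: mult.commute)
    finally have gg: "ip g g = of_real (K y)" .
    have gI: "g z = (\<Sum>i\<in>I. ip g (e i) * e i z)" if "z \<in> sphere 0 1" for z using expand[OF Vg that] .
    have "ip g g = ip (\<lambda>z. \<Sum>i\<in>I. ip g (e i) * e i z) (\<lambda>z. \<Sum>i\<in>I. ip g (e i) * e i z)"
      by (rule ip_cong) (use gI in auto)
    also have "\<dots> = of_real (\<Sum>i\<in>I. (norm (ip g (e i)))\<^sup>2)"
      unfolding orthonormal_parseval[OF e(1)] of_real_sum complex_norm_square ..
    finally have s: "(\<Sum>i\<in>I. (norm (ip g (e i)))\<^sup>2) = K y" using gg by (metis of_real_eq_iff)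
    have "g x = of_real (K y)" using U(3) fy by (simp add: g_def)
    then have "K y = norm (\<Sum>i\<in>I. ip g (e i) * e i x)"
      using gI[OF x] Ky by simp
    also have "\<dots> \<le> (\<Sum>i\<in>I. norm (ip g (e i)) * norm (e i x))"
      by (rule order_trans[OF norm_sum]) (simp add: norm_mult)
    finally have "(K y)\<^sup>2 \<le> (\<Sum>i\<in>I. norm (ip g (e i)) * norm (e i x))\<^sup>2"
      using Ky by (intro power_mono) auto
    also have "\<dots> \<le> (\<Sum>i\<in>I. (norm (ip g (e i)))\<^sup>2) * (\<Sum>i\<in>I. (norm (e i x))\<^sup>2)"
      by (rule Cauchy_Schwarz_ineq_sum)
    also have "\<dots> = K y * K x" by (simp only: s K_def[of x])
    finally have "K y * K y \<le> K y * K x" by (simp only: power2_eq_square)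
    then show ?thesis using Ky by simp
  qed (simp add: K_def sum_nonneg)
  have const: "K z = K x" if "z \<in> sphere 0 1" for z using le[OF x that] le[OF that x] by simp
  have "real (card I) = (\<Sum>i\<in>I. \<integral>x. (norm (e i x))\<^sup>2 \<partial>sphere_measure)"
  proof -
    have "(\<integral>x. (norm (e i x))\<^sup>2 \<partial>sphere_measure) = 1" if "i \<in> I" for i
      using e(1) that ip_self_real[of "e i"] by (simp add: orthonormal_def)
    then show ?thesis by simp
  qed
  also have "\<dots> = (\<integral>x. K x \<partial>sphere_measure)"
    unfolding K_def using e(1)
    by (intro Bochner_Integration.integral_sum[symmetric] integrable_sphere_continuous_real)
      (auto simp: orthonormal_def intro!: continuous_intros)
  also have "\<dots> = (\<integral>z. K x \<partial>(sphere_measure :: (complex ^ 'd) measure))"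
    by (intro Bochner_Integration.integral_cong refl) (simp add: space_sphere_measure const)
  also have "\<dots> = measure sphere_measure (sphere 0 1 :: (complex ^ 'd) set) * K x"
    by (simp add: space_sphere_measure)
  finally show ?thesis using sphere_measure_pos[where 'd='d] by (simp add: K_def[symmetric] field_simps)
qed

subsection \<open>Independence of the monomials\<close>

lemma wirt_zmono: "wirt (-1) j (zmono \<alpha> \<beta>) z = of_nat (\<alpha> j) * zmono (\<alpha>(j := \<alpha> j - 1)) \<beta> z"
proof (induction "sum \<alpha> UNIV + sum \<beta> UNIV" arbitrary: \<alpha> \<beta> rule: less_induct)
  case less
  have pm: "polyfun (zmono \<alpha> \<beta>)" for \<alpha> \<beta> :: "'a \<Rightarrow> nat" using bihom_polyfun[OF bihom_mono] .
  consider k where "\<alpha> k > 0" | k where "\<beta> k > 0" | "\<alpha> = (\<lambda>_. 0)" "\<beta> = (\<lambda>_. 0)" by auto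
  then show ?case
  proof cases
    case 1
    define \<alpha>' where "\<alpha>' = \<alpha>(k := \<alpha> k - 1)"
    have a: "\<alpha> = \<alpha>'(k := Suc (\<alpha>' k))" using 1 by (auto simp: \<alpha>'_def)
    have z: "zmono \<alpha> \<beta> = (\<lambda>z. z $ k * zmono \<alpha>' \<beta> z)"
      by (subst a) (auto simp: coord_mono)
    have "sum \<alpha>' UNIV < sum \<alpha> UNIV" by (subst a, subst sum_upd_Suc) simp
    then have IH: "wirt (-1) j (zmono \<alpha>' \<beta>) z = of_nat (\<alpha>' j) * zmono (\<alpha>'(j := \<alpha>' j - 1)) \<beta> z"
      by (intro less) auto
    have "wirt (-1) j (zmono \<alpha> \<beta>) z = z $ k * (of_nat (\<alpha>' j) * zmono (\<alpha>'(j := \<alpha>' j - 1)) \<beta> z)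
        + of_bool (j = k) * zmono \<alpha>' \<beta> z"
      unfolding z by (simp add: wirt_coord[OF pm] IH)
    also have "z $ k * (of_nat (\<alpha>' j) * zmono (\<alpha>'(j := \<alpha>' j - 1)) \<beta> z)
        = of_nat (\<alpha>' j) * zmono ((\<alpha>'(j := \<alpha>' j - 1))(k := Suc ((\<alpha>'(j := \<alpha>' j - 1)) k))) \<beta> z"
      by (simp only: coord_mono[symmetric] mult.left_commute)
    also have "\<dots> + of_bool (j = k) * zmono \<alpha>' \<beta> z = of_nat (\<alpha> j) * zmono (\<alpha>(j := \<alpha> j - 1)) \<beta> z"
    proof (cases "j = k")
      case True
      have "(\<alpha>'(k := \<alpha>' k - 1))(k := Suc ((\<alpha>'(k := \<alpha>' k - 1)) k)) = \<alpha>'" if "\<alpha>' k > 0"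
        using that by auto
      moreover have "\<alpha> k = Suc (\<alpha>' k)" using 1 by (simp add: \<alpha>'_def)
      moreover have "\<alpha>(k := \<alpha> k - 1) = \<alpha>'" by (simp add: \<alpha>'_def)
      ultimately show ?thesis using True by (cases "\<alpha>' k = 0") (auto simp: algebra_simps simp del: fun_upd_apply fun_upd_upd)
    next
      case False
      then have "(\<alpha>'(j := \<alpha>' j - 1))(k := Suc ((\<alpha>'(j := \<alpha>' j - 1)) k)) = \<alpha>(j := \<alpha> j - 1)" "\<alpha>' j = \<alpha> j"
        using 1 by (auto simp: \<alpha>'_def)
      then show ?thesis using False by simp
    qed
    finally show ?thesis .
  next
    case 2
    define \<beta>' where "\<beta>' = \<beta>(k := \<beta> k - 1)"
    have a: "\<beta> = \<beta>'(k := Suc (\<beta>' k))" using 2 by (auto simp: \<beta>'_def)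
    have z: "zmono \<alpha> \<beta> = (\<lambda>z. cnj (z $ k) * zmono \<alpha> \<beta>' z)" for \<alpha>
      by (subst a) (auto simp: cnj_coord_mono)
    have "sum \<beta>' UNIV < sum \<beta> UNIV" by (subst a, subst sum_upd_Suc) simp
    then have IH: "wirt (-1) j (zmono \<alpha> \<beta>') z = of_nat (\<alpha> j) * zmono (\<alpha>(j := \<alpha> j - 1)) \<beta>' z"
      by (intro less) auto
    show ?thesis unfolding z by (simp add: wirt_cnj_coord[OF pm] IH)
  next
    case 3
    then have "zmono \<alpha> \<beta> = (\<lambda>z. 1)" by (simp add: zmono_def[abs_def])
    then show ?thesis using 3 by (simp add: wirt_const)
  qed
qed

lemma cnj_zmono: "cnj (zmono \<alpha> \<beta> z) = zmono \<beta> \<alpha> z"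
  by (simp add: zmono_def mult.commute)

lemma zmono_at_0: "zmono \<alpha> \<beta> 0 = of_bool (\<alpha> = (\<lambda>_. 0) \<and> \<beta> = (\<lambda>_. 0))"
  by (auto simp: zmono_def fun_eq_iff power_0_left)

text \<open>
  Differentiating a vanishing combination lowers the degree and keeps the coefficients up to
  non-zero factors.
\<close>

lemma zmono_independent:
  fixes \<alpha> \<beta> :: "'x \<Rightarrow> 'd::finite \<Rightarrow> nat"
  assumes "finite X" "inj_on (\<lambda>x. (\<alpha> x, \<beta> x)) X"
    and "\<And>z. (\<Sum>x\<in>X. c x * zmono (\<alpha> x) (\<beta> x) z) = 0" and "x \<in> X"
  shows "c x = 0"
proof -
  have "\<forall>x\<in>X. c x = 0"
    if "finite X" "inj_on (\<lambda>x. (\<alpha> x, \<beta> x)) X"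
      "\<And>z. (\<Sum>x\<in>X. c x * zmono (\<alpha> x) (\<beta> x) z) = 0"
      "\<forall>x\<in>X. sum (\<alpha> x) UNIV + sum (\<beta> x) UNIV < N" for N X c and \<alpha> \<beta> :: "'x \<Rightarrow> 'd \<Rightarrow> nat"
    using that
  proof (induction N arbitrary: X c \<alpha> \<beta>)
    case (Suc N)
    have step: "c x = 0"
      if X: "finite X" and inj: "inj_on (\<lambda>x. (\<alpha> x, \<beta> x)) X"
        and eq: "\<And>z. (\<Sum>x\<in>X. c x * zmono (\<alpha> x) (\<beta> x) z) = 0"
        and deg: "\<forall>x\<in>X. sum (\<alpha> x) UNIV + sum (\<beta> x) UNIV < Suc N"
        and x: "x \<in> X" "\<alpha> x j > 0" for c x j and \<alpha> \<beta> :: "'x \<Rightarrow> 'd \<Rightarrow> nat"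
    proof -
      let ?Y = "{x \<in> X. \<alpha> x j > 0}"
      define \<alpha>' where "\<alpha>' x = (\<alpha> x)(j := \<alpha> x j - 1)" for x
      have up: "\<alpha> x = (\<alpha>' x)(j := Suc (\<alpha>' x j))" if "x \<in> ?Y" for x
        using that by (auto simp: \<alpha>'_def)
      have "0 = wirt (-1) j (\<lambda>z. \<Sum>x\<in>X. c x * zmono (\<alpha> x) (\<beta> x) z) z" for z
        unfolding eq by (simp add: wirt_const)
      also have "\<dots> z = (\<Sum>x\<in>X. c x * (of_nat (\<alpha> x j) * zmono (\<alpha>' x) (\<beta> x) z))" for z
        by (subst wirt_sum)
          (auto simp: wirt_cmult wirt_zmono \<alpha>'_def bihom_polyfun[OF bihom_mono] intro!: polyfun_cmult)
      also have "\<dots> z = (\<Sum>x\<in>?Y. (c x * of_nat (\<alpha> x j)) * zmono (\<alpha>' x) (\<beta> x) z)" for z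
        using X by (intro sum.mono_neutral_cong_right) auto
      finally have 1: "(\<Sum>x\<in>?Y. (c x * of_nat (\<alpha> x j)) * zmono (\<alpha>' x) (\<beta> x) z) = 0" for z by simp
      have 2: "inj_on (\<lambda>x. (\<alpha>' x, \<beta> x)) ?Y"
      proof (rule inj_onI)
        fix x y assume xy: "x \<in> ?Y" "y \<in> ?Y" "(\<alpha>' x, \<beta> x) = (\<alpha>' y, \<beta> y)"
        then have "\<alpha> x = \<alpha> y" "\<beta> x = \<beta> y" using up[OF xy(1)] up[OF xy(2)] by auto
        then show "x = y" using inj xy by (auto simp: inj_on_def)
      qed
      have "sum (\<alpha>' x) UNIV + sum (\<beta> x) UNIV < N" if "x \<in> ?Y" for x
      proof -
        have "sum (\<alpha> x) UNIV = Suc (sum (\<alpha>' x) UNIV)" by (subst up[OF that], rule sum_upd_Suc)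
        moreover have "sum (\<alpha> x) UNIV + sum (\<beta> x) UNIV < Suc N" using deg that by blast
        ultimately show ?thesis by simp
      qed
      with Suc.IH[of ?Y \<alpha>' \<beta> "\<lambda>x. c x * of_nat (\<alpha> x j)"] 1 2 X
      have "\<forall>x\<in>?Y. c x * of_nat (\<alpha> x j) = 0" by simp
      then show ?thesis using x by auto
    qed
    show ?case
    proof
      fix x assume x: "x \<in> X"
      consider j where "\<alpha> x j > 0" | j where "\<beta> x j > 0" | "\<alpha> x = (\<lambda>_. 0)" "\<beta> x = (\<lambda>_. 0)" by auto
      then show "c x = 0"
      proof cases
        case 1
        show ?thesis by (rule step[OF Suc.prems x 1])
      next
        case 2
        have eq: "(\<Sum>x\<in>X. cnj (c x) * zmono (\<beta> x) (\<alpha> x) z) = 0" for z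
        proof -
          have "cnj (\<Sum>x\<in>X. c x * zmono (\<alpha> x) (\<beta> x) z) = 0" by (simp only: Suc.prems(3) complex_cnj_zero)
          then show ?thesis by (simp add: cnj_zmono)
        qed
        have inj: "inj_on (\<lambda>x. (\<beta> x, \<alpha> x)) X" using Suc.prems(2) by (auto simp: inj_on_def)
        have deg: "\<forall>x\<in>X. sum (\<beta> x) UNIV + sum (\<alpha> x) UNIV < Suc N"
          using Suc.prems(4) by (simp add: add.commute)
        have "cnj (c x) = 0" by (rule step[OF Suc.prems(1) inj eq deg x 2])
        then show ?thesis by simp
      next
        case 3
        have only: "y = x" if "y \<in> X" "\<alpha> y = (\<lambda>_. 0)" "\<beta> y = (\<lambda>_. 0)" for y
          by (rule inj_onD[OF Suc.prems(2) _ that(1) x]) (simp only: that 3)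
        have "c y * zmono (\<alpha> y) (\<beta> y) 0 = (if y = x then c x else 0)" if "y \<in> X" for y
          unfolding zmono_at_0 using only[OF that] 3 by (cases "y = x") (simp, force)
        then have "(\<Sum>y\<in>X. c y * zmono (\<alpha> y) (\<beta> y) 0) = (\<Sum>y\<in>X. if y = x then c x else 0)"
          by (rule sum.cong[OF refl])
        also have "\<dots> = c x" using Suc.prems(1) x by simp
        finally show ?thesis using Suc.prems(3)[of 0] by simp
      qed
    qed
  qed simp
  note all = this
  let ?N = "Suc (\<Sum>x\<in>X. sum (\<alpha> x) UNIV + sum (\<beta> x) UNIV)"
  have "sum (\<alpha> y) UNIV + sum (\<beta> y) UNIV < ?N" if "y \<in> X" for y
    using member_le_sum[of y X "\<lambda>x. sum (\<alpha> x) UNIV + sum (\<beta> x) UNIV"] that assms(1) by simp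
  then have "\<forall>x\<in>X. sum (\<alpha> x) UNIV + sum (\<beta> x) UNIV < ?N" by blast
  from all[OF assms(1-3) this] show ?thesis using assms(4) by blast
qed

lemma bihom_zero_if_zero_on_sphere:
  fixes f :: "complex ^ 'd::finite \<Rightarrow> complex"
  assumes f: "bihom m n f" and zero: "\<And>x. x \<in> sphere 0 1 \<Longrightarrow> f x = 0"
  shows "f z = 0"
proof -
  obtain u where u: "u \<in> sphere 0 1" "z = norm z *\<^sub>R u"
  proof (cases "z = 0")
    case True
    then show ?thesis by (intro that[of "axis undefined 1"]) auto
  next
    case False
    then show ?thesis by (intro that[of "z /\<^sub>R norm z"]) auto
  qed
  then show ?thesis using bihom_homogeneous[OF f, of "norm z" u] zero[OF u(1)] by simp
qed

subsection \<open>Harmonics as a space of functions\<close>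

definition on_sphere :: "(complex ^ 'd::finite \<Rightarrow> complex) \<Rightarrow> complex ^ 'd \<Rightarrow> complex" where
  "on_sphere p = (\<lambda>z. if z \<in> sphere 0 1 then p z else 0)"

lemma on_sphere_apply: "z \<in> sphere 0 1 \<Longrightarrow> on_sphere p z = p z"
  by (simp add: on_sphere_def)

lemma harmonics_iff: "f \<in> harmonics m n \<longleftrightarrow> (\<exists>p. bihom m n p \<and> harmonic p \<and> f = on_sphere p)"
  unfolding harmonics_def on_sphere_def bihom_iff harmonic_iff by blast

lemma continuous_on_on_sphere: "continuous_on (sphere 0 1) p \<Longrightarrow> continuous_on (sphere 0 1) (on_sphere p)"
  by (rule continuous_on_eq[of _ p]) (auto simp: on_sphere_def)

lemma harmonic_add: "polyfun f \<Longrightarrow> polyfun g \<Longrightarrow> harmonic f \<Longrightarrow> harmonic g \<Longrightarrow> harmonic (\<lambda>z. f z + g z)"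
proof -
  assume fg: "polyfun f" "polyfun g" "harmonic f" "harmonic g"
  have "wirt 1 j (\<lambda>z. f z + g z) = (\<lambda>z. wirt 1 j f z + wirt 1 j g z)" for j
    using fg by (auto simp: wirt_add)
  then show ?thesis using fg unfolding harmonic_def
    by (simp add: wirt_add polyfun_wirt sum.distrib)
qed

lemma harmonic_cmult: "polyfun f \<Longrightarrow> harmonic f \<Longrightarrow> harmonic (\<lambda>z. c * f z)"
proof -
  assume f: "polyfun f" "harmonic f"
  have "wirt 1 j (\<lambda>z. c * f z) = (\<lambda>z. c * wirt 1 j f z)" for j
    using f by (auto simp: wirt_cmult)
  then show ?thesis using f unfolding harmonic_def
    by (simp add: wirt_cmult polyfun_wirt flip: sum_distrib_left)
qed

lemma func_space_harmonics: "func_space (\<lambda>f. f \<in> harmonics m n)"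
  unfolding func_space_def
proof (intro conjI allI impI)
  fix f :: "complex ^ 'a \<Rightarrow> complex" assume "f \<in> harmonics m n"
  then show "continuous_on (sphere 0 1) f"
    unfolding harmonics_iff using continuous_on_on_sphere polyfun_continuous_on bihom_polyfun by blast
next
  have "harmonic (\<lambda>z::complex^'a. 0)" unfolding harmonic_def by (simp add: wirt_const)
  then show "(\<lambda>x::complex^'a. 0) \<in> harmonics m n"
    unfolding harmonics_iff by (intro exI[of _ "\<lambda>_. 0"]) (auto simp: on_sphere_def intro: bihom.zero)
next
  fix f g :: "complex ^ 'a \<Rightarrow> complex" assume "f \<in> harmonics m n" "g \<in> harmonics m n"
  then obtain p q where "bihom m n p" "harmonic p" "f = on_sphere p" "bihom m n q" "harmonic q" "g = on_sphere q"
    unfolding harmonics_iff by blast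
  then show "(\<lambda>x. f x + g x) \<in> harmonics m n"
    unfolding harmonics_iff
    by (intro exI[of _ "\<lambda>z. p z + q z"]) (auto simp: on_sphere_def intro: bihom.add harmonic_add bihom_polyfun)
next
  fix f :: "complex ^ 'a \<Rightarrow> complex" and c assume "f \<in> harmonics m n"
  then obtain p where "bihom m n p" "harmonic p" "f = on_sphere p"
    unfolding harmonics_iff by blast
  then show "(\<lambda>x. c * f x) \<in> harmonics m n"
    unfolding harmonics_iff
    by (intro exI[of _ "\<lambda>z. c * p z"]) (auto simp: on_sphere_def intro: bihom_cmult harmonic_cmult bihom_polyfun)
qed

abbreviation bimultiindices :: "nat \<Rightarrow> nat \<Rightarrow> (('d::finite \<Rightarrow> nat) \<times> ('d \<Rightarrow> nat)) set" where
  "bimultiindices m n \<equiv> multiindices m \<times> multiindices n"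

lemma bihom_coeffs:
  "bihom m n f \<Longrightarrow> \<exists>c. f = (\<lambda>z. \<Sum>x\<in>bimultiindices m n. c x * zmono (fst x) (snd x) z)"
  unfolding bihom_iff bihomogeneous_polys_iff_coeffs .

lemma spans_harmonics:
  assumes "f \<in> harmonics m n"
  shows "spans (bimultiindices m n) (\<lambda>x. zmono (fst x) (snd x)) f"
  using assms bihom_coeffs unfolding harmonics_iff spans_def by (fastforce simp: on_sphere_apply)

text \<open>
  Harmonicity of a polynomial of bidegree \<open>(m, n)\<close> amounts to one linear equation on its
  coefficients for each monomial of bidegree \<open>(m - 1, n - 1)\<close>. If fewer harmonics formed a
  complete family, these equations together with orthogonality to the family would still have a
  non-trivial solution.
\<close>

lemma exists_harmonics_basis:
  "\<exists>(h::nat) (e :: nat \<Rightarrow> complex ^ 'd::finite \<Rightarrow> complex). orthonormal {..<h} e \<and> (\<forall>i<h. e i \<in> harmonics m n) \<and>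
     (\<forall>g x. g \<in> harmonics m n \<longrightarrow> (\<forall>i<h. ip g (e i) = 0) \<longrightarrow> x \<in> sphere 0 1 \<longrightarrow> g x = 0) \<and>
     card (bimultiindices m n :: (('d \<Rightarrow> nat) \<times> ('d \<Rightarrow> nat)) set)
       \<le> h + (if m = 0 \<or> n = 0 then 0 else card (bimultiindices (m - 1) (n - 1) :: (('d \<Rightarrow> nat) \<times> ('d \<Rightarrow> nat)) set))"
proof -
  let ?A = "bimultiindices m n :: (('d \<Rightarrow> nat) \<times> ('d \<Rightarrow> nat)) set"
  have "finite ?A" by simp
  from exists_orthonormal_basis[OF func_space_harmonics[of m n] this, of "\<lambda>x. zmono (fst x) (snd x)"]
    spans_harmonics[of _ m n]
  have "\<exists>(h::nat) (e :: nat \<Rightarrow> complex ^ 'd \<Rightarrow> complex). orthonormal {..<h} e \<and>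
     (\<forall>i<h. e i \<in> harmonics m n) \<and>
     (\<forall>g x. g \<in> harmonics m n \<longrightarrow> (\<forall>i<h. ip g (e i) = 0) \<longrightarrow> x \<in> sphere 0 1 \<longrightarrow> g x = 0)" .
  then obtain h :: nat and e :: "nat \<Rightarrow> complex ^ 'd::finite \<Rightarrow> complex" where he': "orthonormal {..<h} e \<and>
     (\<forall>i<h. e i \<in> harmonics m n) \<and>
     (\<forall>g x. g \<in> harmonics m n \<longrightarrow> (\<forall>i<h. ip g (e i) = 0) \<longrightarrow> x \<in> sphere 0 1 \<longrightarrow> g x = 0)"
    by (elim exE) (rule that)
  then have he: "orthonormal {..<h} e" "\<And>i. i < h \<Longrightarrow> e i \<in> harmonics m n"
     and compl: "\<And>g x. g \<in> harmonics m n \<Longrightarrow> (\<forall>i<h. ip g (e i) = 0) \<Longrightarrow> x \<in> sphere 0 1 \<Longrightarrow> g x = 0"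
    by blast+
  define B where "B = (if m = 0 \<or> n = 0 then {} else bimultiindices (m - 1) (n - 1) :: (('d \<Rightarrow> nat) \<times> ('d \<Rightarrow> nat)) set)"
  have finB: "finite B" by (simp add: B_def)
  let ?zm = "\<lambda>x. zmono (fst x) (snd x) :: complex ^ 'd \<Rightarrow> complex"
  have bm: "bihom m n (?zm x)" if "x \<in> ?A" for x
    using bihom_mono[of "fst x" "snd x"] that by (auto simp: multiindices_def)
  have pm: "polyfun (?zm x)" for x using bihom_polyfun[OF bihom_mono] .
  have "\<exists>a. (\<lambda>z. \<Sum>j\<in>UNIV. wirt (-1) j (wirt 1 j (?zm x)) z) = (\<lambda>z. \<Sum>b\<in>B. a b * ?zm b z)" if x: "x \<in> ?A" for x
  proof (cases "m = 0 \<or> n = 0")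
    case True
    have "wirt (-1) j (wirt 1 j (?zm x)) = (\<lambda>z. 0)" for j
      using True bihom_wirt_z[OF bm[OF x], of j] bihom_wirt_zbar[OF bm[OF x], of j]
        wirt_commute[OF pm, of "-1" j 1 j x] by (auto simp: wirt_const)
    then show ?thesis using True by (auto simp: B_def)
  next
    case False
    then obtain m' n' where mn: "m = Suc m'" "n = Suc n'" by (metis not0_implies_Suc)
    have "bihom m n' (wirt 1 j (?zm x))" for j using bihom_wirt_zbar[OF bm[OF x], of j] mn by blast
    then have "bihom m' n' (wirt (-1) j (wirt 1 j (?zm x)))" for j
      using bihom_wirt_z mn by blast
    from bihom_coeffs[OF bihom_sum[of UNIV, OF this]] show ?thesis using False by (simp add: B_def mn)
  qed
  then have "\<forall>x\<in>?A. \<exists>a. (\<lambda>z. \<Sum>j\<in>UNIV. wirt (-1) j (wirt 1 j (?zm x)) z) = (\<lambda>z. \<Sum>b\<in>B. a b * ?zm b z)"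
    by blast
  from bchoice[OF this] obtain a where
    a: "\<And>x. x \<in> ?A \<Longrightarrow> (\<lambda>z. \<Sum>j\<in>UNIV. wirt (-1) j (wirt 1 j (?zm x)) z) = (\<lambda>z. \<Sum>b\<in>B. a x b * ?zm b z)"
    by blast
  have "card ?A \<le> h + card B"
  proof (rule ccontr)
    assume "\<not> ?thesis"
    then have less: "card (B <+> {..<h}) < card ?A" using finB by (simp add: card_Plus)
    \<comment> \<open>The equations of harmonicity, followed by those of orthogonality to the complete family.\<close>
    define E where "E j x = (case j of Inl b \<Rightarrow> a x b | Inr i \<Rightarrow> ip (?zm x) (e i))" for j x
    obtain c where c: "\<exists>x\<in>?A. c x \<noteq> 0" "\<And>j. j \<in> B <+> {..<h} \<Longrightarrow> (\<Sum>x\<in>?A. c x * E j x) = 0"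
      using underdetermined_system[OF _ _ less, of E] finB by auto
    define f where "f = (\<lambda>z. \<Sum>x\<in>?A. c x * ?zm x z)"
    have bf: "bihom m n f" unfolding f_def by (intro bihom_sum bihom_cmult bm)
    have "harmonic f"
      unfolding harmonic_def
    proof
      fix z
      have w1: "wirt 1 j f = (\<lambda>z. \<Sum>x\<in>?A. c x * wirt 1 j (?zm x) z)" for j
        unfolding f_def by (rule ext, subst wirt_sum) (auto simp: wirt_cmult[OF pm] intro!: polyfun_cmult pm)
      have w2: "wirt (-1) j (wirt 1 j f) z = (\<Sum>x\<in>?A. c x * wirt (-1) j (wirt 1 j (?zm x)) z)" for j
        unfolding w1 by (subst wirt_sum) (auto simp: wirt_cmult[OF polyfun_wirt[OF pm]] intro!: polyfun_cmult polyfun_wirt pm)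
      have "(\<Sum>j\<in>UNIV. wirt (-1) j (wirt 1 j f) z) = (\<Sum>x\<in>?A. c x * (\<Sum>j\<in>UNIV. wirt (-1) j (wirt 1 j (?zm x)) z))"
        unfolding w2 by (subst sum.swap) (simp add: sum_distrib_left)
      also have "\<dots> = (\<Sum>x\<in>?A. c x * (\<Sum>b\<in>B. a x b * ?zm b z))"
        using a by (intro sum.cong refl) (simp add: fun_eq_iff)
      also have "\<dots> = (\<Sum>b\<in>B. (\<Sum>x\<in>?A. c x * a x b) * ?zm b z)"
        unfolding sum_distrib_left sum_distrib_right by (subst sum.swap) (simp add: mult.assoc)
      also have "\<dots> = 0"
        using c(2)[of "Inl _"] by (intro sum.neutral) (auto simp: E_def)
      finally show "(\<Sum>j\<in>UNIV. wirt (-1) j (wirt 1 j f) z) = 0" .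
    qed
    then have fh: "on_sphere f \<in> harmonics m n" using bf unfolding harmonics_iff by blast
    have "ip (on_sphere f) (e i) = 0" if i: "i < h" for i
    proof -
      have "ip (on_sphere f) (e i) = ip f (e i)" by (rule ip_cong) (auto simp: on_sphere_apply)
      also have "\<dots> = (\<Sum>x\<in>?A. c x * ip (?zm x) (e i))"
        unfolding f_def using he(1) i
        by (intro ip_sum_left polyfun_continuous_on[OF pm]) (auto simp: orthonormal_def)
      also have "\<dots> = 0" using c(2)[of "Inr i"] i by (auto simp: E_def)
      finally show ?thesis .
    qed
    then have "on_sphere f x = 0" if "x \<in> sphere 0 1" for x using compl[OF fh _ that] by blast
    then have "f x = 0" if "x \<in> sphere 0 1" for x using that by (metis on_sphere_apply)
    from bihom_zero_if_zero_on_sphere[OF bf this] have f0: "f z = 0" for z .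
    have "c x = 0" if "x \<in> ?A" for x
      by (rule zmono_independent[of ?A fst snd c, OF _ _ f0[unfolded f_def] that]) (auto simp: inj_on_def)
    then show False using c(1) by blast
  qed
  moreover have "card B = (if m = 0 \<or> n = 0 then 0 else card (bimultiindices (m - 1) (n - 1) :: (('d \<Rightarrow> nat) \<times> ('d \<Rightarrow> nat)) set))"
    by (simp add: B_def)
  ultimately have "card ?A \<le> h + (if m = 0 \<or> n = 0 then 0 else card (bimultiindices (m - 1) (n - 1) :: (('d \<Rightarrow> nat) \<times> ('d \<Rightarrow> nat)) set))"
    by simp
  then show ?thesis using he' by (intro exI[of _ h] exI[of _ e]) blast
qed

subsection \<open>Restrictions of polynomials to the sphere\<close>

lemma spans_zero: "spans I b (\<lambda>x. 0)"
  unfolding spans_def by (intro exI[of _ "\<lambda>_. 0"]) simp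

lemma spans_add:
  assumes "spans I b f" "spans I b g"
  shows "spans I b (\<lambda>x. f x + g x)"
proof -
  obtain c c' where "\<forall>x\<in>sphere 0 1. f x = (\<Sum>i\<in>I. c i * b i x)" "\<forall>x\<in>sphere 0 1. g x = (\<Sum>i\<in>I. c' i * b i x)"
    using assms unfolding spans_def by blast
  then show ?thesis unfolding spans_def
    by (intro exI[of _ "\<lambda>i. c i + c' i"]) (simp add: distrib_right sum.distrib)
qed

lemma spans_cmult:
  assumes "spans I b f"
  shows "spans I b (\<lambda>x. a * f x)"
proof -
  obtain c where "\<forall>x\<in>sphere 0 1. f x = (\<Sum>i\<in>I. c i * b i x)"
    using assms unfolding spans_def by blast
  then show ?thesis unfolding spans_def
    by (intro exI[of _ "\<lambda>i. a * c i"]) (simp add: sum_distrib_left mult.assoc)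
qed

lemma spans_sum: "(\<And>j. j \<in> J \<Longrightarrow> spans I b (f j)) \<Longrightarrow> spans I b (\<lambda>x. \<Sum>j\<in>J. f j x)"
  by (induction J rule: infinite_finite_induct) (auto intro: spans_zero spans_add)

lemma spans_cong: "(\<And>x. x \<in> sphere 0 1 \<Longrightarrow> f x = g x) \<Longrightarrow> spans I b f = spans I b g"
  unfolding spans_def by simp

text \<open>
  On the sphere every polynomial of degree at most \<open>L\<close> agrees with a combination of the
  monomials of the two top degrees, because \<open>\<Sum>\<^sub>j z\<^sub>j \<bar>z\<^sub>j = 1\<close> there.
\<close>

definition top_monomials :: "nat \<Rightarrow> (('d::finite \<Rightarrow> nat) \<times> ('d \<Rightarrow> nat)) set" where
  "top_monomials L = {x. sum (fst x) UNIV + sum (snd x) UNIV \<in> {L, L - 1}}"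

lemma finite_top_monomials [simp]: "finite (top_monomials L)"
proof (rule finite_subset)
  show "top_monomials L \<subseteq> (\<Union>m\<in>{..L}. multiindices m) \<times> (\<Union>n\<in>{..L}. multiindices n)"
    by (auto simp: top_monomials_def multiindices_def)
qed simp

definition sphere_poly :: "nat \<Rightarrow> (complex ^ 'd::finite \<Rightarrow> complex) \<Rightarrow> bool" where
  "sphere_poly L = spans (top_monomials L) (\<lambda>x. zmono (fst x) (snd x))"

lemma sphere_poly_cong: "(\<And>x. x \<in> sphere 0 1 \<Longrightarrow> f x = g x) \<Longrightarrow> sphere_poly L f = sphere_poly L g"
  unfolding sphere_poly_def by (rule spans_cong)

lemma func_space_sphere_poly: "func_space (sphere_poly L)"
  unfolding func_space_def
proof (intro conjI allI impI)
  fix f :: "complex ^ 'a \<Rightarrow> complex" assume "sphere_poly L f"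
  then obtain c where c: "\<And>x. x \<in> sphere 0 1 \<Longrightarrow> f x = (\<Sum>i\<in>top_monomials L. c i * zmono (fst i) (snd i) x)"
    unfolding sphere_poly_def spans_def by blast
  have "continuous_on (sphere 0 1) (\<lambda>x. \<Sum>i\<in>top_monomials L. c i * zmono (fst i) (snd i) x)"
    by (intro continuous_intros polyfun_continuous_on[OF bihom_polyfun[OF bihom_mono]])
  then show "continuous_on (sphere 0 1) f"
    by (rule continuous_on_eq) (simp only: c)
qed (unfold sphere_poly_def, auto intro: spans_zero spans_add spans_cmult)

text \<open>
  The degree is raised by multiplying with a power of \<open>\<Sum>\<^sub>j z\<^sub>j \<bar>z\<^sub>j\<close>.
\<close>

lemma bihom_sphere_poly:
  fixes f :: "complex ^ 'd::finite \<Rightarrow> complex"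
  assumes f: "bihom m n f" and L: "m + n \<le> L"
  shows "sphere_poly L f"
proof -
  \<comment> \<open>The largest power that keeps the degree at most \<open>L\<close>; it reaches \<open>L\<close> or \<open>L - 1\<close>.\<close>
  define j where "j = (L - (m + n)) div 2"
  define g where "g = (\<lambda>z. (herm z z) ^ j * f z)"
  have "bihom (1 + 0) (0 + 1) (\<lambda>z::complex ^ 'd. herm z z)"
    unfolding herm_def by (intro bihom_sum bihom_mult bihom_coord1 bihom_cnj_coord1)
  then have "bihom 1 1 (\<lambda>z::complex ^ 'd. herm z z)" by simp
  from bihom_mult[OF bihom_power[OF this, of j] f]
  have "bihom (j + m) (j + n) g" by (simp add: g_def)
  then obtain c where c: "g = (\<lambda>z. \<Sum>x\<in>bimultiindices (j + m) (j + n). c x * zmono (fst x) (snd x) z)"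
    using bihom_coeffs by blast
  let ?B = "bimultiindices (j + m) (j + n) :: (('d \<Rightarrow> nat) \<times> ('d \<Rightarrow> nat)) set"
  have "j + m + (j + n) \<in> {L, L - 1}" using L unfolding j_def by simp arith
  then have sub: "?B \<subseteq> top_monomials L"
    by (auto simp: top_monomials_def multiindices_def)
  have "f x = (\<Sum>y\<in>top_monomials L. (if y \<in> ?B then c y else 0) * zmono (fst y) (snd y) x)" if "x \<in> sphere 0 1" for x
  proof -
    have "f x = g x" using that by (simp add: g_def herm_self)
    also have "\<dots> = (\<Sum>y\<in>?B. (if y \<in> ?B then c y else 0) * zmono (fst y) (snd y) x)"
      unfolding c by (intro sum.cong) auto
    also have "\<dots> = (\<Sum>y\<in>top_monomials L. (if y \<in> ?B then c y else 0) * zmono (fst y) (snd y) x)"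
      using sub by (intro sum.mono_neutral_left) auto
    finally show ?thesis .
  qed
  then show ?thesis unfolding sphere_poly_def spans_def
    by (intro exI[of _ "\<lambda>y. if y \<in> ?B then c y else 0"] ballI)
qed

lemma sphere_poly_sum_cmult:
  "(\<And>i. i \<in> I \<Longrightarrow> sphere_poly L (f i)) \<Longrightarrow> sphere_poly L (\<lambda>x. \<Sum>i\<in>I. c i * f i x)"
  unfolding sphere_poly_def by (intro spans_sum spans_cmult)

lemma top_monomials_degree: "x \<in> top_monomials L \<Longrightarrow> sum (fst x) UNIV + sum (snd x) UNIV \<le> L"
  by (auto simp: top_monomials_def)

lemma sphere_poly_mult:
  fixes f g :: "complex ^ 'd::finite \<Rightarrow> complex"
  assumes "sphere_poly a f" "sphere_poly b g"
  shows "sphere_poly (a + b) (\<lambda>x. f x * g x)"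
proof -
  let ?z = "\<lambda>x. zmono (fst x) (snd x) :: complex ^ 'd \<Rightarrow> complex"
  obtain c where c: "\<And>x. x \<in> sphere 0 1 \<Longrightarrow> f x = (\<Sum>i\<in>top_monomials a. c i * ?z i x)"
    using assms(1) unfolding sphere_poly_def spans_def by blast
  obtain c' where c': "\<And>x. x \<in> sphere 0 1 \<Longrightarrow> g x = (\<Sum>i\<in>top_monomials b. c' i * ?z i x)"
    using assms(2) unfolding sphere_poly_def spans_def by blast
  have "sphere_poly (a + b) (\<lambda>x. \<Sum>i\<in>top_monomials a. c i * (\<Sum>k\<in>top_monomials b. c' k * (?z i x * ?z k x)))"
  proof (intro sphere_poly_sum_cmult)
    fix i k :: "('d \<Rightarrow> nat) \<times> ('d \<Rightarrow> nat)"
    assume "i \<in> top_monomials a" "k \<in> top_monomials b"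
    then show "sphere_poly (a + b) (\<lambda>x. ?z i x * ?z k x)"
      using top_monomials_degree[of i a] top_monomials_degree[of k b]
      by (intro bihom_sphere_poly[OF bihom_mult[OF bihom_mono bihom_mono]]) auto
  qed
  moreover have "f x * g x = (\<Sum>i\<in>top_monomials a. c i * (\<Sum>k\<in>top_monomials b. c' k * (?z i x * ?z k x)))"
    if "x \<in> sphere 0 1" for x
    unfolding c[OF that] c'[OF that] sum_product by (simp add: sum_distrib_left mult_ac)
  ultimately show ?thesis by (subst sphere_poly_cong) auto
qed

lemma sphere_poly_power: "sphere_poly L f \<Longrightarrow> sphere_poly (n * L) (\<lambda>x. f x ^ n)"
proof (induction n)
  case 0
  show ?case using bihom_sphere_poly[OF bihom.const, of 0 1] by simp
next
  case (Suc n)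
  then show ?case using sphere_poly_mult[of L f "n * L"] by simp
qed

lemma sphere_poly_reflection:
  fixes f :: "complex ^ 'd::finite \<Rightarrow> complex"
  assumes "sphere_poly L f" "herm v v = 1" "norm c = 1"
  shows "sphere_poly L (\<lambda>z. f (unitary_reflection v c z))"
proof -
  let ?z = "\<lambda>x. zmono (fst x) (snd x) :: complex ^ 'd \<Rightarrow> complex"
  obtain b where b: "\<And>x. x \<in> sphere 0 1 \<Longrightarrow> f x = (\<Sum>i\<in>top_monomials L. b i * ?z i x)"
    using assms(1) unfolding sphere_poly_def spans_def by blast
  have "sphere_poly L (\<lambda>z. \<Sum>i\<in>top_monomials L. b i * ?z i (unitary_reflection v c z))"
  proof (intro sphere_poly_sum_cmult)
    fix i :: "('d \<Rightarrow> nat) \<times> ('d \<Rightarrow> nat)" assume "i \<in> top_monomials L"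
    then show "sphere_poly L (\<lambda>z. ?z i (unitary_reflection v c z))"
      by (intro bihom_sphere_poly[OF bihom_comp_linear[OF unitary_reflection_component bihom_mono]]
        top_monomials_degree)
  qed
  moreover have "f (unitary_reflection v c z) = (\<Sum>i\<in>top_monomials L. b i * ?z i (unitary_reflection v c z))"
    if "z \<in> sphere 0 1" for z
    using that norm_unitary_reflection[OF assms(2,3)] by (intro b) simp
  ultimately show ?thesis by (subst sphere_poly_cong) auto
qed

subsection \<open>A complete orthonormal system of harmonics\<close>

definition harmonic_indices :: "(nat \<Rightarrow> nat \<Rightarrow> nat) \<Rightarrow> nat \<Rightarrow> (nat \<times> nat \<times> nat) set" where
  "harmonic_indices h L = {(m, n, i). m + n \<le> L \<and> i < h m n}"

definition bidegrees :: "nat \<Rightarrow> (nat \<times> nat) set" where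
  "bidegrees L = {(m, n). m + n \<le> L}"

lemma finite_bidegrees [simp]: "finite (bidegrees L)"
  by (rule finite_subset[of _ "{..L} \<times> {..L}"]) (auto simp: bidegrees_def)

lemma harmonic_indices_eq:
  "harmonic_indices h L = (\<lambda>((m, n), i). (m, n, i)) ` (SIGMA x:bidegrees L. {..<h (fst x) (snd x)})"
  by (force simp: harmonic_indices_def bidegrees_def image_iff)

lemma finite_harmonic_indices [simp]: "finite (harmonic_indices h L)"
  unfolding harmonic_indices_eq by (intro finite_imageI finite_SigmaI) auto

lemma card_harmonic_indices: "card (harmonic_indices h L) = (\<Sum>x\<in>bidegrees L. h (fst x) (snd x))"
proof -
  have "card (harmonic_indices h L) = card (SIGMA x:bidegrees L. {..<h (fst x) (snd x)})"
    unfolding harmonic_indices_eq by (intro card_image) (auto simp: inj_on_def)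
  then show ?thesis by (simp add: card_SigmaI)
qed

text \<open>
  The lower bounds \<open>P m n - P (m - 1) (n - 1)\<close> for the numbers of harmonics telescope when
  summed over all bidegrees of total degree at most \<open>L\<close>: what remains are the two top
  degrees.
\<close>

lemma card_top_monomials_le:
  fixes h :: "nat \<Rightarrow> nat \<Rightarrow> nat"
  defines "P \<equiv> (\<lambda>m n. card (bimultiindices m n :: (('d::finite \<Rightarrow> nat) \<times> ('d \<Rightarrow> nat)) set))"
  assumes h: "\<And>m n. P m n \<le> h m n + (if m = 0 \<or> n = 0 then 0 else P (m - 1) (n - 1))"
  shows "card (top_monomials L :: (('d \<Rightarrow> nat) \<times> ('d \<Rightarrow> nat)) set) \<le> card (harmonic_indices h L)"
proof -
  define E where "E = {(m, n). m + n \<in> {L, L - 1}}"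
  define D' where "D' = {(m::nat, n::nat). m + n + 2 \<le> L}"
  have finE: "finite E" by (rule finite_subset[of _ "{..L} \<times> {..L}"]) (auto simp: E_def)
  have finD: "finite D'" by (rule finite_subset[of _ "{..L} \<times> {..L}"]) (auto simp: D'_def)
  have "(top_monomials L :: (('d \<Rightarrow> nat) \<times> ('d \<Rightarrow> nat)) set) = (\<Union>x\<in>E. bimultiindices (fst x) (snd x))"
    by (fastforce simp: top_monomials_def multiindices_def E_def)
  also have "card \<dots> = (\<Sum>x\<in>E. P (fst x) (snd x))"
    unfolding P_def using finE by (intro card_UN_disjoint) (auto simp: multiindices_def finite_multiindices)
  finally have 1: "card (top_monomials L :: (('d \<Rightarrow> nat) \<times> ('d \<Rightarrow> nat)) set) = (\<Sum>x\<in>E. P (fst x) (snd x))" .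
  have 2: "bidegrees L = E \<union> D'" "E \<inter> D' = {}"
    by (auto simp: bidegrees_def E_def D'_def)
  have "(\<Sum>x\<in>E. P (fst x) (snd x)) + (\<Sum>x\<in>D'. P (fst x) (snd x)) = (\<Sum>x\<in>bidegrees L. P (fst x) (snd x))"
    unfolding 2(1) by (rule sum.union_disjoint[symmetric, OF finE finD 2(2)])
  also have "\<dots> \<le> (\<Sum>x\<in>bidegrees L. h (fst x) (snd x)
      + (if fst x = 0 \<or> snd x = 0 then 0 else P (fst x - 1) (snd x - 1)))"
    by (intro sum_mono h)
  also have "\<dots> = card (harmonic_indices h L)
      + (\<Sum>x\<in>bidegrees L. if fst x = 0 \<or> snd x = 0 then 0 else P (fst x - 1) (snd x - 1))"
    by (simp add: sum.distrib card_harmonic_indices)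
  also have "(\<Sum>x\<in>bidegrees L. if fst x = 0 \<or> snd x = 0 then 0 else P (fst x - 1) (snd x - 1))
      = (\<Sum>x\<in>(\<lambda>x. (Suc (fst x), Suc (snd x))) ` D'. P (fst x - 1) (snd x - 1))"
  proof (intro sum.mono_neutral_cong_right)
    show "\<forall>i\<in>bidegrees L - (\<lambda>x. (Suc (fst x), Suc (snd x))) ` D'.
       (if fst i = 0 \<or> snd i = 0 then 0 else P (fst i - 1) (snd i - 1)) = 0"
    proof safe
      fix m n assume mn: "(m, n) \<in> bidegrees L" "(m, n) \<notin> (\<lambda>x. (Suc (fst x), Suc (snd x))) ` D'"
      have "m = 0 \<or> n = 0"
      proof (rule ccontr)
        assume "\<not> ?thesis"
        then obtain m' n' where "m = Suc m'" "n = Suc n'" by (metis not0_implies_Suc)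
        then show False using mn by (force simp: bidegrees_def D'_def image_iff)
      qed
      then show "(if fst (m, n) = 0 \<or> snd (m, n) = 0 then 0 else P (fst (m, n) - 1) (snd (m, n) - 1)) = 0" by auto
    qed
    show "(\<lambda>x. (Suc (fst x), Suc (snd x))) ` D' \<subseteq> bidegrees L"
      by (auto simp: bidegrees_def D'_def)
  qed auto
  also have "\<dots> = (\<Sum>x\<in>D'. P (fst x) (snd x))"
    by (subst sum.reindex) (auto simp: inj_on_def)
  finally show ?thesis using 1 by simp
qed

text \<open>
  An orthonormal system of harmonics indexed by bidegree and position. The elements of degree at most
  \<open>L\<close> form a basis of the restrictions of all polynomials of degree at most \<open>L\<close>, and
  the kernel of that space is constant on the diagonal.
\<close>

definition harmonic_system ::
    "(nat \<Rightarrow> nat \<Rightarrow> nat) \<Rightarrow> (nat \<times> nat \<times> nat \<Rightarrow> complex ^ 'd::finite \<Rightarrow> complex) \<Rightarrow> bool" where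
  "harmonic_system h e \<longleftrightarrow>
     (\<forall>m n i. i < h m n \<longrightarrow> e (m, n, i) \<in> harmonics m n) \<and>
     (\<forall>m n g x. g \<in> harmonics m n \<longrightarrow> x \<in> sphere 0 1 \<longrightarrow> g x = (\<Sum>i<h m n. ip g (e (m, n, i)) * e (m, n, i) x)) \<and>
     (\<forall>L. orthonormal (harmonic_indices h L) e) \<and>
     (\<forall>L. card (harmonic_indices h L) = card (top_monomials L :: (('d \<Rightarrow> nat) \<times> ('d \<Rightarrow> nat)) set)) \<and>
     (\<forall>L y. y \<in> harmonic_indices h L \<longrightarrow> sphere_poly L (e y)) \<and>
     (\<forall>L f x. sphere_poly L f \<longrightarrow> x \<in> sphere 0 1 \<longrightarrow> f x = (\<Sum>y\<in>harmonic_indices h L. ip f (e y) * e y x)) \<and>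
     (\<forall>L. \<forall>x\<in>sphere 0 1. (\<Sum>y\<in>harmonic_indices h L. (norm (e y x))\<^sup>2)
         = real (card (harmonic_indices h L)) / measure sphere_measure (sphere 0 1 :: (complex ^ 'd) set))"

text \<open>
  The harmonics of degree at most \<open>L\<close> are at least as many as the monomials that span the
  restrictions of polynomials of degree at most \<open>L\<close>, hence exactly as many, and they form
  a basis of a space that is invariant under reflections.
\<close>

lemma exists_harmonic_system:
  "\<exists>h (e :: nat \<times> nat \<times> nat \<Rightarrow> complex ^ 'd::finite \<Rightarrow> complex). harmonic_system h e"
proof -
  define P where "P = (\<lambda>m n. card (bimultiindices m n :: (('d \<Rightarrow> nat) \<times> ('d \<Rightarrow> nat)) set))"
  define Q where "Q m n h e \<longleftrightarrow> orthonormal {..<h} e \<and> (\<forall>i<h. e i \<in> harmonics m n) \<and>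
     (\<forall>g x. g \<in> harmonics m n \<longrightarrow> (\<forall>i<h. ip g (e i) = 0) \<longrightarrow> x \<in> sphere 0 1 \<longrightarrow> g x = 0) \<and>
     P m n \<le> h + (if m = 0 \<or> n = 0 then 0 else P (m - 1) (n - 1))"
    for m n h and e :: "nat \<Rightarrow> complex ^ 'd \<Rightarrow> complex"
  have "\<forall>m n. \<exists>h e. Q m n h e" unfolding Q_def P_def using exists_harmonics_basis by blast
  then obtain h E where Q: "\<And>m n. Q m n (h m n) (E m n)" by metis
  define e where "e = (\<lambda>(m, n, i). E m n i)"
  have mem: "e (m, n, i) \<in> harmonics m n" if "i < h m n" for m n i
    using Q[of m n] that by (simp add: Q_def e_def)
  have on1: "orthonormal {..<h m n} (E m n)" for m n using Q[of m n] by (simp add: Q_def)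
  have expand: "g x = (\<Sum>i<h m n. ip g (e (m, n, i)) * e (m, n, i) x)"
    if "g \<in> harmonics m n" "x \<in> sphere 0 1" for m n g x
    unfolding e_def prod.case
    by (rule orthonormal_complete_expansion[OF func_space_harmonics on1 _ _ that])
      (use Q[of m n] in \<open>auto simp: Q_def\<close>)
  have cont: "continuous_on (sphere 0 1) (e (m, n, i))" if "i < h m n" for m n i
    using mem[OF that] func_space_harmonics[of m n] unfolding func_space_def by blast
  have on: "orthonormal (harmonic_indices h L) e" for L
    unfolding orthonormal_def
  proof (intro conjI ballI finite_harmonic_indices)
    fix y assume "y \<in> harmonic_indices h L"
    then show "continuous_on (sphere 0 1) (e y)" using cont by (auto simp: harmonic_indices_def)
  next
    fix y y' assume "y \<in> harmonic_indices h L" "y' \<in> harmonic_indices h L"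
    then obtain m n i m' n' i' where y: "y = (m, n, i)" "y' = (m', n', i')" "i < h m n" "i' < h m' n'"
      by (auto simp: harmonic_indices_def)
    show "ip (e y) (e y') = of_bool (y = y')"
    proof (cases "(m, n) = (m', n')")
      case True
      then show ?thesis using on1[of m n] y by (simp add: orthonormal_def e_def)
    next
      case False
      obtain p where p: "bihom m n p" "harmonic p" "e y = on_sphere p"
        using mem[OF y(3)] y(1) unfolding harmonics_iff by blast
      obtain q where q: "bihom m' n' q" "harmonic q" "e y' = on_sphere q"
        using mem[OF y(4)] y(2) unfolding harmonics_iff by blast
      have "ip (e y) (e y') = ip p q" unfolding p q by (rule ip_cong) (auto simp: on_sphere_apply)
      also have "\<dots> = 0" unfolding ip_def by (rule harmonic_orthogonal[OF p(1,2) q(1,2) False])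
      finally show ?thesis using False y by auto
    qed
  qed
  have sp: "sphere_poly L (e y)" if "y \<in> harmonic_indices h L" for L y
  proof -
    obtain m n i where y: "y = (m, n, i)" "m + n \<le> L" "i < h m n"
      using \<open>y \<in> harmonic_indices h L\<close> by (cases y) (auto simp: harmonic_indices_def)
    obtain p where p: "bihom m n p" "e y = on_sphere p"
      using mem[OF y(3)] y(1) unfolding harmonics_iff by blast
    have "sphere_poly L p = sphere_poly L (e y)" unfolding p(2) by (rule sphere_poly_cong) (simp add: on_sphere_apply)
    then show ?thesis using bihom_sphere_poly[OF p(1) y(2)] by simp
  qed
  have span: "spans (top_monomials L) (\<lambda>x. zmono (fst x) (snd x)) f" if "sphere_poly L f"
    for L and f :: "complex ^ 'd \<Rightarrow> complex" using that by (simp add: sphere_poly_def)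
  have le: "card (top_monomials L :: (('d \<Rightarrow> nat) \<times> ('d \<Rightarrow> nat)) set) \<le> card (harmonic_indices h L)" for L
    by (rule card_top_monomials_le) (use Q in \<open>unfold Q_def P_def, blast\<close>)
  have card: "card (harmonic_indices h L) = card (top_monomials L :: (('d \<Rightarrow> nat) \<times> ('d \<Rightarrow> nat)) set)" for L
    using le[of L] orthonormal_card_le[OF on finite_top_monomials span[OF sp]] by (intro antisym) auto
  have full: "f x = (\<Sum>y\<in>harmonic_indices h L. ip f (e y) * e y x)"
    if "sphere_poly L f" "x \<in> sphere 0 1" for L f x
    by (rule orthonormal_full_expansion[OF func_space_sphere_poly finite_top_monomials span on sp le that]) 
  have ker: "(\<Sum>y\<in>harmonic_indices h L. (norm (e y x))\<^sup>2)
      = real (card (harmonic_indices h L)) / measure sphere_measure (sphere 0 1 :: (complex ^ 'd) set)"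
    if "x \<in> sphere 0 1" for L x
    by (rule kernel_diagonal_constant[OF func_space_sphere_poly on sp full sphere_poly_reflection that])
  show ?thesis
    unfolding harmonic_system_def
    using mem expand on card sp full ker by (intro exI[of _ h] exI[of _ e]) blast
qed

section \<open>Random signs\<close>

lemma cosh_le_exp_half_square: "cosh x \<le> exp (x\<^sup>2 / 2)" for x :: real
proof -
  have fact2: "2 ^ n * fact n \<le> (fact (2 * n) :: real)" for n
  proof (induction n)
    case (Suc n)
    have "2 ^ Suc n * fact (Suc n) = (2 * real (Suc n)) * (2 ^ n * fact n)" by simp
    also have "\<dots> \<le> (real (2 * n + 2) * real (2 * n + 1)) * fact (2 * n)"
      using Suc by (intro mult_mono) auto
    also have "\<dots> = fact (2 * Suc n)" by (simp add: algebra_simps)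
    finally show ?case .
  qed simp
  define c where "c n = (if even n then x ^ n /\<^sub>R fact n else 0)" for n
  have inj: "strict_mono (\<lambda>n::nat. 2 * n)" by (auto simp: strict_mono_def)
  have s1: "(\<lambda>n. c (2 * n)) sums cosh x"
  proof -
    have "c sums cosh x" unfolding c_def by (rule cosh_converges)
    moreover have "c n = 0" if "n \<notin> range (\<lambda>n. 2 * n)" for n
      using that by (auto simp: c_def elim!: evenE)
    ultimately show ?thesis using sums_mono_reindex[OF inj, of c "cosh x"] by blast
  qed
  have s2: "(\<lambda>n. (x\<^sup>2 / 2) ^ n /\<^sub>R fact n) sums exp (x\<^sup>2 / 2)" by (rule exp_converges)
  have le: "c (2 * n) \<le> (x\<^sup>2 / 2) ^ n /\<^sub>R fact n" for n
  proof -
    have "x ^ (2 * n) / fact (2 * n) \<le> x ^ (2 * n) / (2 ^ n * fact n)"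
    proof (rule divide_left_mono[OF fact2])
      show "0 \<le> x ^ (2 * n)" by (simp add: power_mult)
    qed simp
    moreover have "c (2 * n) = x ^ (2 * n) / fact (2 * n)"
      by (simp add: c_def divide_inverse mult.commute)
    moreover have "(x\<^sup>2 / 2) ^ n /\<^sub>R fact n = x ^ (2 * n) / (2 ^ n * fact n)"
    proof -
      have "(x\<^sup>2 / 2) ^ n = x ^ (2 * n) / 2 ^ n" by (simp only: power_divide power_mult)
      then show ?thesis by (simp add: field_simps)
    qed
    ultimately show ?thesis by simp
  qed
  show ?thesis by (rule sums_le[OF le s1 s2])
qed

lemma power_even_le_exp: "x ^ (2 * n) \<le> fact (2 * n) * (exp x + exp (- x))" for x :: real
proof -
  have *: "y ^ m / fact m \<le> exp y" if "y \<ge> 0" for y :: real and m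
  proof -
    have s: "(\<lambda>n. y ^ n /\<^sub>R fact n) sums exp y" by (rule exp_converges)
    have "(\<Sum>n\<in>{m}. y ^ n /\<^sub>R fact n) \<le> suminf (\<lambda>n. y ^ n /\<^sub>R fact n)"
      using s that by (intro sum_le_suminf) (auto simp: sums_iff)
    then show ?thesis using s by (simp add: sums_iff divide_inverse mult.commute)
  qed
  have "x ^ (2 * n) = \<bar>x\<bar> ^ (2 * n)" by (simp add: power_even_abs)
  also have "\<dots> \<le> fact (2 * n) * exp \<bar>x\<bar>" using *[of "\<bar>x\<bar>" "2 * n"] by (simp add: field_simps)
  also have "\<dots> \<le> fact (2 * n) * (exp x + exp (- x))"
    by (intro mult_left_mono) (auto simp: abs_if intro: less_imp_le)
  finally show ?thesis .
qed

definition sgn_of :: "'i set \<Rightarrow> 'i \<Rightarrow> real" where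
  "sgn_of T i = (if i \<in> T then 1 else -1)"

lemma sum_signs_exp_le:
  fixes a :: "'i \<Rightarrow> real"
  assumes "finite J"
  shows "(\<Sum>T\<in>Pow J. exp (\<Sum>i\<in>J. sgn_of T i * a i)) \<le> 2 ^ card J * exp ((\<Sum>i\<in>J. (a i)\<^sup>2) / 2)"
proof -
  have "exp (\<Sum>i\<in>J. sgn_of T i * a i) = (\<Prod>i\<in>T. exp (a i)) * (\<Prod>i\<in>J - T. exp (- a i))"
    if "T \<in> Pow J" for T
  proof -
    have T: "T \<subseteq> J" "finite T" using that assms finite_subset by auto
    have "(\<Sum>i\<in>J. sgn_of T i * a i) = (\<Sum>i\<in>T. sgn_of T i * a i) + (\<Sum>i\<in>J - T. sgn_of T i * a i)"
      using assms T by (simp add: sum.subset_diff[of T J] add.commute)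
    also have "\<dots> = (\<Sum>i\<in>T. a i) + (\<Sum>i\<in>J - T. - a i)"
      by (intro arg_cong2[of _ _ _ _ "(+)"] sum.cong) (auto simp: sgn_of_def)
    finally show ?thesis using T assms by (simp add: exp_add exp_sum)
  qed
  then have "(\<Sum>T\<in>Pow J. exp (\<Sum>i\<in>J. sgn_of T i * a i)) = (\<Prod>i\<in>J. exp (a i) + exp (- a i))"
    using assms by (simp add: prod_add)
  also have "\<dots> \<le> (\<Prod>i\<in>J. 2 * exp ((a i)\<^sup>2 / 2))"
  proof (intro prod_mono conjI)
    fix i assume "i \<in> J"
    show "exp (a i) + exp (- a i) \<le> 2 * exp ((a i)\<^sup>2 / 2)"
      using cosh_le_exp_half_square[of "a i"] by (simp add: cosh_def field_simps)
  qed (simp add: add_nonneg_nonneg)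
  also have "\<dots> = 2 ^ card J * exp ((\<Sum>i\<in>J. (a i)\<^sup>2) / 2)"
    using assms by (simp add: prod.distrib exp_sum sum_divide_distrib)
  finally show ?thesis .
qed

text \<open>
  The exponential moments of a sum with independent signs are at most those of a Gaussian variable;
  the moments are recovered from \<open>x\<^sup>2\<^sup>n \<le> (2 n)! (exp x + exp (- x))\<close> after scaling.
\<close>

lemma khintchine_real:
  fixes a :: "'i \<Rightarrow> real"
  assumes J: "finite J" and n: "n \<ge> 1" and B: "B > 0" "(\<Sum>i\<in>J. (a i)\<^sup>2) \<le> B"
  shows "(\<Sum>T\<in>Pow J. (\<Sum>i\<in>J. sgn_of T i * a i) ^ (2 * n)) \<le> 2 ^ card J * (2 * (2 * real n * exp 1 * B) ^ n)"
proof -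
  \<comment> \<open>This scaling minimizes \<open>t powr (- 2 n) * exp (t\<^sup>2 B / 2)\<close>.\<close>
  define t where "t = sqrt (2 * real n / B)"
  have t: "t > 0" "t\<^sup>2 = 2 * real n / B" using n B by (auto simp: t_def)
  let ?S = "\<lambda>T. \<Sum>i\<in>J. sgn_of T i * a i"
  have e: "(\<Sum>T\<in>Pow J. exp (s * ?S T)) \<le> 2 ^ card J * exp (real n)" if "s = t \<or> s = - t" for s
  proof -
    have "(\<Sum>T\<in>Pow J. exp (s * ?S T)) = (\<Sum>T\<in>Pow J. exp (\<Sum>i\<in>J. sgn_of T i * (s * a i)))"
      by (simp add: sum_distrib_left mult_ac)
    also have "\<dots> \<le> 2 ^ card J * exp ((\<Sum>i\<in>J. (s * a i)\<^sup>2) / 2)" by (rule sum_signs_exp_le[OF J])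
    also have "(\<Sum>i\<in>J. (s * a i)\<^sup>2) / 2 = t\<^sup>2 * (\<Sum>i\<in>J. (a i)\<^sup>2) / 2"
      using that by (auto simp: power_mult_distrib sum_distrib_left)
    also have "\<dots> \<le> t\<^sup>2 * B / 2" using B by (intro divide_right_mono mult_left_mono) auto
    also have "\<dots> = real n" using B by (simp add: t)
    finally show ?thesis by simp
  qed
  have "(\<Sum>T\<in>Pow J. (t * ?S T) ^ (2 * n)) \<le> (\<Sum>T\<in>Pow J. fact (2 * n) * (exp (t * ?S T) + exp (- t * ?S T)))"
    using power_even_le_exp[of "t * ?S _" n] by (intro sum_mono) simp
  also have "\<dots> = fact (2 * n) * ((\<Sum>T\<in>Pow J. exp (t * ?S T)) + (\<Sum>T\<in>Pow J. exp (- t * ?S T)))"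
    by (simp add: sum_distrib_left sum.distrib distrib_left)
  also have "\<dots> \<le> (2 * real n) ^ (2 * n) * (2 ^ card J * exp (real n) + 2 ^ card J * exp (real n))"
  proof (intro mult_mono add_mono e)
    show "fact (2 * n) \<le> (2 * real n) ^ (2 * n)" using fact_le_power[of "2 * n", where 'a = real] by simp
  qed (auto intro!: add_nonneg_nonneg sum_nonneg)
  finally have 1: "(\<Sum>T\<in>Pow J. (t * ?S T) ^ (2 * n)) \<le> (2 * real n) ^ (2 * n) * (2 ^ card J * (2 * exp (real n)))"
    by (simp add: algebra_simps)
  have "(\<Sum>T\<in>Pow J. (?S T) ^ (2 * n)) = (\<Sum>T\<in>Pow J. (t * ?S T) ^ (2 * n)) / (t\<^sup>2) ^ n"
    using t(1) by (simp add: power_mult_distrib sum_distrib_left[symmetric] power_mult[symmetric])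
  also have "\<dots> \<le> (2 * real n) ^ (2 * n) * (2 ^ card J * (2 * exp (real n))) / (t\<^sup>2) ^ n"
    using 1 t(1) by (intro divide_right_mono) auto
  also have "(2 * real n) ^ (2 * n) = (2 * real n) ^ n * (2 * real n) ^ n"
    by (simp only: mult_2[of n] power_add)
  also have "exp (real n) = exp 1 ^ n" using exp_of_nat_mult[of n "1::real"] by simp
  also have "(2 * real n) ^ n * (2 * real n) ^ n * (2 ^ card J * (2 * exp 1 ^ n)) / (t\<^sup>2) ^ n
    = 2 ^ card J * (2 * (2 * real n * exp 1 * B) ^ n)"
  proof -
    have cancel: "q * q * (K * (2 * E)) / (q / b) = K * (2 * (q * E * b))" if "q > 0" "b > 0" for q K E b :: real
      using that by (simp add: divide_simps)
    show ?thesis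
      unfolding t(2) power_divide power_mult_distrib[of "2 * real n * exp 1" B] power_mult_distrib[of "2 * real n" "exp 1"]
      by (rule cancel) (use n B in auto)
  qed
  finally show ?thesis .
qed

lemma khintchine_complex:
  fixes a :: "'i \<Rightarrow> complex"
  assumes J: "finite J" and n: "n \<ge> 1" and B: "B > 0" "(\<Sum>i\<in>J. (norm (a i))\<^sup>2) \<le> B"
  shows "(\<Sum>T\<in>Pow J. norm (\<Sum>i\<in>J. of_real (sgn_of T i) * a i) ^ (2 * n)) \<le> 2 ^ card J * (48 * real n * B) ^ n"
proof -
  let ?R = "\<lambda>T. \<Sum>i\<in>J. sgn_of T i * Re (a i)" and ?I = "\<lambda>T. \<Sum>i\<in>J. sgn_of T i * Im (a i)"
  have p: "norm (\<Sum>i\<in>J. of_real (sgn_of T i) * a i) ^ (2 * n) \<le> 2 ^ n * (?R T ^ (2 * n) + ?I T ^ (2 * n))" for T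
  proof -
    have "norm (\<Sum>i\<in>J. of_real (sgn_of T i) * a i) ^ (2 * n) = ((?R T)\<^sup>2 + (?I T)\<^sup>2) ^ n"
      by (simp add: power_mult cmod_power2)
    also have "\<dots> \<le> (2 * max ((?R T)\<^sup>2) ((?I T)\<^sup>2)) ^ n" by (intro power_mono) auto
    also have "\<dots> = 2 ^ n * (max ((?R T)\<^sup>2) ((?I T)\<^sup>2)) ^ n" by (simp add: power_mult_distrib)
    also have "\<dots> \<le> 2 ^ n * (?R T ^ (2 * n) + ?I T ^ (2 * n))"
      by (intro mult_left_mono) (auto simp: max_def power_mult)
    finally show ?thesis .
  qed
  have Re: "(\<Sum>i\<in>J. (Re (a i))\<^sup>2) \<le> B" and Im: "(\<Sum>i\<in>J. (Im (a i))\<^sup>2) \<le> B"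
    by (rule order_trans[OF sum_mono B(2)], simp add: cmod_power2)+
  have "(\<Sum>T\<in>Pow J. norm (\<Sum>i\<in>J. of_real (sgn_of T i) * a i) ^ (2 * n))
    \<le> (\<Sum>T\<in>Pow J. 2 ^ n * (?R T ^ (2 * n) + ?I T ^ (2 * n)))" by (intro sum_mono p)
  also have "\<dots> = 2 ^ n * ((\<Sum>T\<in>Pow J. ?R T ^ (2 * n)) + (\<Sum>T\<in>Pow J. ?I T ^ (2 * n)))"
    by (simp add: sum_distrib_left sum.distrib distrib_left)
  also have "\<dots> \<le> 2 ^ n * (2 ^ card J * (2 * (2 * real n * exp 1 * B) ^ n) + 2 ^ card J * (2 * (2 * real n * exp 1 * B) ^ n))"
    by (intro mult_left_mono add_mono khintchine_real J n B Re Im) auto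
  also have "\<dots> = 2 ^ card J * (4 * (4 * real n * exp 1 * B) ^ n)"
    by (simp add: power_mult_distrib) (simp add: power_mult_distrib[symmetric] algebra_simps)
  also have "\<dots> \<le> 2 ^ card J * (4 ^ n * (12 * real n * B) ^ n)"
  proof (rule mult_left_mono[OF mult_mono[OF _ power_mono]])
    show "(4::real) \<le> 4 ^ n" using n power_increasing[of 1 n "4::real"] by simp
    show "4 * real n * exp 1 * B \<le> 12 * real n * B" using mult_left_mono[OF exp_le, of "real n"] B by (simp add: mult_right_mono)
  qed (use B in auto)
  also have "\<dots> = 2 ^ card J * (48 * real n * B) ^ n"
  proof -
    have "4 * (12 * real n * B) = 48 * real n * B" by simp
    then show ?thesis by (simp only: power_mult_distrib[symmetric])
  qed
  finally show ?thesis .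
qed

lemma bessel:
  assumes g: "orthonormal J g" and f: "continuous_on (sphere 0 1) f"
  shows "(\<Sum>i\<in>J. (norm (ip f (g i)))\<^sup>2) \<le> (\<integral>x. (norm (f x))\<^sup>2 \<partial>sphere_measure)"
proof -
  define P where "P = (\<lambda>x. \<Sum>i\<in>J. ip f (g i) * g i x)"
  define s where "s = (\<Sum>i\<in>J. (norm (ip f (g i)))\<^sup>2)"
  have cg: "continuous_on (sphere 0 1) (g i)" if "i \<in> J" for i using g that by (simp add: orthonormal_def)
  have cP: "continuous_on (sphere 0 1) P" unfolding P_def by (intro continuous_intros cg)
  define d where "d = (\<lambda>x. f x + (-1) * P x)"
  have cd: "continuous_on (sphere 0 1) d" unfolding d_def by (intro continuous_intros f cP)
  have fP: "ip f P = of_real s"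
    unfolding P_def s_def of_real_sum complex_norm_square
    by (subst ip_sum_right[OF cg f]) (simp_all add: mult.commute)
  have PP: "ip P P = of_real s"
    unfolding P_def orthonormal_parseval[OF g] s_def of_real_sum complex_norm_square ..
  have Pf: "ip P f = of_real s" using ip_cnj[of f P] fP by simp
  have dP: "ip d P = 0" unfolding d_def using ip_diff_left[OF f cP cP] fP PP by simp
  then have "ip P d = 0" using ip_cnj[of d P] by simp
  moreover have "ip d d = ip f d - ip P d" unfolding d_def by (rule ip_diff_left[OF f cP cd[unfolded d_def]])
  moreover have "ip d f = ip f f - of_real s" unfolding d_def using ip_diff_left[OF f cP f] Pf by simp
  then have "ip f d = ip f f - of_real s" using ip_cnj[of d f] ip_cnj[of f f] by (metis complex_cnj_complex_of_real complex_cnj_diff)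
  ultimately have "of_real (\<integral>x. (norm (d x))\<^sup>2 \<partial>sphere_measure)
     = complex_of_real ((\<integral>x. (norm (f x))\<^sup>2 \<partial>sphere_measure) - s)"
    by (simp add: ip_self_real)
  then have "(\<integral>x. (norm (d x))\<^sup>2 \<partial>sphere_measure) = (\<integral>x. (norm (f x))\<^sup>2 \<partial>sphere_measure) - s"
    by (simp only: of_real_eq_iff)
  moreover have "(\<integral>x. (norm (d x))\<^sup>2 \<partial>sphere_measure) \<ge> 0" by (rule Bochner_Integration.integral_nonneg) simp
  ultimately show ?thesis by (simp add: s_def)
qed

text \<open>
  Take a combination, with independent signs, of an orthonormal basis of the solutions of the
  constraints. The norm of its coefficients is fixed. At each point the squares of the weighted basis
  functions sum, by Bessel's inequality, to at most the weighted kernel, so that Khintchine's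
  inequality bounds the mean of the weighted combination pointwise, and some choice of signs is
  no worse than the mean.
\<close>

lemma random_combination:
  fixes e :: "'y \<Rightarrow> complex ^ 'd::finite \<Rightarrow> complex" and w :: "'y \<Rightarrow> real" and a :: "nat \<Rightarrow> 'y \<Rightarrow> complex"
  assumes e: "orthonormal I e" and n: "n \<ge> 1" and B: "B > 0"
    and kernel: "\<And>x. x \<in> sphere 0 1 \<Longrightarrow> (\<Sum>y\<in>I. (w y * norm (e y x))\<^sup>2) \<le> B"
    and k: "k < card I"
  shows "\<exists>c. (\<forall>j<k. (\<Sum>y\<in>I. c y * a j y) = 0) \<and> (\<Sum>y\<in>I. (norm (c y))\<^sup>2) \<ge> real (card I - k) \<and>
     (\<integral>x. norm (\<Sum>y\<in>I. c y * of_real (w y) * e y x) ^ (2 * n) \<partial>sphere_measure)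
       \<le> (48 * real n * B) ^ n * measure sphere_measure (sphere 0 1 :: (complex ^ 'd) set)"
proof -
  define V where "V f \<longleftrightarrow> (\<exists>c. (\<forall>x\<in>sphere 0 1. f x = (\<Sum>y\<in>I. c y * e y x)) \<and> (\<forall>j<k. (\<Sum>y\<in>I. c y * a j y) = 0))" for f
  have fin: "finite I" and ce: "\<And>y. y \<in> I \<Longrightarrow> continuous_on (sphere 0 1) (e y)"
    using e by (auto simp: orthonormal_def)
  have V: "func_space V"
    unfolding func_space_def
  proof (intro conjI allI impI)
    fix f assume "V f"
    then obtain c where c: "\<And>x. x \<in> sphere 0 1 \<Longrightarrow> f x = (\<Sum>y\<in>I. c y * e y x)" unfolding V_def by blast
    have "continuous_on (sphere 0 1) (\<lambda>x. \<Sum>y\<in>I. c y * e y x)" by (intro continuous_intros ce)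
    then show "continuous_on (sphere 0 1) f" by (rule continuous_on_eq) (simp only: c)
  next
    show "V (\<lambda>x. 0)" unfolding V_def by (intro exI[of _ "\<lambda>_. 0"]) simp
  next
    fix f g assume "V f" "V g"
    then obtain c c' where "\<forall>x\<in>sphere 0 1. f x = (\<Sum>y\<in>I. c y * e y x)" "\<forall>j<k. (\<Sum>y\<in>I. c y * a j y) = 0"
       "\<forall>x\<in>sphere 0 1. g x = (\<Sum>y\<in>I. c' y * e y x)" "\<forall>j<k. (\<Sum>y\<in>I. c' y * a j y) = 0" unfolding V_def by blast
    then show "V (\<lambda>x. f x + g x)" unfolding V_def
      by (intro exI[of _ "\<lambda>y. c y + c' y"]) (simp add: distrib_right sum.distrib)
  next
    fix f b assume "V f"
    then obtain c where "\<forall>x\<in>sphere 0 1. f x = (\<Sum>y\<in>I. c y * e y x)" "\<forall>j<k. (\<Sum>y\<in>I. c y * a j y) = 0"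
      unfolding V_def by blast
    then show "V (\<lambda>x. b * f x)" unfolding V_def
      by (intro exI[of _ "\<lambda>y. b * c y"]) (simp add: mult.assoc flip: sum_distrib_left)
  qed
  have sp: "spans I e f" if "V f" for f using that unfolding V_def spans_def by blast
  from exists_orthonormal_basis[OF V fin sp]
  have "\<exists>(h::nat) (g :: nat \<Rightarrow> complex ^ 'd \<Rightarrow> complex). orthonormal {..<h} g \<and> (\<forall>i<h. V (g i)) \<and>
     (\<forall>f x. V f \<longrightarrow> (\<forall>i<h. ip f (g i) = 0) \<longrightarrow> x \<in> sphere 0 1 \<longrightarrow> f x = 0)" .
  then obtain h :: nat and g :: "nat \<Rightarrow> complex ^ 'd \<Rightarrow> complex" where hg: "orthonormal {..<h} g \<and> (\<forall>i<h. V (g i)) \<and>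
     (\<forall>f x. V f \<longrightarrow> (\<forall>i<h. ip f (g i) = 0) \<longrightarrow> x \<in> sphere 0 1 \<longrightarrow> f x = 0)"
    by (elim exE) (rule that)
  then have g: "orthonormal {..<h} g" "\<And>i. i < h \<Longrightarrow> V (g i)"
    and compl: "\<And>f x. V f \<Longrightarrow> \<forall>i<h. ip f (g i) = 0 \<Longrightarrow> x \<in> sphere 0 1 \<Longrightarrow> f x = 0" by blast+
  have cg: "continuous_on (sphere 0 1) (g i)" if "i < h" for i using g(1) that by (simp add: orthonormal_def)
  have h: "card I - k \<le> h"
  proof (rule ccontr)
    assume "\<not> ?thesis"
    then have less: "card ({..<k} <+> {..<h}) < card I" by (simp add: card_Plus)
    \<comment> \<open>The constraints, followed by orthogonality to the complete family of solutions.\<close>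
    define E where "E j y = (case j of Inl j \<Rightarrow> a j y | Inr i \<Rightarrow> ip (e y) (g i))" for j y
    obtain c where c: "\<exists>y\<in>I. c y \<noteq> 0" "\<And>j. j \<in> {..<k} <+> {..<h} \<Longrightarrow> (\<Sum>y\<in>I. c y * E j y) = 0"
      using underdetermined_system[OF _ fin less, of E] by auto
    define f where "f = (\<lambda>x. \<Sum>y\<in>I. c y * e y x)"
    have "\<forall>j<k. (\<Sum>y\<in>I. c y * a j y) = 0" using c(2)[of "Inl _"] by (auto simp: E_def)
    then have "V f" unfolding V_def f_def by blast
    moreover have "ip f (g i) = 0" if i: "i < h" for i
      unfolding f_def using c(2)[of "Inr i"] i by (subst ip_sum_left[OF ce cg[OF i]]) (auto simp: E_def)
    ultimately have f0: "f x = 0" if "x \<in> sphere 0 1" for x using compl that by blast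
    obtain y where y: "y \<in> I" "c y \<noteq> 0" using c(1) by blast
    have "c y = ip f (e y)" unfolding f_def using orthonormal_coeff[OF e y(1)] by simp
    also have "\<dots> = ip (\<lambda>x. 0) (e y)" using f0 by (intro ip_cong) auto
    finally show False using y(2) by (simp add: ip_def)
  qed
  have "\<forall>i\<in>{..<h}. \<exists>c. (\<forall>x\<in>sphere 0 1. g i x = (\<Sum>y\<in>I. c y * e y x)) \<and> (\<forall>j<k. (\<Sum>y\<in>I. c y * a j y) = 0)"
    using g(2) unfolding V_def by blast
  from bchoice[OF this] obtain C where
    C: "\<And>i x. i < h \<Longrightarrow> x \<in> sphere 0 1 \<Longrightarrow> g i x = (\<Sum>y\<in>I. C i y * e y x)"
       "\<And>i j. i < h \<Longrightarrow> j < k \<Longrightarrow> (\<Sum>y\<in>I. C i y * a j y) = 0" by blast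
  define F where "F i x = (\<Sum>y\<in>I. C i y * (of_real (w y) * e y x))" for i x
  have FB: "(\<Sum>i<h. (norm (F i x))\<^sup>2) \<le> B" if x: "x \<in> sphere 0 1" for x
  proof -
    \<comment> \<open>The weighted kernel function at \<open>x\<close>, whose inner products with the \<open>g i\<close> are the values \<open>F i x\<close>.\<close>
    define \<phi> where "\<phi> = (\<lambda>z. \<Sum>y\<in>I. cnj (of_real (w y) * e y x) * e y z)"
    have c\<phi>: "continuous_on (sphere 0 1) \<phi>" unfolding \<phi>_def by (intro continuous_intros ce)
    have "ip (g i) \<phi> = F i x" if "i < h" for i
    proof -
      have "ip (g i) \<phi> = ip (\<lambda>x. \<Sum>y\<in>I. C i y * e y x) \<phi>" by (rule ip_cong) (auto simp: C(1)[OF that])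
      also have "\<dots> = F i x" unfolding \<phi>_def orthonormal_parseval[OF e] F_def by simp
      finally show ?thesis .
    qed
    then have "norm (ip \<phi> (g i)) = norm (F i x)" if "i < h" for i
      using that ip_cnj[of "g i" \<phi>] by (metis complex_mod_cnj)
    then have "(\<Sum>i<h. (norm (F i x))\<^sup>2) = (\<Sum>i<h. (norm (ip \<phi> (g i)))\<^sup>2)" by simp
    also have "\<dots> \<le> (\<integral>x. (norm (\<phi> x))\<^sup>2 \<partial>sphere_measure)" by (rule bessel[OF g(1) c\<phi>])
    also have "\<dots> = (\<Sum>y\<in>I. (w y * norm (e y x))\<^sup>2)"
    proof -
      have "complex_of_real (\<integral>x. (norm (\<phi> x))\<^sup>2 \<partial>sphere_measure) = ip \<phi> \<phi>" by (simp add: ip_self_real)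
      also have "\<dots> = (\<Sum>y\<in>I. of_real ((norm (cnj (of_real (w y) * e y x)))\<^sup>2))"
        unfolding \<phi>_def orthonormal_parseval[OF e] complex_norm_square ..
      also have "\<dots> = complex_of_real (\<Sum>y\<in>I. (w y * norm (e y x))\<^sup>2)"
        by (simp add: norm_mult power_mult_distrib)
      finally show ?thesis by (simp only: of_real_eq_iff)
    qed
    also have "\<dots> \<le> B" by (rule kernel[OF x])
    finally show ?thesis .
  qed
  let ?\<Phi> = "\<lambda>T x. \<Sum>i<h. of_real (sgn_of T i) * F i x"
  let ?\<sigma> = "measure sphere_measure (sphere 0 1 :: (complex ^ 'd) set)"
  let ?int = "\<lambda>T. \<integral>x. norm (?\<Phi> T x) ^ (2 * n) \<partial>sphere_measure"
  have integ: "integrable sphere_measure (\<lambda>x. norm (?\<Phi> T x) ^ (2 * n))" for T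
    unfolding F_def by (intro integrable_sphere_continuous_real continuous_intros ce)
  have "(\<Sum>T\<in>Pow {..<h}. ?int T) = (\<integral>x. (\<Sum>T\<in>Pow {..<h}. norm (?\<Phi> T x) ^ (2 * n)) \<partial>sphere_measure)"
    by (intro Bochner_Integration.integral_sum[symmetric] integ)
  also have "\<dots> \<le> (\<integral>x. 2 ^ h * (48 * real n * B) ^ n \<partial>(sphere_measure :: (complex ^ 'd) measure))"
  proof (intro integral_mono)
    fix x :: "complex ^ 'd" assume "x \<in> space sphere_measure"
    then have "x \<in> sphere 0 1" by (simp add: space_sphere_measure)
    from khintchine_complex[OF _ n B FB[OF this]]
    show "(\<Sum>T\<in>Pow {..<h}. norm (?\<Phi> T x) ^ (2 * n)) \<le> 2 ^ h * (48 * real n * B) ^ n" by simp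
  qed (auto intro: integ)
  also have "\<dots> = 2 ^ h * ((48 * real n * B) ^ n * ?\<sigma>)" by (simp add: space_sphere_measure)
  also have "\<dots> = (\<Sum>T\<in>Pow {..<h}. (48 * real n * B) ^ n * ?\<sigma>)" by (simp add: card_Pow)
  finally have "\<exists>T\<in>Pow {..<h}. ?int T \<le> (48 * real n * B) ^ n * ?\<sigma>"
    by (meson Pow_not_empty finite_Pow_iff finite_lessThan not_le sum_strict_mono)
  then obtain T where T: "?int T \<le> (48 * real n * B) ^ n * ?\<sigma>" by blast
  define c where "c y = (\<Sum>i<h. of_real (sgn_of T i) * C i y)" for y
  have sumc: "(\<Sum>y\<in>I. c y * X y) = (\<Sum>i<h. of_real (sgn_of T i) * (\<Sum>y\<in>I. C i y * X y))" for X
    unfolding c_def sum_distrib_right sum_distrib_left by (subst sum.swap) (simp add: mult.assoc)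
  have 1: "\<forall>j<k. (\<Sum>y\<in>I. c y * a j y) = 0" unfolding sumc using C(2) by simp
  have "(\<Sum>y\<in>I. (norm (c y))\<^sup>2) = real h"
  proof -
    have "complex_of_real (\<Sum>y\<in>I. (norm (c y))\<^sup>2) = ip (\<lambda>x. \<Sum>y\<in>I. c y * e y x) (\<lambda>x. \<Sum>y\<in>I. c y * e y x)"
      unfolding orthonormal_parseval[OF e] of_real_sum complex_norm_square ..
    also have "\<dots> = ip (\<lambda>x. \<Sum>i<h. of_real (sgn_of T i) * g i x) (\<lambda>x. \<Sum>i<h. of_real (sgn_of T i) * g i x)"
      by (rule ip_cong) (auto simp: sumc C(1))
    also have "\<dots> = (\<Sum>i<h. of_real (sgn_of T i) * cnj (of_real (sgn_of T i)))"
      by (rule orthonormal_parseval[OF g(1)])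
    also have "\<dots> = (\<Sum>i<h. 1)" by (intro sum.cong) (auto simp: sgn_of_def)
    also have "\<dots> = complex_of_real (real h)" by simp
    finally show ?thesis by (simp only: of_real_eq_iff)
  qed
  then have 2: "(\<Sum>y\<in>I. (norm (c y))\<^sup>2) \<ge> real (card I - k)" using h by simp
  have "(\<Sum>y\<in>I. c y * of_real (w y) * e y x) = ?\<Phi> T x" for x
    unfolding F_def using sumc[of "\<lambda>y. of_real (w y) * e y x"] by (simp add: mult.assoc)
  then show ?thesis using 1 2 T by (intro exI[of _ c]) simp
qed

text \<open>
  The reproducing kernel only bounds the supremum by the \<open>L\<^sup>2\<close> norm; applied to a power of the
  polynomial it bounds it by a high \<open>L\<^sup>p\<close> norm, at the cost of a root of the dimension.
\<close>

lemma sup_le_high_norm: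
  fixes f :: "complex ^ 'd::finite \<Rightarrow> complex"
  assumes he: "harmonic_system h (e :: _ \<Rightarrow> complex ^ 'd \<Rightarrow> complex)" and f: "sphere_poly L f" and x: "x \<in> sphere 0 1"
  shows "norm (f x) ^ (2 * n) \<le> real (card (top_monomials (n * L) :: (('d \<Rightarrow> nat) \<times> ('d \<Rightarrow> nat)) set))
      / measure sphere_measure (sphere 0 1 :: (complex ^ 'd) set)
      * (\<integral>x. norm (f x) ^ (2 * n) \<partial>sphere_measure)"
proof -
  let ?g = "\<lambda>x. f x ^ n" and ?I = "harmonic_indices h (n * L)"
  have g: "sphere_poly (n * L) ?g" by (rule sphere_poly_power[OF f])
  have cg: "continuous_on (sphere 0 1) ?g" using g func_space_sphere_poly unfolding func_space_def by blast
  have on: "orthonormal ?I e" using he by (simp add: harmonic_system_def)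
  have "?g x = (\<Sum>y\<in>?I. ip ?g (e y) * e y x)" using he g x unfolding harmonic_system_def by blast
  then have "norm (?g x) \<le> (\<Sum>y\<in>?I. norm (ip ?g (e y)) * norm (e y x))"
    by (metis (no_types, lifting) norm_mult norm_sum sum.cong)
  then have "(norm (?g x))\<^sup>2 \<le> (\<Sum>y\<in>?I. norm (ip ?g (e y)) * norm (e y x))\<^sup>2"
    by (intro power_mono) auto
  also have "\<dots> \<le> (\<Sum>y\<in>?I. (norm (ip ?g (e y)))\<^sup>2) * (\<Sum>y\<in>?I. (norm (e y x))\<^sup>2)"
    by (rule Cauchy_Schwarz_ineq_sum)
  also have "\<dots> \<le> (\<integral>x. (norm (?g x))\<^sup>2 \<partial>sphere_measure) * (\<Sum>y\<in>?I. (norm (e y x))\<^sup>2)"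
    by (intro mult_right_mono bessel[OF on cg] sum_nonneg) auto
  also have "(\<Sum>y\<in>?I. (norm (e y x))\<^sup>2) = real (card (top_monomials (n * L) :: (('d \<Rightarrow> nat) \<times> ('d \<Rightarrow> nat)) set))
      / measure sphere_measure (sphere 0 1 :: (complex ^ 'd) set)"
    using he x unfolding harmonic_system_def by simp
  finally show ?thesis by (simp add: norm_power power_mult[symmetric] mult.commute)
qed

section \<open>Dimensions and the choice of the degree\<close>

text \<open>
  Enumerating the index type turns multiindices into lists of a fixed length and sum.
\<close>

lemma card_multiindices_total:
  "card {\<alpha> :: 'a::finite \<Rightarrow> nat. sum \<alpha> UNIV = m} = (m + CARD('a) - 1) choose m"
proof -
  obtain xs :: "'a list" where xs: "set xs = UNIV" "distinct xs" using finite_distinct_list[OF finite] by blast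
  have len: "length xs = CARD('a)" using xs distinct_card by metis
  have "bij_betw (\<lambda>\<alpha>. map \<alpha> xs) {\<alpha> :: 'a \<Rightarrow> nat. sum \<alpha> UNIV = m} {l. length l = CARD('a) \<and> sum_list l = m}"
  proof (rule bij_betwI')
    fix \<alpha> \<beta> :: "'a \<Rightarrow> nat"
    show "(map \<alpha> xs = map \<beta> xs) = (\<alpha> = \<beta>)" using xs(1) by (auto simp: map_eq_conv)
  next
    fix \<alpha> :: "'a \<Rightarrow> nat" assume "\<alpha> \<in> {\<alpha>. sum \<alpha> UNIV = m}"
    then show "map \<alpha> xs \<in> {l. length l = CARD('a) \<and> sum_list l = m}"
      using xs len by (simp add: sum_list_distinct_conv_sum_set)
  next
    fix l assume l: "l \<in> {l. length l = CARD('a) \<and> sum_list l = m}"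
    define \<alpha> where "\<alpha> x = (THE v. (x, v) \<in> set (zip xs l))" for x
    have "map \<alpha> xs = l"
    proof (rule nth_equalityI)
      show "length (map \<alpha> xs) = length l" using l len by simp
      fix i assume "i < length (map \<alpha> xs)"
      then have i: "i < length xs" "i < length l" using l len by auto
      have "\<alpha> (xs ! i) = l ! i" unfolding \<alpha>_def
        by (rule the_equality) (use i xs(2) in \<open>auto simp: in_set_zip nth_eq_iff_index_eq\<close>)
      then show "map \<alpha> xs ! i = l ! i" using i by simp
    qed
    moreover from this have "sum \<alpha> UNIV = m" using l xs sum_list_distinct_conv_sum_set[OF xs(2), of \<alpha>] by auto
    ultimately show "\<exists>\<alpha>\<in>{\<alpha>. sum \<alpha> UNIV = m}. l = map \<alpha> xs" by auto
  qed
  then show ?thesis using card_length_sum_list[of "CARD('a)" m] bij_betw_same_card by fastforce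
qed

lemma card_bimonomials:
  "card {x :: ('d::finite \<Rightarrow> nat) \<times> ('d \<Rightarrow> nat). sum (fst x) UNIV + sum (snd x) UNIV = l}
     = (l + (2 * CARD('d) - 1)) choose (2 * CARD('d) - 1)"
proof -
  have s: "sum (case_sum a b) (UNIV :: ('d + 'd) set) = sum a UNIV + sum b UNIV" for a b :: "'d \<Rightarrow> nat"
    by (simp add: UNIV_Plus_UNIV[symmetric] sum.Plus o_def del: UNIV_Plus_UNIV)
  have "bij_betw (\<lambda>x. case_sum (fst x) (snd x))
     {x :: ('d \<Rightarrow> nat) \<times> ('d \<Rightarrow> nat). sum (fst x) UNIV + sum (snd x) UNIV = l}
     {\<gamma> :: 'd + 'd \<Rightarrow> nat. sum \<gamma> UNIV = l}"
  proof (rule bij_betwI[where g = "\<lambda>\<gamma>. (\<gamma> \<circ> Inl, \<gamma> \<circ> Inr)"])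
    show "(\<lambda>\<gamma>. (\<gamma> \<circ> Inl, \<gamma> \<circ> Inr)) \<in> {\<gamma> :: 'd + 'd \<Rightarrow> nat. sum \<gamma> UNIV = l}
      \<rightarrow> {x. sum (fst x) UNIV + sum (snd x) UNIV = l}"
    proof (intro Pi_I CollectI)
      fix \<gamma> :: "'d + 'd \<Rightarrow> nat" assume "\<gamma> \<in> {\<gamma>. sum \<gamma> UNIV = l}"
      moreover have "case_sum (\<gamma> \<circ> Inl) (\<gamma> \<circ> Inr) = \<gamma>" by (auto simp: fun_eq_iff split: sum.split)
      ultimately show "sum (fst (\<gamma> \<circ> Inl, \<gamma> \<circ> Inr)) UNIV + sum (snd (\<gamma> \<circ> Inl, \<gamma> \<circ> Inr)) UNIV = l"
        using s[of "\<gamma> \<circ> Inl" "\<gamma> \<circ> Inr"] by simp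
    qed
  qed (auto simp: s fun_eq_iff split: sum.split)
  then have "card {x :: ('d \<Rightarrow> nat) \<times> ('d \<Rightarrow> nat). sum (fst x) UNIV + sum (snd x) UNIV = l}
      = card {\<gamma> :: 'd + 'd \<Rightarrow> nat. sum \<gamma> UNIV = l}"
    by (rule bij_betw_same_card)
  also have "\<dots> = (l + CARD('d + 'd) - 1) choose l" by (rule card_multiindices_total)
  also have "l + CARD('d + 'd) - 1 = l + (2 * CARD('d) - 1)"
    using zero_less_card_finite[where 'a='d] by simp
  also have "\<dots> choose l = (l + (2 * CARD('d) - 1)) choose (2 * CARD('d) - 1)"
    by (subst binomial_symmetric) auto
  finally show ?thesis .
qed

text \<open>
  The dimension of the space of restrictions to \<open>S\<^sup>D\<close> of polynomials of degree at most
  \<open>L\<close>; truncated subtraction gives the value \<open>1\<close> for \<open>L = 0\<close>.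
\<close>

definition poly_dim :: "nat \<Rightarrow> nat \<Rightarrow> nat" where
  "poly_dim D L = ((L + D) choose D) + ((L + D - 1) choose D)"

lemma card_top_monomials:
  "card (top_monomials L :: (('d::finite \<Rightarrow> nat) \<times> ('d \<Rightarrow> nat)) set) = poly_dim (2 * CARD('d) - 1) L"
proof -
  let ?M = "\<lambda>l. {x :: ('d \<Rightarrow> nat) \<times> ('d \<Rightarrow> nat). sum (fst x) UNIV + sum (snd x) UNIV = l}"
  have fin: "finite (?M l)" for l
    by (rule finite_subset[OF _ finite_top_monomials[of l]]) (auto simp: top_monomials_def)
  show ?thesis
  proof (cases L)
    case 0
    have "top_monomials L = ?M 0" using 0 by (auto simp: top_monomials_def)
    then have "card (top_monomials L :: (('d \<Rightarrow> nat) \<times> ('d \<Rightarrow> nat)) set) = (0 + (2 * CARD('d) - 1)) choose (2 * CARD('d) - 1)"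
      by (simp only: card_bimonomials)
    moreover obtain D where D: "2 * CARD('d) - 1 = Suc D"
      using zero_less_card_finite[where 'a='d] by (cases "2 * CARD('d) - 1") linarith+
    ultimately show ?thesis unfolding poly_dim_def D 0 by simp
  next
    case (Suc l)
    have "top_monomials L = ?M L \<union> ?M l" using Suc by (auto simp: top_monomials_def)
    also have "card \<dots> = card (?M L) + card (?M l)"
      using Suc by (intro card_Un_disjoint fin) auto
    finally show ?thesis using Suc by (simp add: card_bimonomials poly_dim_def)
  qed
qed

lemma binomial_lower: "real (Suc L) ^ D \<le> fact D * real ((L + D) choose D)"
proof (induction D)
  case (Suc D)
  have "real (Suc L) ^ Suc D \<le> real (L + Suc D) * (fact D * real ((L + D) choose D))"
    unfolding power_Suc using Suc by (intro mult_mono) auto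
  also have "\<dots> = fact D * real (Suc (L + D) * ((L + D) choose D))" by (simp add: algebra_simps)
  also have "Suc (L + D) * ((L + D) choose D) = Suc D * (Suc (L + D) choose Suc D)"
    by (rule Suc_times_binomial[symmetric])
  also have "fact D * real (Suc D * (Suc (L + D) choose Suc D)) = fact (Suc D) * real ((L + Suc D) choose Suc D)"
    by (simp add: algebra_simps)
  finally show ?case .
qed simp

text \<open>
  The leading constant \<open>2 / D!\<close> is sharp; it becomes the constant in the exponent of the
  final estimate.
\<close>

lemma poly_dim_lower: "D \<ge> 1 \<Longrightarrow> 2 * real L ^ D \<le> fact D * real (poly_dim D L)"
proof (cases L)
  case (Suc l)
  have "real L ^ D \<le> real (Suc L) ^ D" by (intro power_mono) auto
  then show ?thesis using binomial_lower[of L D] binomial_lower[of l D] Suc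
    by (simp add: poly_dim_def algebra_simps)
qed (auto simp: power_0_left)

lemma poly_dim_upper: "real (poly_dim D L) \<le> 2 * real (L + D) ^ D"
proof -
  have b: "real (m choose D) \<le> real (L + D) ^ D" if "m \<le> L + D" for m
  proof (cases "D \<le> m")
    case True
    have "m choose D \<le> m ^ D" using True by (rule binomial_le_pow)
    also have "\<dots> \<le> (L + D) ^ D" using that by (rule power_mono) simp
    finally show ?thesis by (metis of_nat_le_iff of_nat_power)
  qed (simp add: binomial_eq_0)
  show ?thesis using b[of "L + D"] b[of "L + D - 1"] by (simp add: poly_dim_def)
qed

lemma poly_dim_Suc: "poly_dim (Suc E) (Suc l) = poly_dim (Suc E) l + ((Suc l + E) choose E) + ((l + E) choose E)"
  by (simp add: poly_dim_def)

lemma poly_dim_increment_lower: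
  "real (poly_dim (Suc E) N) + real b * (real N ^ E / fact E) \<le> real (poly_dim (Suc E) (N + b))"
proof (induction b)
  case (Suc b)
  have "real N ^ E \<le> real (Suc (Suc (N + b))) ^ E" by (intro power_mono) auto
  also have "\<dots> \<le> fact E * real ((Suc (N + b) + E) choose E)" by (rule binomial_lower)
  finally have "real N ^ E / fact E \<le> real ((Suc (N + b) + E) choose E)" by (simp add: field_simps)
  moreover have "real (poly_dim (Suc E) (N + Suc b)) \<ge> real (poly_dim (Suc E) (N + b)) + real ((Suc (N + b) + E) choose E)"
    unfolding add_Suc_right poly_dim_Suc[of E "N + b"] by (simp del: binomial_Suc_Suc)
  moreover have "real (Suc b) * (real N ^ E / fact E) = real b * (real N ^ E / fact E) + real N ^ E / fact E"
    by (simp only: of_nat_Suc distrib_right mult_1 add.commute)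
  ultimately show ?case using Suc by linarith
qed simp

lemma poly_dim_increment_upper:
  assumes "Suc l \<le> M"
  shows "real (poly_dim (Suc E) (Suc l)) - real (poly_dim (Suc E) l) \<le> 2 * real (M + E) ^ E"
proof -
  have b: "real ((m + E) choose E) \<le> real (M + E) ^ E" if "m \<le> M" for m
  proof -
    have "(m + E) choose E \<le> (m + E) ^ E" by (rule binomial_le_pow) simp
    also have "\<dots> \<le> (M + E) ^ E" using that by (intro power_mono) auto
    finally show ?thesis by (metis of_nat_le_iff of_nat_power)
  qed
  show ?thesis unfolding poly_dim_Suc using b[of "Suc l"] b[of l] assms by (simp del: binomial_Suc_Suc)
qed

lemma powr_tangent:
  fixes x r :: real
  assumes "x \<ge> 0" "0 < r" "r \<le> 1"
  shows "x powr r \<le> 1 + r * (x - 1)"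
proof (cases "x = 0")
  case False
  then show ?thesis
    using Youngs_inequality_0[of r "1 - r" x 1] assms by (simp add: algebra_simps)
qed (use assms in auto)

lemma powr_add_one_le:
  fixes t r :: real
  assumes "t > 0" "0 < r" "r \<le> 1"
  shows "(t + 1) powr r \<le> t powr r + 1"
proof -
  have "(t + 1) powr r = (t + 1) powr (r - 1) * (t + 1)"
    using assms powr_add[of "t + 1" "r - 1" 1] by simp
  also have "\<dots> = (t + 1) powr (r - 1) * t + (t + 1) powr (r - 1)" by (simp add: algebra_simps)
  also have "\<dots> \<le> t powr (r - 1) * t + 1"
  proof (intro add_mono mult_right_mono)
    show "(t + 1) powr (r - 1) \<le> t powr (r - 1)" using assms by (intro powr_mono2') auto
    have "(t + 1) powr (r - 1) \<le> (t + 1) powr 0" using assms by (intro powr_mono) auto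
    then show "(t + 1) powr (r - 1) \<le> 1" using assms by simp
  qed (use assms in auto)
  also have "t powr (r - 1) * t = t powr r"
    using assms powr_add[of t "r - 1" 1] by simp
  finally show ?thesis .
qed

text \<open>
  By concavity of \<open>x\<^sup>r\<close> the terms decrease from the last one at least like a geometric
  series with ratio \<open>exp (- u)\<close>, where \<open>1 / u\<close> is of the order \<open>M\<^sup>1\<^sup>-\<^sup>r\<close>.
\<close>

lemma weighted_geometric_sum:
  fixes \<gamma> r :: real and M :: nat
  assumes \<gamma>: "\<gamma> > 0" and r: "0 < r" "r \<le> 1" and M: "M \<ge> 1"
  shows "(\<Sum>l=1..M. exp (2 * \<gamma> * real l powr r))
     \<le> exp (2 * \<gamma> * real M powr r) * (1 + real M powr (1 - r) / (2 * \<gamma> * r))"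
proof -
  define u where "u = 2 * \<gamma> * r * real M powr r / real M"
  have u: "u > 0" using \<gamma> r M by (simp add: u_def)
  have "exp (2 * \<gamma> * real l powr r) \<le> exp (2 * \<gamma> * real M powr r) * exp (- u) ^ (M - l)" if "l \<le> M" for l
  proof -
    have "real l powr r = (real M * (real l / real M)) powr r" using M by simp
    also have "\<dots> = real M powr r * (real l / real M) powr r" by (rule powr_mult)
    also have "\<dots> \<le> real M powr r * (1 + r * (real l / real M - 1))"
      by (intro mult_left_mono powr_tangent) (use r in auto)
    finally have "2 * \<gamma> * real l powr r \<le> 2 * \<gamma> * (real M powr r * (1 + r * (real l / real M - 1)))"
      using \<gamma> by (intro mult_left_mono) auto
    also have "\<dots> = 2 * \<gamma> * real M powr r + real (M - l) * (- u)"
      using M that by (simp add: u_def of_nat_diff field_simps)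
    finally have "exp (2 * \<gamma> * real l powr r) \<le> exp (2 * \<gamma> * real M powr r + real (M - l) * (- u))"
      by (simp only: exp_le_cancel_iff)
    then show ?thesis by (simp only: exp_add exp_of_nat_mult)
  qed
  then have "(\<Sum>l=1..M. exp (2 * \<gamma> * real l powr r)) \<le> (\<Sum>l=1..M. exp (2 * \<gamma> * real M powr r) * exp (- u) ^ (M - l))"
    by (intro sum_mono) auto
  also have "\<dots> = exp (2 * \<gamma> * real M powr r) * (\<Sum>l=1..M. exp (- u) ^ (M - l))" by (simp add: sum_distrib_left)
  also have "(\<Sum>l=1..M. exp (- u) ^ (M - l)) = (\<Sum>j<M. exp (- u) ^ j)"
    by (rule sum.reindex_bij_witness[of _ "\<lambda>j. M - j" "\<lambda>l. M - l"]) auto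
  also have "\<dots> \<le> 1 + 1 / u"
  proof -
    have q: "exp (- u) < 1" using u by simp
    have "(\<Sum>j<M. exp (- u) ^ j) \<le> suminf (\<lambda>j. exp (- u) ^ j)"
      using q by (intro sum_le_suminf summable_geometric) auto
    also have "\<dots> = 1 / (1 - exp (- u))" using q by (intro suminf_geometric) simp
    also have "\<dots> \<le> 1 + 1 / u"
    proof -
      have "(1 + u) * exp (- u) \<le> exp u * exp (- u)" using exp_ge_add_one_self[of u] by (intro mult_right_mono) auto
      then have "(1 + u) * exp (- u) \<le> 1" by (simp add: exp_minus)
      then have "u \<le> (1 + u) * (1 - exp (- u))" by (simp add: algebra_simps)
      then show ?thesis using u q by (simp add: field_simps)
    qed
    finally show ?thesis .
  qed
  also have "1 / u = real M powr (1 - r) / (2 * \<gamma> * r)"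
    using M by (simp add: u_def powr_diff)
  finally show ?thesis by simp
qed

text \<open>
  With \<open>b\<close> of the order \<open>N\<^sup>1\<^sup>-\<^sup>r\<close>, passing from degree \<open>N\<close> to \<open>M = N + b\<close> changes
  \<open>M\<^sup>r\<close> by a bounded amount, while the \<open>b\<close> new levels have a total dimension comparable
  to the weighted dimension of all levels, divided by the largest weight.
\<close>

lemma degree_choice:
  fixes \<gamma> r :: real and E :: nat
  assumes \<gamma>: "\<gamma> > 0" and r: "0 < r" "r \<le> 1" and E: "E \<ge> 1"
  defines "D \<equiv> Suc E"
  shows "\<exists>C>0. \<forall>k\<ge>1. \<exists>M\<ge>1. real M \<le> C * real k \<and> k < poly_dim D M \<and>
    1 + (\<Sum>l=1..M. exp (2 * \<gamma> * real l powr r) * (real (poly_dim D l) - real (poly_dim D (l - 1))))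
     \<le> C * (exp (\<gamma> * (fact D / 2) powr (r / real D) * real k powr (r / real D)))\<^sup>2 * real (poly_dim D M - k)"
proof -
  define A where "A = (1 + 2 * real (2 + E) ^ E * (1 + 1 / (\<gamma> * r))) * exp (6 * \<gamma>) * fact E"
  define C where "C = A + fact D + 2"
  have A: "A > 0" unfolding A_def using \<gamma> r by (intro mult_pos_pos add_pos_nonneg) auto
  have "fact D > (0::real)" by simp
  then have C: "C > 0" "A \<le> C" "fact D + 2 \<le> C" using A unfolding C_def by linarith+
  have "\<exists>M\<ge>1. real M \<le> C * real k \<and> k < poly_dim D M \<and>
    1 + (\<Sum>l=1..M. exp (2 * \<gamma> * real l powr r) * (real (poly_dim D l) - real (poly_dim D (l - 1))))
     \<le> C * (exp (\<gamma> * (fact D / 2) powr (r / real D) * real k powr (r / real D)))\<^sup>2 * real (poly_dim D M - k)"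
    if k: "k \<ge> 1" for k
  proof -
    define x where "x = real k * fact D / 2"
    have "fact 2 \<le> (fact D :: real)" unfolding D_def using E by (intro fact_mono) auto
    then have fD: "(fact D :: real) \<ge> 2" by (simp add: numeral_2_eq_2)
    have "1 * 2 \<le> real k * fact D" using k fD by (intro mult_mono) auto
    then have x: "x \<ge> 1" by (simp add: x_def)
    define t where "t = x powr (1 / real D)"
    have t: "t \<ge> 1" "t \<le> x" "t ^ D = x"
    proof -
      show "t \<ge> 1" unfolding t_def using x by (intro ge_one_powr_ge_zero) auto
      show "t \<le> x" unfolding t_def using x powr_mono[of "1 / real D" 1 x] by (simp add: D_def)
      have "t > 0" unfolding t_def using x by simp
      then have "t ^ D = t powr real D" by (simp add: powr_realpow)
      also have "\<dots> = x powr (1 / real D * real D)" unfolding t_def powr_powr ..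
      also have "\<dots> = x" using x by (simp add: D_def)
      finally show "t ^ D = x" .
    qed
    \<comment> \<open>By the lower bound for the dimension, \<open>t \<le> N\<close> suffices for \<open>k \<le> poly_dim D N\<close>.\<close>
    define N where "N = nat \<lfloor>t\<rfloor> + 1"
    have N: "N \<ge> 1" "t \<le> real N" "real N \<le> t + 1" unfolding N_def using t by linarith+
    define p where "p = real N powr (1 - r)"
    have p: "p \<ge> 1" "p \<le> real N"
      unfolding p_def using N r by (auto intro!: ge_one_powr_ge_zero powr_le_one_le simp: powr_mono[of "1 - r" 1 "real N", simplified])
    define b where "b = nat \<lceil>p\<rceil>"
    have b: "p \<le> real b" "real b \<le> p + 1" "1 \<le> b" "b \<le> N" unfolding b_def using p by linarith+
    define M where "M = N + b"
    have M: "M \<ge> 1" "real M \<le> 2 * real N" using N b by (auto simp: M_def)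
    have "real M \<le> 2 * real N" by (rule M(2))
    also have "\<dots> \<le> 2 * (t + 1)" by (rule mult_left_mono[OF N(3)]) simp
    also have "\<dots> \<le> 2 * (x + 1)" using t(2) by simp
    also have "\<dots> \<le> (fact D + 2) * real k" using k by (simp add: x_def algebra_simps)
    also have "\<dots> \<le> C * real k" using C(3) by (intro mult_right_mono) auto
    finally have MC: "real M \<le> C * real k" .
    have "real k * fact D = 2 * t ^ D" by (simp add: t x_def)
    also have "\<dots> \<le> 2 * real N ^ D" using N t by (intro mult_left_mono power_mono) auto
    also have "\<dots> \<le> fact D * real (poly_dim D N)" by (rule poly_dim_lower) (simp add: D_def)
    finally have kN: "real k \<le> real (poly_dim D N)" by (simp add: mult.commute)
    define F where "F = real N ^ E / fact E"
    have F: "F > 0" using N by (simp add: F_def)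
    have inc: "real k + real b * F \<le> real (poly_dim D M)"
      using poly_dim_increment_lower[of E N b] kN by (simp add: D_def M_def F_def)
    moreover have "real b * F > 0" using b F by simp
    ultimately have kM: "k < poly_dim D M" by linarith
    have diff: "real b * F \<le> real (poly_dim D M - k)" using inc kM by (simp add: of_nat_diff)
    define T where "T = exp (\<gamma> * (fact D / 2) powr (r / real D) * real k powr (r / real D))"
    have tr: "t powr r = (fact D / 2) powr (r / real D) * real k powr (r / real D)"
      unfolding t_def x_def by (simp add: powr_powr powr_mult[symmetric] mult.commute)
    have "real N * (1 + real b / real N) = real M" using N(1) by (simp add: M_def distrib_left)
    then have "real M powr r = (real N * (1 + real b / real N)) powr r" by (simp only:)
    also have "\<dots> = real N powr r * (1 + real b / real N) powr r" by (rule powr_mult)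
    also have "\<dots> \<le> real N powr r * (1 + r * (1 + real b / real N - 1))"
      by (intro mult_left_mono powr_tangent) (use r in auto)
    also have "\<dots> = real N powr r + r * (real b * (real N powr r / real N))" by (simp add: algebra_simps)
    also have "\<dots> \<le> real N powr r + 1 * 2"
    proof (intro add_left_mono mult_mono)
      have Np: "real N powr r / real N \<le> 1"
        using N r powr_mono[of r 1 "real N"] by simp
      have "p * (real N powr r / real N) = 1"
        unfolding p_def using N by (simp add: powr_add[symmetric])
      have "real b * (real N powr r / real N) \<le> (p + 1) * (real N powr r / real N)"
        using b by (intro mult_right_mono) auto
      also have "\<dots> = 1 + real N powr r / real N"
        unfolding distrib_right by (simp only: \<open>p * (real N powr r / real N) = 1\<close> mult_1)
      also have "\<dots> \<le> 2" using Np by simp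
      finally show "real b * (real N powr r / real N) \<le> 2" .
    qed (use r in auto)
    also have "real N powr r \<le> (t + 1) powr r" using N t r by (intro powr_mono2) auto
    also have "\<dots> \<le> t powr r + 1" using t r by (intro powr_add_one_le) auto
    finally have Mr: "real M powr r \<le> t powr r + 3" by simp
    have eM: "exp (2 * \<gamma> * real M powr r) \<le> exp (6 * \<gamma>) * T\<^sup>2"
    proof -
      have "2 * \<gamma> * real M powr r \<le> 2 * \<gamma> * (t powr r + 3)" using Mr \<gamma> by (intro mult_left_mono) auto
      then have "exp (2 * \<gamma> * real M powr r) \<le> exp (6 * \<gamma> + (\<gamma> * t powr r + \<gamma> * t powr r))"
        by (simp add: algebra_simps)
      also have "\<dots> = exp (6 * \<gamma>) * T\<^sup>2" by (simp only: exp_add T_def tr power2_eq_square mult.assoc)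
      finally show ?thesis .
    qed
    have "(\<Sum>l=1..M. exp (2 * \<gamma> * real l powr r) * (real (poly_dim D l) - real (poly_dim D (l - 1))))
      \<le> (\<Sum>l=1..M. exp (2 * \<gamma> * real l powr r) * (2 * real (M + E) ^ E))"
    proof (intro sum_mono mult_left_mono)
      fix l assume "l \<in> {1..M}"
      then obtain l' where "l = Suc l'" "Suc l' \<le> M" by (cases l) auto
      then show "real (poly_dim D l) - real (poly_dim D (l - 1)) \<le> 2 * real (M + E) ^ E"
        using poly_dim_increment_upper[of l' M E] by (simp add: D_def)
    qed auto
    also have "\<dots> = (2 * real (M + E) ^ E) * (\<Sum>l=1..M. exp (2 * \<gamma> * real l powr r))"
      by (simp add: sum_distrib_left mult.commute)
    also have "\<dots> \<le> (2 * (real (2 + E) * real N) ^ E) * ((exp (6 * \<gamma>) * T\<^sup>2) * (real b * (1 + 1 / (\<gamma> * r))))"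
    proof (intro mult_mono power_mono)
      have "real E * 1 \<le> real E * real N" using N(1) by (intro mult_left_mono) auto
      then have "real (M + E) \<le> 2 * real N + real E * real N" using M(2) by simp
      then show "real (M + E) \<le> real (2 + E) * real N" by (simp add: algebra_simps)
      have "real M powr (1 - r) \<le> (2 * real N) powr (1 - r)" using M r by (intro powr_mono2) auto
      also have "\<dots> = 2 powr (1 - r) * p" unfolding p_def by (rule powr_mult)
      also have "\<dots> \<le> 2 * real b" using b p r powr_mono[of "1 - r" 1 "2::real"] by (intro mult_mono) auto
      finally have "real M powr (1 - r) / (2 * \<gamma> * r) \<le> 2 * real b / (2 * \<gamma> * r)"
        using \<gamma> r by (intro divide_right_mono) auto
      then have "1 + real M powr (1 - r) / (2 * \<gamma> * r) \<le> real b * (1 + 1 / (\<gamma> * r))"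
        using b by (simp add: algebra_simps)
      then have "exp (2 * \<gamma> * real M powr r) * (1 + real M powr (1 - r) / (2 * \<gamma> * r))
         \<le> (exp (6 * \<gamma>) * T\<^sup>2) * (real b * (1 + 1 / (\<gamma> * r)))"
        using eM \<gamma> r by (intro mult_mono) auto
      then show "(\<Sum>l=1..M. exp (2 * \<gamma> * real l powr r)) \<le> (exp (6 * \<gamma>) * T\<^sup>2) * (real b * (1 + 1 / (\<gamma> * r)))"
        using weighted_geometric_sum[OF \<gamma> r M(1)] by linarith
    qed (auto intro: sum_nonneg)
    also have "\<dots> = 2 * real (2 + E) ^ E * (1 + 1 / (\<gamma> * r)) * exp (6 * \<gamma>) * fact E * (T\<^sup>2 * (real b * F))"
    proof -
      have "real N ^ E = fact E * F" by (simp add: F_def)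
      then show ?thesis
        unfolding power_mult_distrib[of "real (2 + E)" "real N"] by (simp only: mult_ac)
    qed
    finally have 1: "(\<Sum>l=1..M. exp (2 * \<gamma> * real l powr r) * (real (poly_dim D l) - real (poly_dim D (l - 1))))
       \<le> 2 * real (2 + E) ^ E * (1 + 1 / (\<gamma> * r)) * exp (6 * \<gamma>) * fact E * (T\<^sup>2 * (real b * F))" .
    have 2: "1 \<le> exp (6 * \<gamma>) * fact E * (T\<^sup>2 * (real b * F))"
    proof -
      have "1 \<le> T" unfolding T_def using \<gamma> by simp
      then have "1 \<le> T\<^sup>2" by (simp add: one_le_power)
      moreover have "1 \<le> exp (6 * \<gamma>)" using \<gamma> by simp
      moreover have "1 \<le> real N ^ E" using N by (intro one_le_power) auto
      moreover have "1 \<le> real b" using b by simp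
      ultimately have "1 * (1 * (1 * 1)) \<le> exp (6 * \<gamma>) * (T\<^sup>2 * (real b * real N ^ E))"
        by (intro mult_mono) auto
      then show ?thesis by (simp add: F_def field_simps)
    qed
    have "1 + (\<Sum>l=1..M. exp (2 * \<gamma> * real l powr r) * (real (poly_dim D l) - real (poly_dim D (l - 1))))
       \<le> A * (T\<^sup>2 * (real b * F))"
      using add_mono[OF 2 1] by (simp add: A_def algebra_simps)
    also have "\<dots> \<le> C * (T\<^sup>2 * real (poly_dim D M - k))"
      using C A diff F b by (intro mult_mono mult_left_mono) auto
    finally show ?thesis using M(1) MC kM by (auto simp: T_def mult.assoc intro!: exI[of _ M])
  qed
  then show ?thesis using C(1) by blast
qed

section \<open>Polynomials with small weighted norm\<close>

definition level :: "nat \<times> nat \<times> nat \<Rightarrow> nat" where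
  "level y = fst y + fst (snd y)"

text \<open>
  The kernel of a single level is the difference of two kernels that are constant on the diagonal.
\<close>

lemma weighted_kernel:
  fixes e :: "nat \<times> nat \<times> nat \<Rightarrow> complex ^ 'd::finite \<Rightarrow> complex" and w :: "nat \<Rightarrow> real"
  assumes he: "harmonic_system h e" and x: "x \<in> sphere 0 1"
  defines "D \<equiv> 2 * CARD('d) - 1"
  shows "(\<Sum>y\<in>harmonic_indices h M. (w (level y) * norm (e y x))\<^sup>2) * measure sphere_measure (sphere 0 1 :: (complex ^ 'd) set)
    = (w 0)\<^sup>2 + (\<Sum>l=1..M. (w l)\<^sup>2 * (real (poly_dim D l) - real (poly_dim D (l - 1))))"
proof -
  let ?\<sigma> = "measure sphere_measure (sphere 0 1 :: (complex ^ 'd) set)"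
  have \<sigma>: "?\<sigma> > 0" by (rule sphere_measure_pos)
  have K: "(\<Sum>y\<in>harmonic_indices h L. (norm (e y x))\<^sup>2) * ?\<sigma> = real (poly_dim D L)" for L
    using he x \<sigma> unfolding harmonic_system_def D_def by (simp add: card_top_monomials)
  have lev: "(\<Sum>y\<in>J. (w (level y) * norm (e y x))\<^sup>2) = (w l)\<^sup>2 * (\<Sum>y\<in>J. (norm (e y x))\<^sup>2)"
    if "\<And>y. y \<in> J \<Longrightarrow> level y = l" for J l
    using that by (simp add: sum_distrib_left power_mult_distrib)
  show ?thesis
  proof (induction M)
    case 0
    have "poly_dim D 0 = 1"
    proof -
      obtain E where "D = Suc E"
        using zero_less_card_finite[where 'a='d] unfolding D_def by (cases "2 * CARD('d) - 1") linarith+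
      then show ?thesis by (simp add: poly_dim_def)
    qed
    moreover have "(\<Sum>y\<in>harmonic_indices h 0. (w (level y) * norm (e y x))\<^sup>2)
        = (w 0)\<^sup>2 * (\<Sum>y\<in>harmonic_indices h 0. (norm (e y x))\<^sup>2)"
      by (rule lev) (auto simp: harmonic_indices_def level_def)
    ultimately show ?case using K[of 0] by (simp add: mult.assoc)
  next
    case (Suc M)
    let ?J = "harmonic_indices h (Suc M) - harmonic_indices h M"
    have sub: "harmonic_indices h M \<subseteq> harmonic_indices h (Suc M)" by (auto simp: harmonic_indices_def)
    have split: "(\<Sum>y\<in>harmonic_indices h (Suc M). F y) = (\<Sum>y\<in>?J. F y) + (\<Sum>y\<in>harmonic_indices h M. F y)"
      for F :: "_ \<Rightarrow> real" by (rule sum.subset_diff[OF sub]) simp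
    have "(\<Sum>y\<in>?J. (w (level y) * norm (e y x))\<^sup>2) = (w (Suc M))\<^sup>2 * (\<Sum>y\<in>?J. (norm (e y x))\<^sup>2)"
      by (rule lev) (auto simp: harmonic_indices_def level_def)
    moreover have "(\<Sum>y\<in>?J. (norm (e y x))\<^sup>2) * ?\<sigma> = real (poly_dim D (Suc M)) - real (poly_dim D M)"
      using K[of "Suc M"] K[of M] split[of "\<lambda>y. (norm (e y x))\<^sup>2"] by (simp add: algebra_simps)
    ultimately have "(\<Sum>y\<in>?J. (w (level y) * norm (e y x))\<^sup>2) * ?\<sigma>
        = (w (Suc M))\<^sup>2 * (real (poly_dim D (Suc M)) - real (poly_dim D M))"
      by (simp add: mult.assoc)
    then show ?case using Suc split[of "\<lambda>y. (w (level y) * norm (e y x))\<^sup>2"]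
      by (simp add: distrib_right)
  qed
qed

definition growth :: "nat \<Rightarrow> real \<Rightarrow> real \<Rightarrow> nat \<Rightarrow> real" where
  "growth d \<gamma> r k = exp (R_star d \<gamma> r * real k powr (r / real (2 * d - 1)))"

definition wexp :: "real \<Rightarrow> real \<Rightarrow> nat \<times> nat \<times> nat \<Rightarrow> real" where
  "wexp \<gamma> r y = exp (\<gamma> * real (level y) powr r)"

abbreviation wsum where
  "wsum \<gamma> r h e M c x \<equiv> (\<Sum>y\<in>harmonic_indices h M. c y * of_real (wexp \<gamma> r y) * e y x)"

abbreviation unit_solution where
  "unit_solution I k a c \<equiv> (\<forall>j<k. (\<Sum>y\<in>I. c y * a j y) = (0::complex)) \<and> (\<Sum>y\<in>I. (norm (c y))\<^sup>2) = (1::real)"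

text \<open>
  The constraints are those of orthogonality to a subspace of dimension \<open>k\<close>; the weights
  are the inverse multipliers. The constant does not depend on \<open>n\<close>, so that \<open>n\<close> may
  grow with \<open>k\<close>.
\<close>

lemma exists_small_weighted_polynomial:
  fixes e :: "nat \<times> nat \<times> nat \<Rightarrow> complex ^ 'd::finite \<Rightarrow> complex" and \<gamma> r :: real
  assumes he: "harmonic_system h e" and d: "CARD('d) \<ge> 2" and \<gamma>: "\<gamma> > 0" and r: "0 < r" "r \<le> 1"
  shows "\<exists>C>0. \<forall>k\<ge>1. \<exists>M. real M \<le> C * real k \<and> (\<forall>n\<ge>1. \<forall>a. \<exists>c.
     unit_solution (harmonic_indices h M) k a c \<and>
     (\<integral>x. norm (wsum \<gamma> r h e M c x) ^ (2 * n) \<partial>sphere_measure)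
       \<le> (C * real n * (growth CARD('d) \<gamma> r k)\<^sup>2) ^ n)"
proof -
  let ?\<sigma> = "measure sphere_measure (sphere 0 1 :: (complex ^ 'd) set)"
  have \<sigma>: "?\<sigma> > 0" by (rule sphere_measure_pos)
  define E where "E = 2 * CARD('d) - 2"
  have E: "E \<ge> 1" "2 * CARD('d) - 1 = Suc E" using d by (auto simp: E_def)
  obtain C where C: "C > 0" and ch: "\<And>k. k \<ge> 1 \<Longrightarrow> \<exists>M\<ge>1. real M \<le> C * real k \<and> k < poly_dim (Suc E) M \<and>
    1 + (\<Sum>l=1..M. exp (2 * \<gamma> * real l powr r) * (real (poly_dim (Suc E) l) - real (poly_dim (Suc E) (l - 1))))
     \<le> C * (exp (\<gamma> * (fact (Suc E) / 2) powr (r / real (Suc E)) * real k powr (r / real (Suc E))))\<^sup>2 * real (poly_dim (Suc E) M - k)"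
    using degree_choice[OF \<gamma> r E(1)] by blast
  define C' where "C' = C + 48 * C * (1 + ?\<sigma>) / ?\<sigma>"
  have C': "C' > 0" "C \<le> C'" "48 * C * (1 + ?\<sigma>) / ?\<sigma> \<le> C'" using C \<sigma> by (auto simp: C'_def intro: add_pos_nonneg)
  have main: "\<exists>M. real M \<le> C' * real k \<and> (\<forall>n\<ge>1. \<forall>a. \<exists>c.
     unit_solution (harmonic_indices h M) k a c \<and>
     (\<integral>x. norm (wsum \<gamma> r h e M c x) ^ (2 * n) \<partial>sphere_measure)
       \<le> (C' * real n * (growth CARD('d) \<gamma> r k)\<^sup>2) ^ n)"
    if k: "k \<ge> 1" for k
  proof -
    define G where "G = growth CARD('d) \<gamma> r k"
    have G': "G = exp (\<gamma> * (fact (Suc E) / 2) powr (r / real (Suc E)) * real k powr (r / real (Suc E)))"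
      unfolding G_def growth_def R_star_def E(2) ..
    obtain M where M: "real M \<le> C * real k" "k < poly_dim (Suc E) M"
      "1 + (\<Sum>l=1..M. exp (2 * \<gamma> * real l powr r) * (real (poly_dim (Suc E) l) - real (poly_dim (Suc E) (l - 1))))
         \<le> C * G\<^sup>2 * real (poly_dim (Suc E) M - k)"
      using ch[OF k] unfolding G' by blast
    let ?I = "harmonic_indices h M"
    define m where "m = real (poly_dim (Suc E) M - k)"
    have m: "m > 0" using M(2) by (simp add: m_def)
    have cardI: "card ?I = poly_dim (Suc E) M"
      using he unfolding harmonic_system_def card_top_monomials E(2) by blast
    define B where "B = C * G\<^sup>2 * m / ?\<sigma>"
    have B: "B > 0" using C m \<sigma> by (simp add: B_def G')
    have on: "orthonormal ?I e" using he by (simp add: harmonic_system_def)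
    have ker: "(\<Sum>y\<in>?I. (wexp \<gamma> r y * norm (e y x))\<^sup>2) \<le> B" if x: "x \<in> sphere 0 1" for x
    proof -
      have sq: "(exp (\<gamma> * real l powr r))\<^sup>2 = exp (2 * \<gamma> * real l powr r)" for l
        by (simp add: power2_eq_square exp_add[symmetric])
      have "(\<Sum>y\<in>?I. (wexp \<gamma> r y * norm (e y x))\<^sup>2) * ?\<sigma> \<le> C * G\<^sup>2 * m"
        using weighted_kernel[OF he x, of "\<lambda>l. exp (\<gamma> * real l powr r)" M] M(3)
        unfolding E(2) sq wexp_def m_def by simp
      then show ?thesis using \<sigma> by (simp add: B_def field_simps)
    qed
    have "\<exists>c. (\<forall>j<k. (\<Sum>y\<in>?I. c y * a j y) = 0) \<and> (\<Sum>y\<in>?I. (norm (c y))\<^sup>2) = 1 \<and>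
     (\<integral>x. norm (\<Sum>y\<in>?I. c y * of_real (wexp \<gamma> r y) * e y x) ^ (2 * n) \<partial>sphere_measure) \<le> (C' * real n * G\<^sup>2) ^ n"
      if n: "n \<ge> 1" for n and a :: "nat \<Rightarrow> nat \<times> nat \<times> nat \<Rightarrow> complex"
    proof -
      obtain b where b: "\<forall>j<k. (\<Sum>y\<in>?I. b y * a j y) = 0" "(\<Sum>y\<in>?I. (norm (b y))\<^sup>2) \<ge> m"
         "(\<integral>x. norm (\<Sum>y\<in>?I. b y * of_real (wexp \<gamma> r y) * e y x) ^ (2 * n) \<partial>sphere_measure)
           \<le> (48 * real n * B) ^ n * ?\<sigma>"
        using random_combination[OF on n B ker, of k a] M(2) unfolding cardI m_def by blast
      define H where "H = (\<Sum>y\<in>?I. (norm (b y))\<^sup>2)"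
      have H: "H \<ge> m" "H > 0" using b(2) m by (auto simp: H_def)
      define c where "c y = of_real (1 / sqrt H) * b y" for y
      have 1: "\<forall>j<k. (\<Sum>y\<in>?I. c y * a j y) = 0"
        using b(1) by (simp add: c_def mult.assoc flip: sum_distrib_left sum_divide_distrib)
      have 2: "(\<Sum>y\<in>?I. (norm (c y))\<^sup>2) = 1"
      proof -
        have "(\<Sum>y\<in>?I. (norm (c y))\<^sup>2) = (\<Sum>y\<in>?I. (1 / H) * (norm (b y))\<^sup>2)"
          using H by (intro sum.cong refl) (simp add: c_def norm_mult norm_divide power_divide)
        also have "\<dots> = (1 / H) * H" by (simp only: H_def sum_distrib_left)
        finally show ?thesis using H by simp
      qed
      have "norm (\<Sum>y\<in>?I. c y * of_real (wexp \<gamma> r y) * e y x) ^ (2 * n)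
         = (1 / H) ^ n * norm (\<Sum>y\<in>?I. b y * of_real (wexp \<gamma> r y) * e y x) ^ (2 * n)" for x
      proof -
        have "(\<Sum>y\<in>?I. c y * of_real (wexp \<gamma> r y) * e y x)
            = of_real (1 / sqrt H) * (\<Sum>y\<in>?I. b y * of_real (wexp \<gamma> r y) * e y x)"
          unfolding c_def sum_distrib_left by (intro sum.cong refl) (simp only: mult.assoc)
        then have "norm (\<Sum>y\<in>?I. c y * of_real (wexp \<gamma> r y) * e y x)
            = (1 / sqrt H) * norm (\<Sum>y\<in>?I. b y * of_real (wexp \<gamma> r y) * e y x)"
          using H by (simp add: norm_mult norm_divide)
        moreover have "(1 / sqrt H) ^ (2 * n) = (1 / H) ^ n"
          using H by (simp add: power_mult power_divide)
        ultimately show ?thesis by (simp only: power_mult_distrib)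
      qed
      then have "(\<integral>x. norm (\<Sum>y\<in>?I. c y * of_real (wexp \<gamma> r y) * e y x) ^ (2 * n) \<partial>sphere_measure)
         = (1 / H) ^ n * (\<integral>x. norm (\<Sum>y\<in>?I. b y * of_real (wexp \<gamma> r y) * e y x) ^ (2 * n) \<partial>sphere_measure)"
        by simp
      also have "\<dots> \<le> (1 / m) ^ n * ((48 * real n * B) ^ n * ?\<sigma>)"
        using b(3) H m by (intro mult_mono power_mono divide_left_mono) (auto intro!: Bochner_Integration.integral_nonneg)
      also have "\<dots> = (48 * real n * (C * G\<^sup>2 / ?\<sigma>)) ^ n * ?\<sigma>"
      proof -
        have "1 / m * (48 * real n * B) = 48 * real n * (C * G\<^sup>2 / ?\<sigma>)" using m by (simp add: B_def)
        then show ?thesis by (simp only: mult.assoc[symmetric] power_mult_distrib[symmetric])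
      qed
      also have "\<dots> \<le> (48 * real n * (C * G\<^sup>2 / ?\<sigma>)) ^ n * (1 + ?\<sigma>) ^ n"
      proof (intro mult_left_mono)
        have "?\<sigma> \<le> (1 + ?\<sigma>) ^ 1" by simp
        also have "\<dots> \<le> (1 + ?\<sigma>) ^ n" using \<sigma> n by (intro power_increasing) auto
        finally show "?\<sigma> \<le> (1 + ?\<sigma>) ^ n" .
      qed (use C \<sigma> in auto)
      also have "\<dots> = ((48 * C * (1 + ?\<sigma>) / ?\<sigma>) * (real n * G\<^sup>2)) ^ n"
      proof -
        have "48 * real n * (C * G\<^sup>2 / ?\<sigma>) * (1 + ?\<sigma>) = (48 * C * (1 + ?\<sigma>) / ?\<sigma>) * (real n * G\<^sup>2)" by simp
        then show ?thesis by (simp only: power_mult_distrib[symmetric])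
      qed
      also have "\<dots> \<le> (C' * (real n * G\<^sup>2)) ^ n"
        using C'(3) C \<sigma> by (intro power_mono mult_right_mono) auto
      finally show ?thesis using 1 2 by (intro exI[of _ c]) (simp add: mult.assoc)
    qed
    moreover have "real M \<le> C' * real k"
      using M(1) C'(2) mult_right_mono[of C C' "real k"] by simp
    ultimately show ?thesis unfolding G_def by blast
  qed
  show ?thesis using C'(1) main by blast
qed

lemma harmonic_sum_sphere_poly:
  fixes e :: "nat \<times> nat \<times> nat \<Rightarrow> complex ^ 'd::finite \<Rightarrow> complex"
  assumes "harmonic_system h e"
  shows "sphere_poly M (\<lambda>x. \<Sum>y\<in>harmonic_indices h M. c y * e y x)"
  using assms by (intro sphere_poly_sum_cmult) (auto simp: harmonic_system_def)

text \<open>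
  With \<open>n\<close> of the order \<open>ln k\<close> the \<open>n\<close>-th root of the dimension is bounded,
  and the price is the factor \<open>sqrt n\<close> of the moment estimate.
\<close>

lemma exists_small_sup_polynomial:
  fixes e :: "nat \<times> nat \<times> nat \<Rightarrow> complex ^ 'd::finite \<Rightarrow> complex" and \<gamma> r :: real
  assumes he: "harmonic_system h e" and d: "CARD('d) \<ge> 2" and \<gamma>: "\<gamma> > 0" and r: "0 < r" "r \<le> 1"
  shows "\<exists>C>0. \<forall>k\<ge>2. \<exists>M. \<forall>a. \<exists>c.
     unit_solution (harmonic_indices h M) k a c \<and>
     (\<forall>x\<in>sphere 0 1. norm (wsum \<gamma> r h e M c x)
       \<le> C * sqrt (ln (real k)) * growth CARD('d) \<gamma> r k)"
proof -
  let ?\<sigma> = "measure sphere_measure (sphere 0 1 :: (complex ^ 'd) set)"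
  have \<sigma>: "?\<sigma> > 0" by (rule sphere_measure_pos)
  obtain C where C: "C > 0" and ex: "\<And>k. k \<ge> 1 \<Longrightarrow> \<exists>M. real M \<le> C * real k \<and> (\<forall>n\<ge>1. \<forall>a. \<exists>c.
     unit_solution (harmonic_indices h M) k a c \<and>
     (\<integral>x. norm (wsum \<gamma> r h e M c x) ^ (2 * n) \<partial>sphere_measure)
       \<le> (C * real n * (growth CARD('d) \<gamma> r k)\<^sup>2) ^ n)"
    using exists_small_weighted_polynomial[OF assms] by blast
  define D where "D = 2 * CARD('d) - 1"
  define P where "P = (C + real D + 1) * exp 2"
  define Q where "Q = (2 / ?\<sigma> + 1) * P ^ D"
  have P: "P > 0" using C by (simp add: P_def add_pos_nonneg)
  have Q: "Q > 0" using \<sigma> P by (simp add: Q_def add_pos_pos)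
  have "\<exists>M. \<forall>a. \<exists>c.
     unit_solution (harmonic_indices h M) k a c \<and>
     (\<forall>x\<in>sphere 0 1. norm (wsum \<gamma> r h e M c x)
       \<le> (sqrt (4 * Q * C)) * sqrt (ln (real k)) * growth CARD('d) \<gamma> r k)"
    if k: "k \<ge> 2" for k
  proof -
    define G where "G = growth CARD('d) \<gamma> r k"
    have G: "G > 0" by (simp add: G_def growth_def)
    define n where "n = nat \<lceil>ln (real k)\<rceil> + 1"
    have lnk: "ln (real k) \<ge> 2 / 3"
      using ln2_ge_two_thirds ln_mono[of 2 "real k"] k by linarith
    have n: "n \<ge> 1" "ln (real k) \<le> real n" "real n \<le> 4 * ln (real k)"
      unfolding n_def using lnk by linarith+
    have kn: "real k \<le> exp (real n)"
      using n(2) k by (metis exp_le_cancel_iff exp_ln of_nat_0_less_iff order_less_le_trans pos2)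
    obtain M where M: "real M \<le> C * real k" and exM: "\<And>n a. n \<ge> 1 \<Longrightarrow> \<exists>c.
     unit_solution (harmonic_indices h M) k a c \<and>
     (\<integral>x. norm (wsum \<gamma> r h e M c x) ^ (2 * n) \<partial>sphere_measure)
       \<le> (C * real n * G\<^sup>2) ^ n"
      using ex[of k] k unfolding G_def by auto
    have dim: "real (poly_dim D (n * M)) / ?\<sigma> \<le> Q ^ n"
    proof -
      have "real (n * M + D) \<le> real n * (C * real k) + real D * (real n * real k)"
      proof -
        have "1 * 1 \<le> real n * real k" using n(1) k by (intro mult_mono) auto
        then have "real D * 1 \<le> real D * (real n * real k)" by (intro mult_left_mono) auto
        moreover have "real n * real M \<le> real n * (C * real k)" using M by (intro mult_left_mono) auto
        ultimately show ?thesis by simp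
      qed
      also have "\<dots> = (C + real D) * (real n * real k)" by (simp add: algebra_simps)
      also have "\<dots> \<le> (C + real D) * (exp (real n) * exp (real n))"
      proof -
        have "real n \<le> exp (real n)" using exp_ge_add_one_self[of "real n"] by linarith
        then show ?thesis using kn C by (intro mult_left_mono mult_mono) auto
      qed
      also have "\<dots> = (C + real D) * exp 2 ^ n"
        by (simp add: exp_add[symmetric] exp_of_nat_mult[symmetric] algebra_simps)
      also have "\<dots> \<le> (C + real D + 1) ^ n * exp 2 ^ n"
      proof (intro mult_right_mono)
        have "C + real D \<le> (C + real D + 1) ^ 1" by simp
        also have "\<dots> \<le> (C + real D + 1) ^ n" using C n(1) by (intro power_increasing) auto
        finally show "C + real D \<le> (C + real D + 1) ^ n" .
      qed auto
      finally have 1: "real (n * M + D) \<le> ((C + real D + 1) * exp 2) ^ n" by (simp add: power_mult_distrib)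
      have "real (poly_dim D (n * M)) / ?\<sigma> \<le> 2 * real (n * M + D) ^ D / ?\<sigma>"
        using \<sigma> by (intro divide_right_mono poly_dim_upper) auto
      also have "\<dots> = (2 / ?\<sigma>) * real (n * M + D) ^ D" by simp
      also have "\<dots> \<le> (2 / ?\<sigma> + 1) ^ n * (((C + real D + 1) * exp 2) ^ n) ^ D"
      proof (intro mult_mono power_mono 1)
        have "2 / ?\<sigma> \<le> (2 / ?\<sigma> + 1) ^ 1" by simp
        also have "\<dots> \<le> (2 / ?\<sigma> + 1) ^ n" using \<sigma> n(1) by (intro power_increasing) auto
        finally show "2 / ?\<sigma> \<le> (2 / ?\<sigma> + 1) ^ n" .
      qed (use \<sigma> in auto)
      finally show ?thesis unfolding Q_def P_def
        by (simp add: power_mult_distrib power_mult[symmetric] mult.commute)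
    qed
    have "\<exists>c. unit_solution (harmonic_indices h M) k a c \<and>
     (\<forall>x\<in>sphere 0 1. norm (wsum \<gamma> r h e M c x)
       \<le> (sqrt (4 * Q * C)) * sqrt (ln (real k)) * G)" for a
    proof -
      obtain c where c: "\<forall>j<k. (\<Sum>y\<in>harmonic_indices h M. c y * a j y) = 0"
        "(\<Sum>y\<in>harmonic_indices h M. (norm (c y))\<^sup>2) = 1"
        and ci: "(\<integral>x. norm (wsum \<gamma> r h e M c x) ^ (2 * n) \<partial>sphere_measure)
          \<le> (C * real n * G\<^sup>2) ^ n" using exM[OF n(1), of a] by blast
      define f where "f = (wsum \<gamma> r h e M c)"
      have f: "sphere_poly M f" unfolding f_def by (rule harmonic_sum_sphere_poly[OF he])
      have "norm (f x) \<le> (sqrt (4 * Q * C)) * sqrt (ln (real k)) * G" if x: "x \<in> sphere 0 1" for x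
      proof -
        have "norm (f x) ^ (2 * n) \<le> real (poly_dim D (n * M)) / ?\<sigma> * (\<integral>x. norm (f x) ^ (2 * n) \<partial>sphere_measure)"
          using sup_le_high_norm[OF he f x, of n] unfolding card_top_monomials D_def .
        also have "\<dots> \<le> Q ^ n * (C * real n * G\<^sup>2) ^ n"
          using ci Q dim unfolding f_def by (intro mult_mono) (auto intro!: Bochner_Integration.integral_nonneg)
        also have "\<dots> = (Q * (C * real n * G\<^sup>2)) ^ n" by (simp only: power_mult_distrib)
        finally have "((norm (f x))\<^sup>2) ^ n \<le> (Q * (C * real n * G\<^sup>2)) ^ n" by (simp only: power_mult)
        then have "(norm (f x))\<^sup>2 \<le> Q * (C * real n * G\<^sup>2)"
          using n(1) Q C by (subst (asm) power_mono_iff) auto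
        also have "\<dots> \<le> Q * (C * (4 * ln (real k)) * G\<^sup>2)"
          using n(3) Q C by (intro mult_left_mono mult_right_mono) auto
        also have "\<dots> = (sqrt (4 * Q * C) * sqrt (ln (real k)) * G)\<^sup>2"
          using Q C lnk by (simp add: power_mult_distrib)
        finally show ?thesis
        proof (rule power2_le_imp_le)
          show "0 \<le> sqrt (4 * Q * C) * sqrt (ln (real k)) * G"
            using G Q C lnk by (intro mult_nonneg_nonneg real_sqrt_ge_zero) auto
        qed
      qed
      then show ?thesis using c unfolding f_def by blast
    qed
    then show ?thesis unfolding G_def by blast
  qed
  then show ?thesis using Q C by (intro exI[of _ "sqrt (4 * Q * C)"]) auto
qed

section \<open>Norms and the pairing on the sphere\<close>

abbreviation sphere_mass :: "'d::finite itself \<Rightarrow> real" where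
  "sphere_mass _ \<equiv> measure sphere_measure (sphere 0 1 :: (complex ^ 'd) set)"

text \<open>
  Even exponents suffice as the measure is finite, and they keep the integrand a polynomial in the
  moduli.
\<close>

definition even_norm_le :: "nat \<Rightarrow> real \<Rightarrow> (complex ^ 'd::finite \<Rightarrow> complex) \<Rightarrow> bool" where
  "even_norm_le n A f \<longleftrightarrow> (\<integral>x. norm (f x) ^ (2 * n) \<partial>sphere_measure) \<le> A ^ (2 * n)"

lemma powr_le_one_plus_power:
  fixes x s :: real
  assumes "x \<ge> 0" "0 \<le> s" "s \<le> real m"
  shows "x powr s \<le> 1 + x ^ m"
proof (cases "x \<le> 1")
  case True
  then have "x powr s \<le> 1" using assms powr_mono2[of s x 1] by simp
  then show ?thesis using assms zero_le_power[of x m] by linarith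
next
  case False
  then have "x powr s \<le> x powr real m" using assms by (intro powr_mono) auto
  then show ?thesis using False by (simp add: powr_realpow)
qed

lemma even_norm_integral:
  fixes f :: "complex ^ 'd::finite \<Rightarrow> complex"
  assumes f: "continuous_on (sphere 0 1) f" and A: "A > 0" and le: "even_norm_le n A f"
  shows "integrable sphere_measure (\<lambda>x. 1 + (norm (f x) / A) ^ (2 * n))"
    and "(\<integral>x. 1 + (norm (f x) / A) ^ (2 * n) \<partial>sphere_measure) \<le> sphere_mass TYPE('d) + 1"
proof -
  show "integrable sphere_measure (\<lambda>x. 1 + (norm (f x) / A) ^ (2 * n))"
    using f A by (intro integrable_sphere_continuous_real continuous_intros) auto
  have i: "integrable sphere_measure (\<lambda>x. (norm (f x) / A) ^ (2 * n))"
    using f A by (intro integrable_sphere_continuous_real continuous_intros) auto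
  have "(\<integral>x. (norm (f x) / A) ^ (2 * n) \<partial>sphere_measure) = (\<integral>x. norm (f x) ^ (2 * n) \<partial>sphere_measure) / A ^ (2 * n)"
    by (simp add: power_divide)
  also have "\<dots> \<le> 1" using le A by (simp add: even_norm_le_def)
  finally show "(\<integral>x. 1 + (norm (f x) / A) ^ (2 * n) \<partial>sphere_measure) \<le> sphere_mass TYPE('d) + 1"
    using i by (simp add: space_sphere_measure)
qed

lemma Lp_norm_le_even_norm:
  fixes f :: "complex ^ 'd::finite \<Rightarrow> complex"
  assumes f: "continuous_on (sphere 0 1) f" and A: "A > 0" and le: "even_norm_le n A f"
    and p: "1 \<le> p" "p < \<infinity>" "enn2real p \<le> 2 * real n"
  shows "Lp_norm p f \<le> ennreal (A * (sphere_mass TYPE('d) + 1))"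
proof -
  let ?\<sigma> = "sphere_mass TYPE('d)"
  have \<sigma>: "?\<sigma> > 0" by (rule sphere_measure_pos)
  define s where "s = enn2real p"
  have s: "s \<ge> 1" using p(1,2) unfolding s_def by (metis enn2real_1 enn2real_mono infinity_ennreal_def)
  have pt: "norm (f x) powr s \<le> A powr s * (1 + (norm (f x) / A) ^ (2 * n))" for x
  proof -
    have "(norm (f x) / A) powr s \<le> 1 + (norm (f x) / A) ^ (2 * n)"
      using A s p(3) by (intro powr_le_one_plus_power) (auto simp: s_def)
    then have "A powr s * (norm (f x) / A) powr s \<le> A powr s * (1 + (norm (f x) / A) ^ (2 * n))"
      by (intro mult_left_mono) auto
    then show ?thesis using A by (simp add: powr_divide)
  qed
  define I where "I = (\<integral>\<^sup>+x. ennreal (norm (f x) powr s) \<partial>sphere_measure)"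
  have "I \<le> (\<integral>\<^sup>+x. ennreal (A powr s * (1 + (norm (f x) / A) ^ (2 * n))) \<partial>sphere_measure)"
    unfolding I_def by (intro nn_integral_mono ennreal_leI pt)
  also have "\<dots> = ennreal (\<integral>x. A powr s * (1 + (norm (f x) / A) ^ (2 * n)) \<partial>sphere_measure)"
    using even_norm_integral(1)[OF f A le] A by (intro nn_integral_eq_integral integrable_mult_right) auto
  also have "\<dots> \<le> ennreal (A powr s * (?\<sigma> + 1))"
  proof (intro ennreal_leI)
    show "(\<integral>x. A powr s * (1 + (norm (f x) / A) ^ (2 * n)) \<partial>sphere_measure) \<le> A powr s * (?\<sigma> + 1)"
      unfolding integral_mult_right_zero using even_norm_integral(2)[OF f A le] by (intro mult_left_mono) auto
  qed
  finally have I: "I \<le> ennreal (A powr s * (?\<sigma> + 1))" .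
  then have fin: "I \<noteq> \<infinity>" by (auto simp: top_unique)
  have "enn2real I \<le> A powr s * (?\<sigma> + 1)"
    using I \<sigma> by (intro enn2real_leI) auto
  then have "enn2real I powr (1 / s) \<le> (A powr s * (?\<sigma> + 1)) powr (1 / s)"
    using s by (intro powr_mono2) auto
  also have "\<dots> = A * (?\<sigma> + 1) powr (1 / s)"
    using A s by (simp add: powr_mult powr_powr)
  also have "\<dots> \<le> A * (?\<sigma> + 1)"
    using A s \<sigma> powr_mono[of "1 / s" 1 "?\<sigma> + 1"] by (intro mult_left_mono) auto
  finally show ?thesis
    using p(2) fin unfolding Lp_norm_def Let_def s_def[symmetric] I_def[symmetric] by (auto intro: ennreal_leI)
qed

lemma Lp_norm_le_sup:
  fixes f :: "complex ^ 'd::finite \<Rightarrow> complex"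
  assumes f: "continuous_on (sphere 0 1) f" and le: "\<And>x. x \<in> sphere 0 1 \<Longrightarrow> norm (f x) \<le> A"
  shows "Lp_norm \<infinity> f \<le> ennreal A"
proof -
  have "f \<in> borel_measurable sphere_measure" using f by (rule borel_measurable_sphere_continuous)
  then have "esssup sphere_measure (\<lambda>x. ennreal (norm (f x))) \<le> ennreal A"
    by (intro esssup_I) (auto simp: space_sphere_measure intro!: AE_I2 ennreal_leI le)
  then show ?thesis by (simp add: Lp_norm_def)
qed

lemma Lp_norm_infty_AE:
  assumes "h \<in> borel_measurable sphere_measure" "Lp_norm \<infinity> h < \<infinity>"
  shows "AE x in sphere_measure. norm (h x) \<le> enn2real (Lp_norm \<infinity> h)"
proof -
  have "AE x in sphere_measure. ennreal (norm (h x)) \<le> Lp_norm \<infinity> h"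
    unfolding Lp_norm_def using assms(1) by (simp add: esssup_AE)
  then show ?thesis
    by (rule AE_mp) (intro AE_I2 impI, use assms(2) in \<open>metis enn2real_ennreal enn2real_mono norm_ge_zero infinity_ennreal_def\<close>)
qed

lemma Lp_norm_finite_nn_integral:
  assumes "p < \<infinity>" "Lp_norm p h < \<infinity>"
  shows "(\<integral>\<^sup>+x. ennreal (norm (h x) powr enn2real p) \<partial>sphere_measure) < \<infinity>"
    and "Lp_norm p h = ennreal (enn2real (\<integral>\<^sup>+x. ennreal (norm (h x) powr enn2real p) \<partial>sphere_measure) powr (1 / enn2real p))"
  using assms by (auto simp: Lp_norm_def Let_def less_top[symmetric] split: if_splits)

lemma Lp_space_integrable:
  fixes h :: "complex ^ 'd::finite \<Rightarrow> complex"
  assumes h: "h \<in> Lp_space q" and q: "1 \<le> q"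
  shows "integrable sphere_measure h"
proof -
  have [measurable]: "h \<in> borel_measurable sphere_measure" and fin: "Lp_norm q h < \<infinity>"
    using h by (auto simp: Lp_space_def)
  show ?thesis
  proof (cases "q = \<infinity>")
    case True
    then have "AE x in sphere_measure. norm (h x) \<le> norm (enn2real (Lp_norm \<infinity> h))"
      using Lp_norm_infty_AE[of h] fin by simp
    then show ?thesis
      by (rule Bochner_Integration.integrable_bound[rotated 2]) auto
  next
    case False
    then have q': "q < \<infinity>" by (simp add: less_top)
    define s where "s = enn2real q"
    have s: "s \<ge> 1" using q q' unfolding s_def by (metis enn2real_1 enn2real_mono infinity_ennreal_def)
    have i: "integrable sphere_measure (\<lambda>x. norm (h x) powr s)"
      using Lp_norm_finite_nn_integral(1)[OF q' fin] unfolding s_def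
      by (intro integrableI_bounded) auto
    show ?thesis
    proof (rule Bochner_Integration.integrable_bound)
      show "integrable sphere_measure (\<lambda>x. 1 + norm (h x) powr s)" using i by auto
      have "norm (h x) \<le> 1 + norm (h x) powr s" for x
      proof (cases "norm (h x) \<le> 1")
        case False
        then have "norm (h x) powr 1 \<le> norm (h x) powr s" using s by (intro powr_mono) auto
        then show ?thesis using False by simp
      qed (simp add: add_increasing2)
      then show "AE x in sphere_measure. norm (h x) \<le> norm (1 + norm (h x) powr s)"
        by (intro AE_I2) (metis abs_ge_self order_trans real_norm_def)
    qed simp
  qed
qed

text \<open>
  The pairing with \<open>f\<close> is a functional of norm at most \<open>K\<close> on \<open>L\<^sup>q\<close>.
\<close>

definition paired_bound :: "ennreal \<Rightarrow> real \<Rightarrow> (complex ^ 'd::finite \<Rightarrow> complex) \<Rightarrow> bool" where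
  "paired_bound q K f \<longleftrightarrow> (\<forall>h. h \<in> borel_measurable sphere_measure \<longrightarrow> integrable sphere_measure h \<longrightarrow>
      ennreal (norm (ip h f)) \<le> ennreal K * Lp_norm q h)"

lemma norm_ip_le:
  fixes f h :: "complex ^ 'd::finite \<Rightarrow> complex"
  assumes f: "continuous_on (sphere 0 1) f" and h: "integrable sphere_measure h"
    and g: "integrable sphere_measure g" and le: "AE x in sphere_measure. norm (h x) * norm (f x) \<le> g x"
  shows "norm (ip h f) \<le> (\<integral>x. g x \<partial>sphere_measure)"
proof -
  have i: "integrable sphere_measure (\<lambda>x. h x * cnj (f x))"
    using f h by (intro integrable_sphere_bounded_mult continuous_intros)
  have "norm (ip h f) \<le> (\<integral>x. norm (h x * cnj (f x)) \<partial>sphere_measure)"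
    unfolding ip_def by (rule integral_norm_bound)
  also have "\<dots> \<le> (\<integral>x. g x \<partial>sphere_measure)"
    using integrable_norm[OF i] g le by (intro integral_mono_AE) (simp_all add: norm_mult)
  finally show ?thesis .
qed

text \<open>
  Hoelder's inequality up to a constant: Young's inequality is applied to \<open>|h| / H\<close> and
  \<open>|f| / A\<close>, and the conjugate power of the second factor is at most one plus its
  \<open>2 n\<close>-th power.
\<close>

lemma paired_bound_even_norm:
  fixes f :: "complex ^ 'd::finite \<Rightarrow> complex"
  assumes f: "continuous_on (sphere 0 1) f" and A: "A > 0" and le: "even_norm_le n A f"
    and q: "1 < q" and n: "n \<ge> 1" "q < \<infinity> \<Longrightarrow> enn2real q / (enn2real q - 1) \<le> 2 * real n"
  shows "paired_bound q (A * (sphere_mass TYPE('d) + 2)) f"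
  unfolding paired_bound_def
proof (intro allI impI)
  let ?\<sigma> = "sphere_mass TYPE('d)"
  have \<sigma>: "?\<sigma> > 0" by (rule sphere_measure_pos)
  let ?F = "\<lambda>x. 1 + (norm (f x) / A) ^ (2 * n)"
  note F = even_norm_integral[OF f A le]
  fix h :: "complex ^ 'd \<Rightarrow> complex"
  assume [measurable]: "h \<in> borel_measurable sphere_measure" and hi: "integrable sphere_measure h"
  show "ennreal (norm (ip h f)) \<le> ennreal (A * (?\<sigma> + 2)) * Lp_norm q h"
  proof (cases "Lp_norm q h < \<infinity>")
    case False
    then have "Lp_norm q h = \<infinity>" by (simp add: not_less top_unique)
    moreover have "ennreal (A * (?\<sigma> + 2)) \<noteq> 0" using A \<sigma> by simp
    ultimately show ?thesis by (simp add: ennreal_mult_top)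
  next
    case fin: True
    define H where "H = enn2real (Lp_norm q h)"
    have LH: "Lp_norm q h = ennreal H" using fin by (simp add: H_def less_top)
    have H0: "H \<ge> 0" by (simp add: H_def)
    have "norm (ip h f) \<le> H * (A * (?\<sigma> + 2))"
    proof (cases "q = \<infinity>")
      case True
      have "AE x in sphere_measure. norm (h x) \<le> enn2real (Lp_norm \<infinity> h)"
        by (rule Lp_norm_infty_AE) (use fin True in simp_all)
      then have ae: "AE x in sphere_measure. norm (h x) * norm (f x) \<le> H * A * ?F x"
      proof (rule AE_mp)
        show "AE x in sphere_measure. norm (h x) \<le> enn2real (Lp_norm \<infinity> h) \<longrightarrow> norm (h x) * norm (f x) \<le> H * A * ?F x"
        proof (intro AE_I2 impI)
          fix x assume "norm (h x) \<le> enn2real (Lp_norm \<infinity> h)"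
          then have 1: "norm (h x) \<le> H" using True by (simp add: H_def)
          have "norm (f x) / A \<le> ?F x"
            using powr_le_one_plus_power[of "norm (f x) / A" 1 "2 * n"] n(1) A by simp
          then have "norm (f x) \<le> A * ?F x" using A by (simp add: field_simps)
          then have "norm (h x) * norm (f x) \<le> H * (A * ?F x)" using 1 H0 by (intro mult_mono) auto
          then show "norm (h x) * norm (f x) \<le> H * A * ?F x" by (simp only: mult.assoc)
        qed
      qed
      have "norm (ip h f) \<le> (\<integral>x. H * A * ?F x \<partial>sphere_measure)"
        by (rule norm_ip_le[OF f hi _ ae]) (intro integrable_mult_right F(1))
      also have "\<dots> = H * A * (\<integral>x. ?F x \<partial>sphere_measure)" by (rule integral_mult_right_zero)
      also have "\<dots> \<le> H * A * (?\<sigma> + 1)" using F(2) H0 A by (intro mult_left_mono) auto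
      also have "\<dots> \<le> H * (A * (?\<sigma> + 2))" using H0 A by (simp add: algebra_simps)
      finally show ?thesis .
    next
      case False
      then have q': "q < \<infinity>" by (simp add: less_top)
      define s where "s = enn2real q"
      have s: "s > 1"
        using q q' unfolding s_def by (metis enn2real_1 enn2real_less_iff ennreal_1 ennreal_enn2real_if ennreal_less_iff infinity_ennreal_def zero_le_one less_top)
      define t where "t = s / (s - 1)"
      have t: "t > 1" "1 / s + 1 / t = 1" "t \<le> 2 * real n"
        using s n(2)[OF q'] by (auto simp: t_def s_def[symmetric] field_simps)
      define v where "v = enn2real (\<integral>\<^sup>+x. ennreal (norm (h x) powr s) \<partial>sphere_measure)"
      have nn: "(\<integral>\<^sup>+x. ennreal (norm (h x) powr s) \<partial>sphere_measure) < \<infinity>"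
        using Lp_norm_finite_nn_integral(1)[OF q' fin] by (simp add: s_def)
      have i: "integrable sphere_measure (\<lambda>x. norm (h x) powr s)"
        using nn by (intro integrableI_bounded) auto
      have v: "v = (\<integral>x. norm (h x) powr s \<partial>sphere_measure)"
        unfolding v_def by (subst integral_eq_nn_integral) auto
      have v0: "v \<ge> 0" by (simp add: v_def)
      have Hv: "H = v powr (1 / s)"
        using Lp_norm_finite_nn_integral(2)[OF q' fin] unfolding H_def v_def s_def by simp
      show ?thesis
      proof (cases "v = 0")
        case True
        then have "AE x in sphere_measure. norm (h x) powr s = 0"
          using v integral_nonneg_eq_0_iff_AE[OF i] by simp
        then have "AE x in sphere_measure. h x = 0" by simp
        then have "norm (ip h f) \<le> (\<integral>x. 0 \<partial>(sphere_measure :: (complex ^ 'd) measure))"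
          by (intro norm_ip_le[OF f hi]) auto
        then show ?thesis using H0 A \<sigma> by simp
      next
        case False
        then have v1: "v > 0" using v0 by simp
        have H: "H > 0" "H powr s = v" using v1 s by (auto simp: Hv powr_powr)
        have pt: "norm (h x) * norm (f x) \<le> H * A * (norm (h x) powr s / v + ?F x)" for x
        proof -
          have "(norm (h x) / H) * (norm (f x) / A) \<le> (norm (h x) / H) powr s / s + (norm (f x) / A) powr t / t"
            using s t H A by (intro Youngs_inequality) auto
          also have "\<dots> \<le> (norm (h x) / H) powr s + (norm (f x) / A) powr t"
          proof (intro add_mono)
            show "(norm (h x) / H) powr s / s \<le> (norm (h x) / H) powr s"
              using s by (simp add: divide_le_eq mult_left_le_one_le mult_le_cancel_left1)
            show "(norm (f x) / A) powr t / t \<le> (norm (f x) / A) powr t"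
              using t by (simp add: divide_le_eq mult_le_cancel_left1)
          qed
          also have "(norm (h x) / H) powr s = norm (h x) powr s / v" using H by (simp add: powr_divide)
          also have "(norm (f x) / A) powr t \<le> ?F x" using t A by (intro powr_le_one_plus_power) auto
          finally have "(norm (h x) / H) * (norm (f x) / A) \<le> norm (h x) powr s / v + ?F x" by simp
          then show ?thesis using H A by (simp add: field_simps)
        qed
        have "norm (ip h f) \<le> (\<integral>x. H * A * (norm (h x) powr s / v + ?F x) \<partial>sphere_measure)"
          by (rule norm_ip_le[OF f hi]) (use i F(1) pt in \<open>auto intro!: integrable_mult_right Bochner_Integration.integrable_add\<close>)
        also have "\<dots> = H * A * ((\<integral>x. norm (h x) powr s / v \<partial>sphere_measure) + (\<integral>x. ?F x \<partial>sphere_measure))"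
          unfolding integral_mult_right_zero using i F(1) by (subst Bochner_Integration.integral_add) auto
        also have "(\<integral>x. norm (h x) powr s / v \<partial>sphere_measure) = 1" using v v1 by simp
        also have "H * A * (1 + (\<integral>x. ?F x \<partial>sphere_measure)) \<le> H * A * (1 + (?\<sigma> + 1))"
          using F(2) H A by (intro mult_left_mono add_left_mono) auto
        finally show ?thesis by (simp add: mult.assoc add.commute)
      qed
    qed
    then have "ennreal (norm (ip h f)) \<le> ennreal (A * (?\<sigma> + 2) * H)" by (intro ennreal_leI) (simp add: mult.commute)
    also have "\<dots> = ennreal (A * (?\<sigma> + 2)) * Lp_norm q h" using A \<sigma> H0 by (simp add: LH ennreal_mult)
    finally show ?thesis .
  qed
qed

lemma paired_bound_sup:
  fixes f :: "complex ^ 'd::finite \<Rightarrow> complex"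
  assumes f: "continuous_on (sphere 0 1) f" and A: "A > 0" and le: "\<And>x. x \<in> sphere 0 1 \<Longrightarrow> norm (f x) \<le> A"
  shows "paired_bound 1 A f"
  unfolding paired_bound_def
proof (intro allI impI)
  fix h :: "complex ^ 'd \<Rightarrow> complex"
  assume [measurable]: "h \<in> borel_measurable sphere_measure" and hi: "integrable sphere_measure h"
  have "norm (ip h f) \<le> (\<integral>x. A * norm (h x) \<partial>sphere_measure)"
    using hi le A by (intro norm_ip_le[OF f hi] AE_I2) (auto simp: space_sphere_measure mult.commute[of A] intro!: mult_left_mono)
  then have 1: "norm (ip h f) \<le> A * (\<integral>x. norm (h x) \<partial>sphere_measure)" by simp
  have nn: "(\<integral>\<^sup>+x. ennreal (norm (h x)) \<partial>sphere_measure) = ennreal (\<integral>x. norm (h x) \<partial>sphere_measure)"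
    using hi by (intro nn_integral_eq_integral) auto
  have "Lp_norm 1 h = ennreal (\<integral>x. norm (h x) \<partial>sphere_measure)"
    by (simp add: Lp_norm_def nn)
  then show "ennreal (norm (ip h f)) \<le> ennreal A * Lp_norm 1 h"
    using 1 A by (simp add: ennreal_mult[symmetric] ennreal_leI)
qed

section \<open>Multipliers acting on polynomials\<close>

lemma reproducing_kernel_eq:
  fixes e :: "nat \<times> nat \<times> nat \<Rightarrow> complex ^ 'd::finite \<Rightarrow> complex"
  assumes he: "harmonic_system h e" and w: "w \<in> sphere 0 1"
  shows "reproducing_kernel m n w = (\<lambda>x. \<Sum>i<h m n. cnj (e (m, n, i) w) * e (m, n, i) x)"
  unfolding reproducing_kernel_def
proof (rule the_equality)
  let ?Z = "\<lambda>x. \<Sum>i<h m n. cnj (e (m, n, i) w) * e (m, n, i) x"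
  have mem: "e (m, n, i) \<in> harmonics m n" if "i < h m n" for i
    using he that by (simp add: harmonic_system_def)
  have V: "func_space (\<lambda>f. f \<in> harmonics m n)" by (rule func_space_harmonics)
  have cont: "continuous_on (sphere 0 1) f" if "f \<in> harmonics m n" for f :: "complex ^ 'd \<Rightarrow> complex"
    using V that unfolding func_space_def by blast
  have Z: "?Z \<in> harmonics m n"
    using func_space_sum[OF V, of "{..<h m n}" "\<lambda>i. e (m, n, i)" "\<lambda>i. cnj (e (m, n, i) w)"] mem by simp
  have rep: "f w = ip f ?Z" if f: "f \<in> harmonics m n" for f
  proof -
    have "ip f ?Z = (\<Sum>i<h m n. cnj (cnj (e (m, n, i) w)) * ip f (e (m, n, i)))"
      by (rule ip_sum_right) (auto intro: cont mem f)
    also have "\<dots> = f w"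
      using he f w unfolding harmonic_system_def by (simp add: mult.commute)
    finally show ?thesis by simp
  qed
  show "?Z \<in> harmonics m n \<and> (\<forall>f\<in>harmonics m n. f w = sint (\<lambda>x. f x * cnj (?Z x)))"
    using Z rep unfolding ip_def by blast
  fix Z' assume Z': "Z' \<in> harmonics m n \<and> (\<forall>f\<in>harmonics m n. f w = sint (\<lambda>x. f x * cnj (Z' x)))"
  define f where "f = (\<lambda>x. Z' x + (-1) * ?Z x)"
  have f: "f \<in> harmonics m n" unfolding f_def using V Z Z' unfolding func_space_def by blast
  have "f w = ip f Z'" using Z' f unfolding ip_def by blast
  then have "ip f Z' = ip f ?Z" using rep[OF f] by simp
  then have "cnj (ip f Z') = cnj (ip f ?Z)" by (simp only:)
  then have eq: "ip Z' f = ip ?Z f" by (simp only: ip_cnj)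
  have cZ: "continuous_on (sphere 0 1) Z'" "continuous_on (sphere 0 1) ?Z" "continuous_on (sphere 0 1) f"
    using cont Z Z' f by blast+
  have "ip (\<lambda>x. Z' x + (-1) * ?Z x) f = ip Z' f - ip ?Z f" by (rule ip_diff_left[OF cZ])
  then have "ip f f = 0" unfolding f_def[symmetric] eq by simp
  then have z: "(\<integral>x. (norm (f x))\<^sup>2 \<partial>sphere_measure) = 0" by (simp add: ip_self_real)
  have "f x = 0" if "x \<in> sphere 0 1" for x
    using norm2_pos[OF cont[OF f] that] z by auto
  then have on: "Z' x = ?Z x" if "x \<in> sphere 0 1" for x using that by (simp add: f_def)
  have off: "g x = 0" if "g \<in> harmonics m n" "x \<notin> sphere 0 1" for g :: "complex ^ 'd \<Rightarrow> complex" and x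
    using that unfolding harmonics_iff on_sphere_def by auto
  show "Z' = ?Z"
  proof
    fix x show "Z' x = ?Z x"
    proof (cases "x \<in> sphere 0 1")
      case True
      then show ?thesis by (rule on)
    next
      case False
      have "Z' x = 0" using off[OF conjunct1[OF Z'] False] .
      moreover have "?Z x = 0" using off[OF Z False] .
      ultimately show ?thesis by simp
    qed
  qed
qed

lemma harmonic_projection_sum:
  fixes e :: "nat \<times> nat \<times> nat \<Rightarrow> complex ^ 'd::finite \<Rightarrow> complex"
  assumes he: "harmonic_system h e" and w: "w \<in> sphere 0 1"
  shows "harmonic_projection m n (\<lambda>x. \<Sum>y\<in>harmonic_indices h M. b y * e y x) w
    = (\<Sum>y\<in>harmonic_indices h M. b y * (\<Sum>i<h m n. of_bool (y = (m, n, i)) * e (m, n, i) w))"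
proof -
  let ?I = "harmonic_indices h M"
  let ?Z = "\<lambda>x. \<Sum>i<h m n. cnj (e (m, n, i) w) * e (m, n, i) x"
  have ce: "continuous_on (sphere 0 1) (e y)" if "y \<in> harmonic_indices h L" for y L
    using he that unfolding harmonic_system_def orthonormal_def by blast
  have ci: "continuous_on (sphere 0 1) (e (m, n, i))" if "i < h m n" for i
    by (rule ce[of _ "m + n"]) (use that in \<open>simp add: harmonic_indices_def\<close>)
  have orth: "ip (e y) (e (m, n, i)) = of_bool (y = (m, n, i))" if "y \<in> ?I" "i < h m n" for y i
  proof -
    have "orthonormal (harmonic_indices h (M + m + n)) e" using he by (simp add: harmonic_system_def)
    moreover have "y \<in> harmonic_indices h (M + m + n)" "(m, n, i) \<in> harmonic_indices h (M + m + n)"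
      using that by (auto simp: harmonic_indices_def)
    ultimately show ?thesis unfolding orthonormal_def by blast
  qed
  have "harmonic_projection m n (\<lambda>x. \<Sum>y\<in>?I. b y * e y x) w = ip (\<lambda>x. \<Sum>y\<in>?I. b y * e y x) ?Z"
    unfolding harmonic_projection_def reproducing_kernel_eq[OF he w] ip_def ..
  also have "\<dots> = (\<Sum>y\<in>?I. b y * ip (e y) ?Z)"
    by (rule ip_sum_left) (auto intro!: ce continuous_intros ci)
  also have "\<dots> = (\<Sum>y\<in>?I. b y * (\<Sum>i<h m n. of_bool (y = (m, n, i)) * e (m, n, i) w))"
  proof (intro sum.cong refl arg_cong2[of _ _ _ _ "(*)"])
    fix y assume y: "y \<in> ?I"
    have "ip (e y) ?Z = (\<Sum>i<h m n. cnj (cnj (e (m, n, i) w)) * ip (e y) (e (m, n, i)))"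
      by (rule ip_sum_right) (auto intro: ci ce[OF y])
    also have "\<dots> = (\<Sum>i<h m n. of_bool (y = (m, n, i)) * e (m, n, i) w)"
      using orth[OF y] by (intro sum.cong) auto
    finally show "ip (e y) ?Z = (\<Sum>i<h m n. of_bool (y = (m, n, i)) * e (m, n, i) w)" .
  qed
  finally show ?thesis .
qed

lemma Lp_space_1_continuous:
  fixes f :: "complex ^ 'd::finite \<Rightarrow> complex"
  assumes "continuous_on (sphere 0 1) f"
  shows "f \<in> Lp_space 1"
proof -
  have i: "integrable sphere_measure (\<lambda>x. norm (f x))"
    using assms by (intro integrable_sphere_continuous_real continuous_intros)
  then have "(\<integral>\<^sup>+x. ennreal (norm (f x)) \<partial>sphere_measure) = ennreal (\<integral>x. norm (f x) \<partial>sphere_measure)"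
    by (intro nn_integral_eq_integral) auto
  then show ?thesis
    using borel_measurable_sphere_continuous[OF assms] by (simp add: Lp_space_def Lp_norm_def)
qed

text \<open>
  The projections select the coefficients of the respective bidegree, where the multiplier and the
  weight cancel.
\<close>

lemma multiplier_op_sum:
  fixes e :: "nat \<times> nat \<times> nat \<Rightarrow> complex ^ 'd::finite \<Rightarrow> complex"
  assumes he: "harmonic_system h e"
  shows "(\<lambda>x. \<Sum>y\<in>harmonic_indices h M. b y * e y x)
    \<in> multiplier_op (exp_multiplier \<gamma> r) (\<lambda>x. \<Sum>y\<in>harmonic_indices h M. (b y * of_real (wexp \<gamma> r y)) * e y x)"
proof -
  let ?I = "harmonic_indices h M"
  have "sphere_poly M (\<lambda>x. \<Sum>y\<in>?I. b y * e y x)" by (rule harmonic_sum_sphere_poly[OF he])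
  then have "continuous_on (sphere 0 1) (\<lambda>x. \<Sum>y\<in>?I. b y * e y x)"
    using func_space_sphere_poly unfolding func_space_def by blast
  from Lp_space_1_continuous[OF this]
  have 1: "(\<lambda>x. \<Sum>y\<in>?I. b y * e y x) \<in> Lp_space 1" .
  have "exp_multiplier \<gamma> r m n * of_real (wexp \<gamma> r (m, n, i)) = 1" for m n i
    by (simp add: exp_multiplier_def wexp_def level_def exp_minus flip: of_real_mult)
  then have lam: "b y = exp_multiplier \<gamma> r m n * (b y * of_real (wexp \<gamma> r y))" if "y = (m, n, i)" for y m n i
    using that by (metis mult.left_commute mult.right_neutral)
  have "harmonic_projection m n (\<lambda>x. \<Sum>y\<in>?I. b y * e y x) w
     = exp_multiplier \<gamma> r m n * harmonic_projection m n (\<lambda>x. \<Sum>y\<in>?I. (b y * of_real (wexp \<gamma> r y)) * e y x) w"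
    if w: "w \<in> sphere 0 1" for m n w
    unfolding harmonic_projection_sum[OF he w] sum_distrib_left
  proof (intro sum.cong refl)
    fix y i
    show "b y * (of_bool (y = (m, n, i)) * e (m, n, i) w)
      = exp_multiplier \<gamma> r m n * (b y * of_real (wexp \<gamma> r y) * (of_bool (y = (m, n, i)) * e (m, n, i) w))"
    proof (cases "y = (m, n, i)")
      case True
      show ?thesis by (subst lam[OF True]) (simp only: mult.assoc)
    qed simp
  qed
  then show ?thesis using 1 by (simp add: multiplier_op_def)
qed

section \<open>The lower bound\<close>

text \<open>
  Duality: a functional that vanishes on the approximating subspace and is large on some element of
  the set keeps that element away from the subspace.
\<close>

lemma kolmogorov_width_lower:
  fixes A :: "(complex ^ 'd::finite \<Rightarrow> complex) set"
  assumes q: "1 \<le> q" and K: "K > 0" and \<delta>: "\<delta> \<ge> 0"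
    and ex: "\<And>g. (\<And>j. j < k \<Longrightarrow> integrable sphere_measure (g j)) \<Longrightarrow>
      \<exists>\<psi>\<in>A. \<exists>f. continuous_on (sphere 0 1) \<psi> \<and> continuous_on (sphere 0 1) f \<and> (\<forall>j<k. ip (g j) f = 0) \<and>
        norm (ip \<psi> f) \<ge> \<delta> * K \<and> paired_bound q K f"
  shows "kolmogorov_width k A q \<ge> ennreal \<delta>"
  unfolding kolmogorov_width_def
proof (rule INF_greatest)
  fix X :: "(complex ^ 'd \<Rightarrow> complex) set" assume "X \<in> Lp_subspaces q k"
  then obtain g where X: "X = {\<lambda>x. \<Sum>i<k. c i * g i x | c :: nat \<Rightarrow> complex. True}"
    and g: "\<And>i. i < k \<Longrightarrow> g i \<in> Lp_space q"
    unfolding Lp_subspaces_def by blast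
  have gi: "integrable sphere_measure (g j)" if "j < k" for j using Lp_space_integrable[OF g[OF that] q] .
  obtain \<psi> f where \<psi>: "\<psi> \<in> A" "continuous_on (sphere 0 1) \<psi>" "continuous_on (sphere 0 1) f"
    "\<And>j. j < k \<Longrightarrow> ip (g j) f = 0" "norm (ip \<psi> f) \<ge> \<delta> * K" "paired_bound q K f"
    using ex[of g] gi by blast
  have "ennreal \<delta> \<le> (INF y\<in>X. Lp_norm q (\<lambda>z. \<psi> z - y z))"
  proof (rule INF_greatest)
    fix y assume "y \<in> X"
    then obtain c where y: "y = (\<lambda>x. \<Sum>i<k. c i * g i x)" unfolding X by blast
    have yi: "integrable sphere_measure y" unfolding y using gi by auto
    have \<psi>i: "integrable sphere_measure \<psi>" using \<psi>(2) by (rule integrable_sphere_continuous)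
    have m: "integrable sphere_measure (\<lambda>x. u x * cnj (f x))" if "integrable sphere_measure u" for u
      using \<psi>(3) that by (intro integrable_sphere_bounded_mult continuous_intros)
    have "ip y f = (\<Sum>i<k. c i * ip (g i) f)"
      unfolding ip_def y sum_distrib_right mult.assoc
      by (subst Bochner_Integration.integral_sum) (auto intro!: m[OF gi] integrable_mult_right)
    also have "\<dots> = 0" using \<psi>(4) by simp
    finally have "ip (\<lambda>z. \<psi> z - y z) f = ip \<psi> f"
      using m[OF \<psi>i] m[OF yi] by (simp add: ip_def left_diff_distrib)
    moreover have "ennreal (norm (ip (\<lambda>z. \<psi> z - y z) f)) \<le> ennreal K * Lp_norm q (\<lambda>z. \<psi> z - y z)"
    proof -
      have u: "integrable sphere_measure (\<lambda>z. \<psi> z - y z)" using \<psi>i yi by (rule Bochner_Integration.integrable_diff)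
      show ?thesis using \<psi>(6) u borel_measurable_integrable[OF u] unfolding paired_bound_def by blast
    qed
    ultimately have "ennreal (\<delta> * K) \<le> ennreal K * Lp_norm q (\<lambda>z. \<psi> z - y z)"
      using order_trans[OF ennreal_leI[OF \<psi>(5)]] by simp
    then have "ennreal K * ennreal \<delta> \<le> ennreal K * Lp_norm q (\<lambda>z. \<psi> z - y z)"
      using K \<delta> by (simp add: ennreal_mult mult.commute)
    then show "ennreal \<delta> \<le> Lp_norm q (\<lambda>z. \<psi> z - y z)"
      using K by (subst (asm) ennreal_mult_le_mult_iff) auto
  qed
  also have "\<dots> \<le> (SUP x\<in>A. INF y\<in>X. Lp_norm q (\<lambda>z. x z - y z))" by (rule SUP_upper[OF \<psi>(1)])
  finally show "ennreal \<delta> \<le> (SUP x\<in>A. INF y\<in>X. Lp_norm q (\<lambda>z. x z - y z))" .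
qed

lemma ip_sum_right_integrable:
  fixes g :: "complex ^ 'd::finite \<Rightarrow> complex"
  assumes "\<And>i. i \<in> I \<Longrightarrow> continuous_on (sphere 0 1) (f i)" "integrable sphere_measure g"
  shows "ip g (\<lambda>x. \<Sum>i\<in>I. c i * f i x) = (\<Sum>i\<in>I. cnj (c i) * ip g (f i))"
proof -
  have i: "integrable sphere_measure (\<lambda>x. g x * cnj (f i x))" if "i \<in> I" for i
    using assms that by (intro integrable_sphere_bounded_mult continuous_intros) auto
  have "ip g (\<lambda>x. \<Sum>i\<in>I. c i * f i x) = sint (\<lambda>x. \<Sum>i\<in>I. cnj (c i) * (g x * cnj (f i x)))"
    by (simp add: ip_def sum_distrib_left mult.left_commute)
  also have "\<dots> = (\<Sum>i\<in>I. cnj (c i) * ip g (f i))"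
    unfolding ip_def by (subst Bochner_Integration.integral_sum) (auto intro!: integrable_mult_right i)
  finally show ?thesis .
qed

lemma continuous_on_harmonic_sum:
  fixes e :: "nat \<times> nat \<times> nat \<Rightarrow> complex ^ 'd::finite \<Rightarrow> complex"
  assumes "harmonic_system h e"
  shows "continuous_on (sphere 0 1) (\<lambda>x. \<Sum>y\<in>harmonic_indices h M. c y * e y x)"
  using harmonic_sum_sphere_poly[OF assms] func_space_sphere_poly unfolding func_space_def by blast

lemma even_norm_harmonic_sum:
  fixes e :: "nat \<times> nat \<times> nat \<Rightarrow> complex ^ 'd::finite \<Rightarrow> complex"
  assumes he: "harmonic_system h e" and c: "(\<Sum>y\<in>harmonic_indices h M. (norm (c y))\<^sup>2) = 1" and t: "t \<ge> 0"
  shows "even_norm_le 1 t (\<lambda>x. \<Sum>y\<in>harmonic_indices h M. (of_real t * c y) * e y x)"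
proof -
  let ?f = "\<lambda>x. \<Sum>y\<in>harmonic_indices h M. (of_real t * c y) * e y x"
  have on: "orthonormal (harmonic_indices h M) e" using he by (simp add: harmonic_system_def)
  have "complex_of_real (\<integral>x. (norm (?f x))\<^sup>2 \<partial>sphere_measure) = (\<Sum>y\<in>harmonic_indices h M. of_real ((norm (of_real t * c y))\<^sup>2))"
    unfolding ip_self_real[symmetric] orthonormal_parseval[OF on] complex_norm_square ..
  also have "\<dots> = complex_of_real (t\<^sup>2 * (\<Sum>y\<in>harmonic_indices h M. (norm (c y))\<^sup>2))"
    by (simp add: norm_mult power_mult_distrib sum_distrib_left)
  finally have "(\<integral>x. (norm (?f x))\<^sup>2 \<partial>sphere_measure) = t\<^sup>2 * (\<Sum>y\<in>harmonic_indices h M. (norm (c y))\<^sup>2)"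
    by (simp only: of_real_eq_iff)
  then show ?thesis using c by (simp add: even_norm_le_def)
qed

text \<open>
  For \<open>q \<ge> 2\<close> the weighted polynomial, scaled into the unit ball, is mapped by the
  multiplier to a multiple of the unweighted one, and the unweighted one is also used as the
  functional.
\<close>

lemma width_lower_by_ball_norm:
  fixes e :: "nat \<times> nat \<times> nat \<Rightarrow> complex ^ 'd::finite \<Rightarrow> complex"
  assumes he: "harmonic_system h e" and q: "2 \<le> q" and A: "A > 0"
    and ex: "\<And>a. \<exists>c. unit_solution (harmonic_indices h M) k a c \<and>
      Lp_norm p (\<lambda>x. of_real (1 / A) * wsum \<gamma> r h e M c x) \<le> 1"
  shows "kolmogorov_width k (multiplier_image (exp_multiplier \<gamma> r) (Lp_ball p :: (complex ^ 'd \<Rightarrow> complex) set)) q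
    \<ge> ennreal (1 / (A * (sphere_mass TYPE('d) + 2)))"
proof (rule kolmogorov_width_lower)
  let ?\<sigma> = "sphere_mass TYPE('d)" and ?I = "harmonic_indices h M"
  have \<sigma>: "?\<sigma> > 0" by (rule sphere_measure_pos)
  show "1 \<le> q" using q by (rule order_trans[rotated]) simp
  show "0 < 1 * (?\<sigma> + 2)" "0 \<le> 1 / (A * (?\<sigma> + 2))" using \<sigma> A by auto
  fix g :: "nat \<Rightarrow> complex ^ 'd \<Rightarrow> complex" assume g: "\<And>j. j < k \<Longrightarrow> integrable sphere_measure (g j)"
  obtain c where c: "\<And>j. j < k \<Longrightarrow> (\<Sum>y\<in>?I. c y * cnj (ip (g j) (e y))) = 0" "(\<Sum>y\<in>?I. (norm (c y))\<^sup>2) = 1"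
    "Lp_norm p (\<lambda>x. of_real (1 / A) * (\<Sum>y\<in>?I. c y * of_real (wexp \<gamma> r y) * e y x)) \<le> 1"
    using ex[of "\<lambda>j y. cnj (ip (g j) (e y))"] by blast
  define b where "b y = of_real (1 / A) * c y" for y
  define \<psi> where "\<psi> = (\<lambda>x. \<Sum>y\<in>?I. b y * e y x)"
  define \<phi> where "\<phi> = (\<lambda>x. \<Sum>y\<in>?I. (b y * of_real (wexp \<gamma> r y)) * e y x)"
  define f where "f = (\<lambda>x. \<Sum>y\<in>?I. c y * e y x)"
  have on: "orthonormal ?I e" using he by (simp add: harmonic_system_def)
  have ce: "continuous_on (sphere 0 1) (e y)" if "y \<in> ?I" for y using on that by (simp add: orthonormal_def)
  have "\<phi> = (\<lambda>x. of_real (1 / A) * (\<Sum>y\<in>?I. c y * of_real (wexp \<gamma> r y) * e y x))"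
    by (simp add: \<phi>_def b_def sum_distrib_left mult.assoc)
  then have n\<phi>: "Lp_norm p \<phi> \<le> 1" using c(3) by simp
  have "\<phi> \<in> borel_measurable sphere_measure"
    unfolding \<phi>_def by (intro borel_measurable_sphere_continuous continuous_on_harmonic_sum[OF he])
  moreover have "Lp_norm p \<phi> < \<infinity>" using n\<phi> by (rule le_less_trans) simp
  ultimately have "\<phi> \<in> Lp_ball p" using n\<phi> by (simp add: Lp_ball_def Lp_space_def)
  moreover have "\<psi> \<in> multiplier_op (exp_multiplier \<gamma> r) \<phi>" unfolding \<psi>_def \<phi>_def by (rule multiplier_op_sum[OF he])
  ultimately have \<psi>: "\<psi> \<in> multiplier_image (exp_multiplier \<gamma> r) (Lp_ball p)" unfolding multiplier_image_def by blast
  have cf: "continuous_on (sphere 0 1) f" "continuous_on (sphere 0 1) \<psi>"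
    unfolding f_def \<psi>_def by (rule continuous_on_harmonic_sum[OF he])+
  have "even_norm_le 1 1 f" using even_norm_harmonic_sum[OF he c(2), of 1] by (simp add: f_def)
  then have pb: "paired_bound q (1 * (?\<sigma> + 2)) f"
  proof (intro paired_bound_even_norm[OF cf(1)])
    show "1 < q" using q by (rule less_le_trans[rotated]) simp
    assume "q < \<infinity>"
    then have "2 \<le> enn2real q" using q enn2real_mono[of 2 q] by simp
    then show "enn2real q / (enn2real q - 1) \<le> 2 * real 1" by (simp add: field_simps)
  qed auto
  have ann: "ip (g j) f = 0" if "j < k" for j
  proof -
    have "ip (g j) f = cnj (\<Sum>y\<in>?I. c y * cnj (ip (g j) (e y)))"
      unfolding f_def using ip_sum_right_integrable[OF ce g[OF that], where c = c] by simp
    then show ?thesis using c(1)[OF that] by simp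
  qed
  have "ip \<psi> f = (\<Sum>y\<in>?I. of_real (1 / A) * of_real ((norm (c y))\<^sup>2))"
    unfolding \<psi>_def f_def orthonormal_parseval[OF on] b_def complex_norm_square by (simp add: mult.assoc)
  also have "\<dots> = of_real (1 / A)" by (simp only: sum_distrib_left[symmetric] of_real_sum[symmetric] c(2)) simp
  finally have "norm (ip \<psi> f) = 1 / A" using A by (simp add: norm_divide)
  then have "1 / (A * (?\<sigma> + 2)) * (1 * (?\<sigma> + 2)) \<le> norm (ip \<psi> f)" using A \<sigma> by simp
  then show "\<exists>\<psi>\<in>multiplier_image (exp_multiplier \<gamma> r) (Lp_ball p). \<exists>f. continuous_on (sphere 0 1) \<psi> \<and>
     continuous_on (sphere 0 1) f \<and> (\<forall>j<k. ip (g j) f = 0) \<and>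
     1 / (A * (?\<sigma> + 2)) * (1 * (?\<sigma> + 2)) \<le> norm (ip \<psi> f) \<and> paired_bound q (1 * (?\<sigma> + 2)) f"
    using \<psi> cf ann pb by blast
qed

text \<open>
  For \<open>p \<le> 2\<close> the unit ball contains a multiple of the unweighted polynomial, and the
  weighted polynomial serves as the functional. The pairing of the image with it is the
  squared norm of the coefficients, because multiplier and weight cancel.
\<close>

lemma width_lower_by_functional:
  fixes e :: "nat \<times> nat \<times> nat \<Rightarrow> complex ^ 'd::finite \<Rightarrow> complex"
  assumes he: "harmonic_system h e" and p: "1 \<le> p" "p \<le> 2" and q: "1 \<le> q" and A: "A > 0"
    and ex: "\<And>a. \<exists>c. unit_solution (harmonic_indices h M) k a c \<and>
      paired_bound q A (wsum \<gamma> r h e M c)"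
  shows "kolmogorov_width k (multiplier_image (exp_multiplier \<gamma> r) (Lp_ball p :: (complex ^ 'd \<Rightarrow> complex) set)) q
    \<ge> ennreal (1 / (A * (sphere_mass TYPE('d) + 1)))"
proof (rule kolmogorov_width_lower[OF q A])
  let ?\<sigma> = "sphere_mass TYPE('d)" and ?I = "harmonic_indices h M"
  have \<sigma>: "?\<sigma> > 0" by (rule sphere_measure_pos)
  show "0 \<le> 1 / (A * (?\<sigma> + 1))" using \<sigma> A by auto
  fix g :: "nat \<Rightarrow> complex ^ 'd \<Rightarrow> complex" assume g: "\<And>j. j < k \<Longrightarrow> integrable sphere_measure (g j)"
  obtain c where c: "\<And>j. j < k \<Longrightarrow> (\<Sum>y\<in>?I. c y * (of_real (wexp \<gamma> r y) * cnj (ip (g j) (e y)))) = 0"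
    "(\<Sum>y\<in>?I. (norm (c y))\<^sup>2) = 1"
    "paired_bound q A (\<lambda>x. \<Sum>y\<in>?I. c y * of_real (wexp \<gamma> r y) * e y x)"
    using ex[of "\<lambda>j y. of_real (wexp \<gamma> r y) * cnj (ip (g j) (e y))"] by blast
  have w: "wexp \<gamma> r y > 0" for y by (simp add: wexp_def)
  define t where "t = 1 / (?\<sigma> + 1)"
  have t: "t > 0" "t * (?\<sigma> + 1) = 1" using \<sigma> by (auto simp: t_def)
  \<comment> \<open>Coefficients of the image of \<open>\<phi>\<close>.\<close>
  define b where "b y = of_real t * c y * of_real (1 / wexp \<gamma> r y)" for y
  define \<psi> where "\<psi> = (\<lambda>x. \<Sum>y\<in>?I. b y * e y x)"
  define \<phi> where "\<phi> = (\<lambda>x. \<Sum>y\<in>?I. (of_real t * c y) * e y x)"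
  define f where "f = (\<lambda>x. \<Sum>y\<in>?I. c y * of_real (wexp \<gamma> r y) * e y x)"
  have on: "orthonormal ?I e" using he by (simp add: harmonic_system_def)
  have ce: "continuous_on (sphere 0 1) (e y)" if "y \<in> ?I" for y using on that by (simp add: orthonormal_def)
  have bw: "b y * of_real (wexp \<gamma> r y) = of_real t * c y" for y using w[of y] by (simp add: b_def)
  have cf: "continuous_on (sphere 0 1) f" "continuous_on (sphere 0 1) \<psi>" "continuous_on (sphere 0 1) \<phi>"
    unfolding f_def \<psi>_def \<phi>_def by (rule continuous_on_harmonic_sum[OF he])+
  have p': "p < \<infinity>" using p(2) by (rule le_less_trans) simp
  have "enn2real p \<le> enn2real 2" using p(2) by (intro enn2real_mono) auto
  then have "Lp_norm p \<phi> \<le> ennreal (t * (?\<sigma> + 1))"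
    using even_norm_harmonic_sum[OF he c(2), of t] t p p'
    by (intro Lp_norm_le_even_norm[OF cf(3), of t 1]) (auto simp: \<phi>_def)
  then have n\<phi>: "Lp_norm p \<phi> \<le> 1" using t by simp
  then have "Lp_norm p \<phi> < \<infinity>" by (rule le_less_trans) simp
  then have "\<phi> \<in> Lp_ball p" using n\<phi> borel_measurable_sphere_continuous[OF cf(3)] by (simp add: Lp_ball_def Lp_space_def)
  moreover have "\<psi> \<in> multiplier_op (exp_multiplier \<gamma> r) \<phi>"
    using multiplier_op_sum[OF he, of b M \<gamma> r] unfolding bw \<psi>_def \<phi>_def .
  ultimately have \<psi>: "\<psi> \<in> multiplier_image (exp_multiplier \<gamma> r) (Lp_ball p)" unfolding multiplier_image_def by blast
  have ann: "ip (g j) f = 0" if "j < k" for j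
  proof -
    have "ip (g j) f = cnj (\<Sum>y\<in>?I. c y * (of_real (wexp \<gamma> r y) * cnj (ip (g j) (e y))))"
      unfolding f_def using ip_sum_right_integrable[OF ce g[OF that], where c = "\<lambda>y. c y * of_real (wexp \<gamma> r y)"]
      by (simp add: mult.assoc)
    then show ?thesis using c(1)[OF that] by simp
  qed
  have "ip \<psi> f = (\<Sum>y\<in>?I. of_real t * of_real ((norm (c y))\<^sup>2))"
    unfolding \<psi>_def f_def orthonormal_parseval[OF on] complex_norm_square
  proof (intro sum.cong refl)
    fix y
    have "b y * cnj (c y * of_real (wexp \<gamma> r y)) = (b y * of_real (wexp \<gamma> r y)) * cnj (c y)" by simp
    then show "b y * cnj (c y * of_real (wexp \<gamma> r y)) = of_real t * (c y * cnj (c y))"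
      unfolding bw by (simp only: mult.assoc)
  qed
  also have "\<dots> = of_real t" by (simp only: sum_distrib_left[symmetric] of_real_sum[symmetric] c(2)) simp
  finally have "norm (ip \<psi> f) = t" using t by simp
  moreover have "1 / (A * (?\<sigma> + 1)) * A = t" using A by (simp add: t_def)
  ultimately have "1 / (A * (?\<sigma> + 1)) * A \<le> norm (ip \<psi> f)" by simp
  then show "\<exists>\<psi>\<in>multiplier_image (exp_multiplier \<gamma> r) (Lp_ball p). \<exists>f. continuous_on (sphere 0 1) \<psi> \<and>
     continuous_on (sphere 0 1) f \<and> (\<forall>j<k. ip (g j) f = 0) \<and>
     1 / (A * (?\<sigma> + 1)) * A \<le> norm (ip \<psi> f) \<and> paired_bound q A f"
    using \<psi> cf ann c(3) unfolding f_def by blast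
qed

lemma even_norm_le_of_power:
  assumes "(\<integral>x. norm (f x) ^ (2 * n) \<partial>sphere_measure) \<le> (C * real n * G\<^sup>2) ^ n" "C > 0" "G > 0"
  shows "even_norm_le n (sqrt (C * real n) * G) f"
proof -
  have "(sqrt (C * real n) * G)\<^sup>2 = C * real n * G\<^sup>2" using assms(2) by (simp add: power_mult_distrib)
  then have "(sqrt (C * real n) * G) ^ (2 * n) = (C * real n * G\<^sup>2) ^ n" by (simp only: power_mult)
  then show ?thesis using assms(1) by (simp add: even_norm_le_def)
qed

lemma width_lower_finite_exponents:
  fixes \<gamma> r :: real and p q :: ennreal
  assumes d: "CARD('d::finite) \<ge> 2" and \<gamma>: "\<gamma> > 0" and r: "0 < r" "r \<le> 1"
    and pq: "1 \<le> p \<and> p \<le> 2 \<and> 1 < q \<and> q \<le> 2 \<or> 1 \<le> p \<and> p < \<infinity> \<and> 2 \<le> q"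
  shows "\<exists>C>0. \<forall>k\<ge>1. kolmogorov_width k
      (multiplier_image (exp_multiplier \<gamma> r) (Lp_ball p :: (complex ^ 'd \<Rightarrow> complex) set)) q
    \<ge> ennreal (C / growth CARD('d) \<gamma> r k)"
proof -
  let ?\<sigma> = "sphere_mass TYPE('d)"
  have \<sigma>: "?\<sigma> > 0" by (rule sphere_measure_pos)
  obtain h and e :: "nat \<times> nat \<times> nat \<Rightarrow> complex ^ 'd \<Rightarrow> complex" where he: "harmonic_system h e"
    using exists_harmonic_system by blast
  obtain C where C: "C > 0" and ex: "\<And>k. k \<ge> 1 \<Longrightarrow> \<exists>M. real M \<le> C * real k \<and> (\<forall>n\<ge>1. \<forall>a. \<exists>c.
     unit_solution (harmonic_indices h M) k a c \<and>
     (\<integral>x. norm (wsum \<gamma> r h e M c x) ^ (2 * n) \<partial>sphere_measure)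
       \<le> (C * real n * (growth CARD('d) \<gamma> r k)\<^sup>2) ^ n)"
    using exists_small_weighted_polynomial[OF he d \<gamma> r] by blast
  \<comment> \<open>Both \<open>p\<close> and the conjugate exponent of \<open>q\<close> have to be at most \<open>2 n\<close>.\<close>
  define n where "n = nat \<lceil>max (enn2real p) (enn2real q / (enn2real q - 1))\<rceil> + 1"
  have n: "n \<ge> 1" "enn2real p \<le> 2 * real n" "enn2real q / (enn2real q - 1) \<le> 2 * real n"
    using real_nat_ceiling_ge[of "max (enn2real p) (enn2real q / (enn2real q - 1))"]
    by (simp_all add: n_def)
  define C' where "C' = 1 / (sqrt (C * real n) * ((?\<sigma> + 1) * (?\<sigma> + 2)))"
  have C': "C' > 0" using C n(1) \<sigma> by (simp add: C'_def)
  have "kolmogorov_width k (multiplier_image (exp_multiplier \<gamma> r) (Lp_ball p :: (complex ^ 'd \<Rightarrow> complex) set)) q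
      \<ge> ennreal (C' / growth CARD('d) \<gamma> r k)" if k: "k \<ge> 1" for k
  proof -
    define G where "G = growth CARD('d) \<gamma> r k"
    have G: "G > 0" by (simp add: G_def growth_def)
    define A where "A = sqrt (C * real n) * G"
    have A: "A > 0" using C n(1) G by (simp add: A_def)
    obtain M where M0: "\<And>a. \<exists>c. unit_solution (harmonic_indices h M) k a c \<and>
       (\<integral>x. norm (wsum \<gamma> r h e M c x) ^ (2 * n) \<partial>sphere_measure)
         \<le> (C * real n * G\<^sup>2) ^ n"
      using ex[OF k] n(1) unfolding G_def by blast
    have M: "\<exists>c. unit_solution (harmonic_indices h M) k a c \<and>
       even_norm_le n A (wsum \<gamma> r h e M c)" for a
    proof -
      obtain c where c: "\<forall>j<k. (\<Sum>y\<in>harmonic_indices h M. c y * a j y) = 0"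
         "(\<Sum>y\<in>harmonic_indices h M. (norm (c y))\<^sup>2) = 1"
         "(\<integral>x. norm (wsum \<gamma> r h e M c x) ^ (2 * n) \<partial>sphere_measure)
           \<le> (C * real n * G\<^sup>2) ^ n"
        using M0[of a] by blast
      show ?thesis using c(1,2) even_norm_le_of_power[OF c(3) C G] unfolding A_def by blast
    qed
    have cont: "continuous_on (sphere 0 1) (wsum \<gamma> r h e M c)" for c
      by (rule continuous_on_harmonic_sum[OF he])
    from pq have "kolmogorov_width k (multiplier_image (exp_multiplier \<gamma> r) (Lp_ball p :: (complex ^ 'd \<Rightarrow> complex) set)) q
      \<ge> ennreal (1 / (A * ((?\<sigma> + 1) * (?\<sigma> + 2))))"
    proof
      assume pq: "1 \<le> p \<and> p \<le> 2 \<and> 1 < q \<and> q \<le> 2"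
      have "paired_bound q (A * (?\<sigma> + 2)) f" if "even_norm_le n A f" "continuous_on (sphere 0 1) f"
        for f :: "complex ^ 'd \<Rightarrow> complex"
        using pq n that by (intro paired_bound_even_norm A) auto
      then have "\<exists>c. unit_solution (harmonic_indices h M) k a c \<and>
         paired_bound q (A * (?\<sigma> + 2)) (wsum \<gamma> r h e M c)" for a
        using M[of a] cont by meson
      from width_lower_by_functional[OF he _ _ _ _ this] pq A \<sigma>
      show ?thesis by (simp add: mult.assoc mult.commute[of "?\<sigma> + 2"] less_imp_le)
    next
      assume pq: "1 \<le> p \<and> p < \<infinity> \<and> 2 \<le> q"
      have "Lp_norm p (\<lambda>x. of_real (1 / (A * (?\<sigma> + 1))) * f x) \<le> 1" if f: "even_norm_le n A f" "continuous_on (sphere 0 1) f"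
        for f :: "complex ^ 'd \<Rightarrow> complex"
      proof -
        let ?t = "1 / (A * (?\<sigma> + 1))"
        have t: "?t > 0" using A \<sigma> by simp
        have "(\<integral>x. norm (of_real ?t * f x) ^ (2 * n) \<partial>sphere_measure) = ?t ^ (2 * n) * (\<integral>x. norm (f x) ^ (2 * n) \<partial>sphere_measure)"
          using t by (simp only: norm_mult norm_of_real power_mult_distrib integral_mult_right_zero abs_of_pos)
        also have "\<dots> \<le> ?t ^ (2 * n) * A ^ (2 * n)"
          using f(1) t unfolding even_norm_le_def by (intro mult_left_mono) auto
        also have "\<dots> = (?t * A) ^ (2 * n)" by (simp only: power_mult_distrib)
        finally have le: "even_norm_le n (?t * A) (\<lambda>x. of_real ?t * f x)" by (simp only: even_norm_le_def)
        have "continuous_on (sphere 0 1) (\<lambda>x. of_real ?t * f x)" using f(2) by (intro continuous_intros)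
        from Lp_norm_le_even_norm[OF this mult_pos_pos[OF t A] le] pq n(2)
        have "Lp_norm p (\<lambda>x. of_real ?t * f x) \<le> ennreal (?t * A * (?\<sigma> + 1))" by blast
        also have "?t * A * (?\<sigma> + 1) = 1" using A \<sigma> by simp
        finally show ?thesis by simp
      qed
      then have "\<exists>c. unit_solution (harmonic_indices h M) k a c \<and>
         Lp_norm p (\<lambda>x. of_real (1 / (A * (?\<sigma> + 1))) * wsum \<gamma> r h e M c x) \<le> 1" for a
        using M[of a] cont by meson
      from width_lower_by_ball_norm[OF he _ _ this] pq A \<sigma>
      show ?thesis by (simp add: mult.assoc)
    qed
    also have "1 / (A * ((?\<sigma> + 1) * (?\<sigma> + 2))) = C' / G" by (simp add: A_def C'_def)
    finally show ?thesis unfolding G_def .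
  qed
  then show ?thesis using C' by blast
qed

lemma width_lower_extreme_exponents:
  fixes \<gamma> r :: real and p q :: ennreal
  assumes d: "CARD('d::finite) \<ge> 2" and \<gamma>: "\<gamma> > 0" and r: "0 < r" "r \<le> 1"
    and pq: "1 \<le> p \<and> p \<le> 2 \<and> q = 1 \<or> p = \<infinity> \<and> 2 \<le> q"
  shows "\<exists>C>0. \<forall>k\<ge>2. kolmogorov_width k
      (multiplier_image (exp_multiplier \<gamma> r) (Lp_ball p :: (complex ^ 'd \<Rightarrow> complex) set)) q
    \<ge> ennreal (C / (growth CARD('d) \<gamma> r k * sqrt (ln (real k))))"
proof -
  let ?\<sigma> = "sphere_mass TYPE('d)"
  have \<sigma>: "?\<sigma> > 0" by (rule sphere_measure_pos)
  obtain h and e :: "nat \<times> nat \<times> nat \<Rightarrow> complex ^ 'd \<Rightarrow> complex" where he: "harmonic_system h e"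
    using exists_harmonic_system by blast
  obtain C where C: "C > 0" and ex: "\<And>k. k \<ge> 2 \<Longrightarrow> \<exists>M. \<forall>a. \<exists>c.
     unit_solution (harmonic_indices h M) k a c \<and>
     (\<forall>x\<in>sphere 0 1. norm (wsum \<gamma> r h e M c x)
       \<le> C * sqrt (ln (real k)) * growth CARD('d) \<gamma> r k)"
    using exists_small_sup_polynomial[OF he d \<gamma> r] by blast
  define C' where "C' = 1 / (C * (?\<sigma> + 2))"
  have C': "C' > 0" using C \<sigma> by (simp add: C'_def)
  have "kolmogorov_width k (multiplier_image (exp_multiplier \<gamma> r) (Lp_ball p :: (complex ^ 'd \<Rightarrow> complex) set)) q
      \<ge> ennreal (C' / (growth CARD('d) \<gamma> r k * sqrt (ln (real k))))" if k: "k \<ge> 2" for k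
  proof -
    define G where "G = growth CARD('d) \<gamma> r k"
    have G: "G > 0" by (simp add: G_def growth_def)
    define A where "A = C * sqrt (ln (real k)) * G"
    have A: "A > 0" using C G k by (simp add: A_def)
    obtain M where M: "\<And>a. \<exists>c. unit_solution (harmonic_indices h M) k a c \<and>
       (\<forall>x\<in>sphere 0 1. norm (wsum \<gamma> r h e M c x) \<le> A)"
      using ex[OF k] unfolding A_def G_def by blast
    have cont: "continuous_on (sphere 0 1) (wsum \<gamma> r h e M c)" for c
      by (rule continuous_on_harmonic_sum[OF he])
    from pq have "kolmogorov_width k (multiplier_image (exp_multiplier \<gamma> r) (Lp_ball p :: (complex ^ 'd \<Rightarrow> complex) set)) q
      \<ge> ennreal (1 / (A * (?\<sigma> + 2)))"
    proof
      assume pq: "1 \<le> p \<and> p \<le> 2 \<and> q = 1"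
      have "paired_bound q A f" if "\<forall>x\<in>sphere 0 1. norm (f x) \<le> A" "continuous_on (sphere 0 1) f"
        for f :: "complex ^ 'd \<Rightarrow> complex"
        using pq that paired_bound_sup[of f A] A by simp
      then have "\<exists>c. unit_solution (harmonic_indices h M) k a c \<and>
         paired_bound q A (wsum \<gamma> r h e M c)" for a
        using M[of a] cont by meson
      from width_lower_by_functional[OF he _ _ _ A this] pq
      have "ennreal (1 / (A * (?\<sigma> + 1))) \<le> kolmogorov_width k (multiplier_image (exp_multiplier \<gamma> r) (Lp_ball p :: (complex ^ 'd \<Rightarrow> complex) set)) q"
        by simp
      moreover have "1 / (A * (?\<sigma> + 2)) \<le> 1 / (A * (?\<sigma> + 1))"
        using A \<sigma> by (intro divide_left_mono mult_left_mono) auto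
      ultimately show ?thesis by (meson ennreal_leI order_trans)
    next
      assume pq: "p = \<infinity> \<and> 2 \<le> q"
      have "Lp_norm p (\<lambda>x. of_real (1 / A) * f x) \<le> 1" if f: "\<forall>x\<in>sphere 0 1. norm (f x) \<le> A" "continuous_on (sphere 0 1) f"
        for f :: "complex ^ 'd \<Rightarrow> complex"
      proof -
        have "Lp_norm \<infinity> (\<lambda>x. of_real (1 / A) * f x) \<le> ennreal 1"
        proof (rule Lp_norm_le_sup)
          show "continuous_on (sphere 0 1) (\<lambda>x. of_real (1 / A) * f x)" using f(2) by (intro continuous_intros)
          fix x :: "complex ^ 'd" assume "x \<in> sphere 0 1"
          then show "norm (of_real (1 / A) * f x) \<le> 1" using f(1) A by (simp add: norm_mult norm_divide)
        qed
        then show ?thesis using pq by simp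
      qed
      then have "\<exists>c. unit_solution (harmonic_indices h M) k a c \<and>
         Lp_norm p (\<lambda>x. of_real (1 / A) * wsum \<gamma> r h e M c x) \<le> 1" for a
        using M[of a] cont by meson
      from width_lower_by_ball_norm[OF he _ A this] pq show ?thesis by simp
    qed
    also have "1 / (A * (?\<sigma> + 2)) = C' / (G * sqrt (ln (real k)))" by (simp add: A_def C'_def mult_ac)
    finally show ?thesis unfolding G_def .
  qed
  then show ?thesis using C' by blast
qed

theorem theorem3p7:
  fixes \<gamma> r :: real and p q :: ennreal
  assumes "CARD('d::finite) \<ge> 2"
    and "\<gamma> > 0" and "0 < r" and "r \<le> 1"
    and "theta_domain p q"
  shows "\<exists>C>0. \<forall>k\<ge>2.
    kolmogorov_width k
      (multiplier_image (exp_multiplier \<gamma> r) (Lp_ball p :: (complex ^ 'd \<Rightarrow> complex) set)) q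
    \<ge> ennreal (C * (exp (- R_star CARD('d) \<gamma> r * real k powr (r / real (2 * CARD('d) - 1)))
                   * theta p q k))"
proof -
  have E: "exp (- R_star CARD('d) \<gamma> r * real k powr (r / real (2 * CARD('d) - 1))) = 1 / growth CARD('d) \<gamma> r k" for k
    by (simp add: growth_def exp_minus inverse_eq_divide)
  have one2: "(1::ennreal) \<le> 2" "(2::ennreal) < \<infinity>" "(1::ennreal) < 2" by auto
  show ?thesis
  proof (cases "1 \<le> p \<and> p \<le> 2 \<and> 1 < q \<and> q \<le> 2 \<or> 1 \<le> p \<and> p < \<infinity> \<and> 2 \<le> q")
    case True
    then have "theta p q k = 1" for k
      using assms(5) unfolding theta_domain_def theta_def by (auto simp: less_top[symmetric])
    then show ?thesis using width_lower_finite_exponents[OF assms(1-4) True] unfolding E by auto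
  next
    case False
    then have pq: "1 \<le> p \<and> p \<le> 2 \<and> q = 1 \<or> p = \<infinity> \<and> 2 \<le> q"
      using assms(5) one2 unfolding theta_domain_def by (metis le_less_trans order_trans)
    have "theta p q k = 1 / sqrt (ln (real k))" if "k \<ge> 2" for k
    proof -
      have "theta p q k = ln (real k) powr (- 1 / 2)"
        using pq False one2 unfolding theta_def by (auto simp: less_top[symmetric] top_unique)
      then show ?thesis using that by (simp add: powr_minus powr_half_sqrt inverse_eq_divide)
    qed
    then show ?thesis using width_lower_extreme_exponents[OF assms(1-4) pq] unfolding E by auto
  qed
qed

end
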